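(* Let $\beta>-d/2$ and assume that $$\limsup_{r\to 0} \frac{\operatorname{Vol}(\{x\in W: d(x,\partial W)\leq r\})}{r}<\infty,$$ that $n^2 r_n^d\to\infty$, $n r_n^{d+1}\to0$ and $\min\{n r_n^{d/2+1}a_n,\,r_n/a_n \} \to 0$ as $n\to\infty$, and that, for all $r>0$, $$\int_{W} \mathbf{1}\{d(x,\partial W)\leq r\}\, |g(x)| \, \mathrm{d}x \leq C_{W,g}\, r$$ with some constant $C_{W,g}\in (0,\infty)$. Then the following assertions hold: (a) If $n r_n^{d/2}a_n^2\to \gamma\in[0,\infty)$ as $n\to\infty$, then $$\widetilde{T}_{e,n}(\beta) \overset{\mathcal{D}}{\longrightarrow} \left( Z + \frac{\sqrt{d\kappa_d(2\beta+d)}}{\sqrt{2}(\beta+d)} \,\gamma\int_W g(x)^2 \, \mathrm{d}x \right)^2 \quad \text{as} \quad n\to\infty$$ with $Z \sim N(0,1)$. (b) If $n r_n^{d/2}a_n^2\to \infty$ as $n\to\infty$, then $\widetilde{T}_{e,n}(\beta) \overset{\mathbb{P}}{\longrightarrow}\infty$ as $n\to\infty$. (c) If, additionally, $n^2r_n^{d+2}\to 0$ as $n\to\infty$, then the statements of (a) and (b) also hold with $\widetilde{T}_{a,n}(\beta)$ in place of $\widetilde{T}_{e,n}(\beta)$.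
   Context: Let $d\ge 1$ and let $W\subset\mathbb{R}^d$ be a measurable set with volume (Lebesgue measure) $\operatorname{Vol}(W)=1$. Let $(r_n)$ be a sequence of positive real numbers with $r_n\to0$ as $n\to\infty$. Let $g\in L^3(W)$ (i.e. $g$ measurable on $W$ with $\int_W|g|^3<\infty$) be such that $g\not\equiv0$ (not almost everywhere zero) and $\int_W g(x)\,\mathrm{d}x=0$, and let $(a_n)$ be a positive sequence with $a_n\to0$ as $n\to\infty$, such that $1+a_ng(x)\ge0$ for all $x\in W$ and $n\in\mathbb{N}$; thus $\mathbf{1}_W+a_ng$ is a probability density on $W$. For each $n$ let $\widetilde{X}_1,\ldots,\widetilde{X}_n$ be i.i.d. random vectors with density $\mathbf{1}_W+a_n g$ (a triangular scheme), and let $$\widetilde L_n(\beta):=\frac12\sum_{i\ne j}\mathbf{1}\{\|\widetilde X_i-\widetilde X_j\|\le r_n\}\,\|\widetilde X_i-\widetilde X_j\|^\beta ,$$ the sum being over ordered pairs $(i,j)$ of distinct indices in $\{1,\dots,n\}$ and $\|\cdot\|$ the Euclidean norm. With $\kappa_d=\pi^{d/2}/\Gamma(d/2+1)$ the volume of the $d$-dimensional unit ball, define for $\beta>-d/2$ $$\widetilde T_{e,n}(\beta)=\left(\frac{\widetilde L_n(\beta)- \frac{1}{2}n(n-1)\int_{W^2} \mathbf{1}\{\|x-y\|\leq r_n\} \, \|x-y\|^\beta\, \mathrm{d}(x,y)}{\sqrt{\frac{d\kappa_d}{2(2\beta+d)} }\,n r_n^{\beta+d/2}}\right)^2,$$ $$\widetilde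 T_{a,n}(\beta)=\left(\frac{\widetilde L_n(\beta)-\frac{d\kappa_d}{2(\beta+d)} \, n(n-1) r_n^{\beta+d}}{\sqrt{\frac{d\kappa_d}{2(2\beta+d)} }\,n r_n^{\beta+d/2}}\right)^2.$$ $\partial W$ is the boundary of $W$ and $d(x,A):=\inf_{y\in A}\|x-y\|$. $\overset{\mathcal{D}}{\longrightarrow}$ denotes convergence in distribution; $\overset{\mathbb{P}}{\longrightarrow}\infty$ denotes convergence in probability to infinity (for every $K>0$ the probability of exceeding $K$ tends to $1$). *)

theory Defs
  imports "HOL-Probability.Probability"
begin

text \<open>
  Space dimension: the ambient space is a type of class \<^class>\<open>euclidean_space\<close>,
  and \<open>d = DIM('a) \<ge> 1\<close>; \<open>unit_ball_vol (real DIM('a))\<close> is the constant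
  \<open>\<kappa>\<^sub>d = \<pi>\<^sup>d\<^sup>/\<^sup>2 / \<Gamma>(d/2 + 1)\<close>.
\<close>

text \<open>
  A Borel random vector \<open>X\<close> whose law has density \<open>f\<close> with respect to Lebesgue measure.  The
  library's \<^const>\<open>distributed\<close> over \<^const>\<open>lborel\<close> would require \<open>f\<close> to be Borel measurable; here
  \<open>f\<close> need only be Lebesgue measurable.
\<close>
definition has_lebesgue_density ::
    "'s measure \<Rightarrow> ('s \<Rightarrow> 'a::euclidean_space) \<Rightarrow> ('a \<Rightarrow> real) \<Rightarrow> bool" where
  "has_lebesgue_density M X f \<longleftrightarrow>
     X \<in> borel_measurable M \<and> f \<in> borel_measurable lebesgue \<and> (AE x in lebesgue. 0 \<le> f x) \<and>
     (\<forall>A\<in>sets borel. emeasure M (X -` A \<inter> space M) = (\<integral>\<^sup>+x\<in>A. ennreal (f x) \<partial>lebesgue))"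

text \<open>
  Pitfall: \<open>0 powr \<beta> = 0\<close> for every \<open>\<beta>\<close>, including \<open>\<beta> \<le> 0\<close>.  The value at \<open>x = y\<close> is immaterial:
  the diagonal is a Lebesgue null set, and points with a density coincide with probability zero.
\<close>
definition edge_kernel :: "real \<Rightarrow> real \<Rightarrow> 'a::euclidean_space \<Rightarrow> 'a \<Rightarrow> real" where
  "edge_kernel \<beta> r x y = of_bool (norm (x - y) \<le> r) * norm (x - y) powr \<beta>"

definition edge_length :: "real \<Rightarrow> real \<Rightarrow> nat \<Rightarrow> (nat \<Rightarrow> 'a::euclidean_space) \<Rightarrow> real" where
  "edge_length \<beta> r n x = 1/2 * (\<Sum>i\<in>{1..n}. \<Sum>j\<in>{1..n} - {i}. edge_kernel \<beta> r (x i) (x j))"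

definition edge_scale :: "'a::euclidean_space itself \<Rightarrow> real \<Rightarrow> real \<Rightarrow> nat \<Rightarrow> real" where
  "edge_scale _ \<beta> r n =
     sqrt (real DIM('a) * unit_ball_vol (real DIM('a)) / (2 * (2 * \<beta> + real DIM('a))))
       * real n * r powr (\<beta> + real DIM('a) / 2)"

definition T_exact ::
    "'a::euclidean_space set \<Rightarrow> real \<Rightarrow> real \<Rightarrow> nat \<Rightarrow> (nat \<Rightarrow> 'a) \<Rightarrow> real" where
  "T_exact W \<beta> r n x =
     ((edge_length \<beta> r n x
        - 1/2 * real n * (real n - 1)
            * (\<integral>p. edge_kernel \<beta> r (fst p) (snd p) \<partial>(lebesgue_on W \<Otimes>\<^sub>M lebesgue_on W)))
      / edge_scale TYPE('a) \<beta> r n)\<^sup>2"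

definition T_approx :: "real \<Rightarrow> real \<Rightarrow> nat \<Rightarrow> (nat \<Rightarrow> 'a::euclidean_space) \<Rightarrow> real" where
  "T_approx \<beta> r n x =
     ((edge_length \<beta> r n x
        - real DIM('a) * unit_ball_vol (real DIM('a)) / (2 * (\<beta> + real DIM('a)))
            * real n * (real n - 1) * r powr (\<beta> + real DIM('a)))
      / edge_scale TYPE('a) \<beta> r n)\<^sup>2"

text \<open>The law of \<open>(Z + \<mu>)\<^sup>2\<close> with \<open>Z\<close> standard normal.\<close>
definition shifted_normal_square :: "real \<Rightarrow> real measure" where
  "shifted_normal_square \<mu> = distr std_normal_distribution borel (\<lambda>z. (z + \<mu>)\<^sup>2)"

text \<open>The random variables \<open>T n\<close> may live on different probability spaces \<open>M n\<close>.\<close>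
definition tends_to_infinity_in_prob ::
    "(nat \<Rightarrow> 's measure) \<Rightarrow> (nat \<Rightarrow> 's \<Rightarrow> real) \<Rightarrow> bool" where
  "tends_to_infinity_in_prob M T \<longleftrightarrow>
     (\<forall>K>0. (\<lambda>n. measure (M n) {\<omega> \<in> space (M n). T n \<omega> > K}) \<longlonglongrightarrow> 1)"

end

theory Submission
  imports Defs
begin

text \<open>
  The proof separates the fluctuation of the edge length from the shift of its mean.  Let \<open>k\<close> be the
  kernel \<open>of_bool (norm z \<le> r n) * norm z powr \<beta>\<close>, \<open>w\<close> the indicator of the window and \<open>f = w + a n * g\<close> the
  density of a sample point.  The mean of the edge length is \<open>n * (n - 1) / 2\<close> times \<open>form k f f\<close>, a
  bilinear form, whereas the exact statistic is centred with \<open>form k w w\<close> and the approximate one with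
  the integral of \<open>k\<close>.  In units of the standard deviation \<open>\<sigma> n\<close> the two statistics are therefore
  \<open>(Z n + shift n)\<^sup>2\<close> and \<open>(Z n + shift n + bias n)\<^sup>2\<close>, where \<open>Z n\<close> is the standardised centred edge length
  and the other two terms are deterministic.

  \<^emph>\<open>The fluctuation is asymptotically standard normal\<close> if \<open>n * r n powr (d / 2) * (a n)\<^sup>2\<close> is bounded
  (\<open>char_Z_limit\<close>).  Up to its mean, the edge length is a U-statistic of order two, and Hoeffding's
  decomposition (\<open>hoeffding_decomposition\<close>) splits it into a sum of independent terms and a degenerate
  pair sum.  The first part depends on how much \<open>\<integral>y. k (x - y) * f y\<close> varies with \<open>x\<close>.  This function
  is constant off a boundary layer of width \<open>r n\<close>, apart from a perturbation of order \<open>a n\<close>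
  (\<open>proj_deviation\<close>), so the first part vanishes because \<open>n * r n powr (d + 1)\<close> and
  \<open>n * r n powr d * (a n)\<^sup>2\<close> tend to zero.  The degenerate pair sum is a martingale under the successive
  addition of sample points.  Replacing its increments one after the other by Gaussian factors, as
  in Lindeberg's method, bounds the distance of its characteristic function from the normal one in
  terms of four integrals of the kernel (\<open>char_pair_sum\<close>).  The essential one is the square norm \<open>g2\<close> of
  the iterated kernel, which controls the fluctuations of the conditional variances; it is of lower
  order than the squared variance because \<open>k\<close> is supported in a ball whose volume tends to zero.
  The remaining error terms vanish because \<open>n\<close> and the expected number of edges \<open>n\<^sup>2 * r n powr d\<close> tend
  to infinity.

  These bounds require a bounded kernel.  For a negative exponent the edges shorter than \<open>\<epsilon> * r n\<close> are
  treated separately: by \<open>pair_sum_variance_le\<close>, which holds for square integrable kernels, and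
  \<open>\<beta> > - d / 2\<close>, they contribute only a small fraction of the variance, uniformly in \<open>n\<close>.  All integrals
  of products of three densities are reduced to third moments by the arithmetic-geometric mean
  inequality and translation invariance (\<open>nn_cherry\<close>), which is where \<open>g\<close> in \<open>L\<^sup>3\<close> enters.

  \<^emph>\<open>The shift\<close> is a sum of a term linear in \<open>a n\<close>, with coefficient \<open>form k g w\<close>, and a quadratic term,
  with coefficient \<open>form k g g\<close>.  Since \<open>g\<close> has mean zero, the former only sees the boundary layer
  (\<open>form_g_w\<close>), and the condition on the minimum makes it negligible, either absolutely or compared
  with the quadratic term (\<open>E_le\<close>).  The normalised kernels are an approximate identity, so
  \<open>form k g g\<close> divided by the integral of \<open>k\<close> tends to the integral of \<open>g\<^sup>2\<close> (\<open>form_g_g_limit\<close>).  Hence,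
  up to terms that vanish absolutely or in comparison, \<open>shift n\<close> is a positive constant times
  \<open>n * r n powr (d / 2) * (a n)\<^sup>2\<close>.  If the latter converges, the noncentral limit follows from Levy's continuity theorem
  (\<open>bounded_perturbation_limit\<close>).  If it diverges, the shift outgrows the standard deviation of \<open>Z n\<close>, and
  Chebyshev's inequality gives divergence in probability (\<open>large_perturbation_limit\<close>).  The \<open>bias\<close> is
  again a boundary effect, of order \<open>n * r n powr (d / 2 + 1)\<close>, and tends to zero under the additional
  assumption of the last assertion (\<open>bias_limit\<close>).
\<close>

section \<open>Bounded measurable functions\<close>

text \<open>
  On a probability space these functions form an algebra of integrable functions which is closed
  under substitution and partial integration; this settles every integrability side condition of
  the moment computations for bounded kernels.
\<close>
definition bounded_measurable :: "'b measure \<Rightarrow> ('b \<Rightarrow> real) set" where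
  "bounded_measurable M = {f \<in> borel_measurable M. \<exists>B. \<forall>x\<in>space M. \<bar>f x\<bar> \<le> B}"

named_theorems bm_intros

lemma bm_measurable: "f \<in> bounded_measurable M \<Longrightarrow> f \<in> borel_measurable M"
  by (simp add: bounded_measurable_def)

lemma bm_bound:
  assumes "f \<in> bounded_measurable M"
  obtains B where "B \<ge> 0" "\<And>x. x \<in> space M \<Longrightarrow> \<bar>f x\<bar> \<le> B"
proof -
  obtain B where B: "\<forall>x\<in>space M. \<bar>f x\<bar> \<le> B"
    using assms by (auto simp: bounded_measurable_def)
  show ?thesis
    by (rule that[of "max B 0"]) (use B in \<open>auto simp: le_max_iff_disj\<close>)
qed

lemma bmI:
  assumes "f \<in> borel_measurable M" "\<And>x. x \<in> space M \<Longrightarrow> \<bar>f x\<bar> \<le> B"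
  shows "f \<in> bounded_measurable M"
  using assms by (auto simp: bounded_measurable_def)

lemma bm_const [bm_intros]: "(\<lambda>x. c) \<in> bounded_measurable M"
  by (rule bmI[of _ _ "\<bar>c\<bar>"]) auto

lemma bm_add [bm_intros]:
  assumes "f \<in> bounded_measurable M" "g \<in> bounded_measurable M"
  shows "(\<lambda>x. f x + g x) \<in> bounded_measurable M"
proof -
  obtain B where "\<And>x. x \<in> space M \<Longrightarrow> \<bar>f x\<bar> \<le> B" using bm_bound[OF assms(1)] by blast
  moreover obtain C where "\<And>x. x \<in> space M \<Longrightarrow> \<bar>g x\<bar> \<le> C" using bm_bound[OF assms(2)] by blast
  ultimately show ?thesis
    by (intro bmI[of _ _ "B + C"])
      (use assms in \<open>auto dest!: bm_measurable intro!: order_trans[OF abs_triangle_ineq] add_mono\<close>)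
qed

lemma bm_mult [bm_intros]:
  assumes "f \<in> bounded_measurable M" "g \<in> bounded_measurable M"
  shows "(\<lambda>x. f x * g x) \<in> bounded_measurable M"
proof -
  obtain B where "B \<ge> 0" "\<And>x. x \<in> space M \<Longrightarrow> \<bar>f x\<bar> \<le> B" using bm_bound[OF assms(1)] by blast
  moreover obtain C where "\<And>x. x \<in> space M \<Longrightarrow> \<bar>g x\<bar> \<le> C" using bm_bound[OF assms(2)] by blast
  ultimately show ?thesis
    by (intro bmI[of _ _ "B * C"])
      (use assms in \<open>auto dest!: bm_measurable simp: abs_mult intro!: mult_mono\<close>)
qed

lemma bm_minus [bm_intros]: "f \<in> bounded_measurable M \<Longrightarrow> (\<lambda>x. - f x) \<in> bounded_measurable M"
  by (auto simp: bounded_measurable_def)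

lemma bm_diff [bm_intros]:
  "f \<in> bounded_measurable M \<Longrightarrow> g \<in> bounded_measurable M \<Longrightarrow> (\<lambda>x. f x - g x) \<in> bounded_measurable M"
  using bm_add[OF _ bm_minus, of f M g] by simp

lemma bm_abs [bm_intros]: "f \<in> bounded_measurable M \<Longrightarrow> (\<lambda>x. \<bar>f x\<bar>) \<in> bounded_measurable M"
  by (auto simp: bounded_measurable_def)

lemma bm_power [bm_intros]: "f \<in> bounded_measurable M \<Longrightarrow> (\<lambda>x. f x ^ n) \<in> bounded_measurable M"
  by (induction n) (auto intro: bm_intros)

lemma bm_divide [bm_intros]: "f \<in> bounded_measurable M \<Longrightarrow> (\<lambda>x. f x / c) \<in> bounded_measurable M"
  using bm_mult[OF _ bm_const, of f M "inverse c"] by (simp add: field_simps)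

lemma bm_sum [bm_intros]:
  "(\<And>i. i \<in> I \<Longrightarrow> f i \<in> bounded_measurable M) \<Longrightarrow> (\<lambda>x. \<Sum>i\<in>I. f i x) \<in> bounded_measurable M"
  by (induction I rule: infinite_finite_induct) (auto intro: bm_intros)

lemma bm_comp:
  assumes "f \<in> bounded_measurable N" "g \<in> measurable M N"
  shows "(\<lambda>x. f (g x)) \<in> bounded_measurable M"
proof -
  obtain B where "\<And>x. x \<in> space N \<Longrightarrow> \<bar>f x\<bar> \<le> B" using bm_bound[OF assms(1)] by blast
  then show ?thesis
    by (intro bmI[of _ _ B] measurable_compose[OF assms(2)] bm_measurable[OF assms(1)])
      (use measurable_space[OF assms(2)] in auto)
qed

lemma bm_section:
  assumes "case_prod h \<in> bounded_measurable (M \<Otimes>\<^sub>M N)" "x \<in> space M"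
  shows "h x \<in> bounded_measurable N"
  using bm_comp[OF assms(1), of "\<lambda>y. (x, y)" N] assms(2) by (simp add: measurable_Pair1')

lemma bm_power_uncurried:
  "(\<lambda>(x, y). h x y) \<in> bounded_measurable (M \<Otimes>\<^sub>M N) \<Longrightarrow> (\<lambda>(x, y). h x y ^ n) \<in> bounded_measurable (M \<Otimes>\<^sub>M N)"
  using bm_power[of "case_prod h"] by (simp add: case_prod_beta')

lemma (in finite_measure) bm_integrable: "f \<in> bounded_measurable M \<Longrightarrow> integrable M f"
  by (metis bm_bound bm_measurable AE_I2 integrable_const_bound real_norm_def)

lemma (in prob_space) bm_integral_bound:
  assumes "f \<in> bounded_measurable M" "\<And>x. x \<in> space M \<Longrightarrow> \<bar>f x\<bar> \<le> B"
  shows "\<bar>\<integral>x. f x \<partial>M\<bar> \<le> B"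
proof -
  have i: "integrable M f" by (rule bm_integrable[OF assms(1)])
  have "\<bar>\<integral>x. f x \<partial>M\<bar> \<le> (\<integral>x. \<bar>f x\<bar> \<partial>M)" by (rule integral_abs_bound)
  also have "\<dots> \<le> B" by (rule integral_le_const) (use i assms(2) in auto)
  finally show ?thesis .
qed

lemma (in prob_space) bm_integral:
  assumes "(\<lambda>(x, y). h x y) \<in> bounded_measurable (N \<Otimes>\<^sub>M M)"
  shows "(\<lambda>x. \<integral>y. h x y \<partial>M) \<in> bounded_measurable N"
proof -
  obtain B where B: "\<And>p. p \<in> space (N \<Otimes>\<^sub>M M) \<Longrightarrow> \<bar>case_prod h p\<bar> \<le> B"
    using bm_bound[OF assms] by blast
  show ?thesis
  proof (rule bmI[of _ _ B])
    show "(\<lambda>x. \<integral>y. h x y \<partial>M) \<in> borel_measurable N"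
      using bm_measurable[OF assms] by (rule borel_measurable_lebesgue_integral)
    show "\<bar>\<integral>y. h x y \<partial>M\<bar> \<le> B" if "x \<in> space N" for x
      by (rule bm_integral_bound[OF bm_section[OF assms that]])
        (use B[of "(x, _)"] that in \<open>auto simp: space_pair_measure\<close>)
  qed
qed

lemma (in prob_space) square_integral_le:
  assumes f: "f \<in> bounded_measurable M"
  shows "(\<integral>x. f x \<partial>M)\<^sup>2 \<le> (\<integral>x. (f x)\<^sup>2 \<partial>M)"
proof -
  define m where "m = (\<integral>x. f x \<partial>M)"
  have "0 \<le> (\<integral>x. (f x - m)\<^sup>2 \<partial>M)" by simp
  also have "\<dots> = (\<integral>x. (f x)\<^sup>2 - 2 * m * f x + m\<^sup>2 \<partial>M)"
    by (intro Bochner_Integration.integral_cong) (auto simp: power2_eq_square algebra_simps)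
  also have "\<dots> = (\<integral>x. (f x)\<^sup>2 \<partial>M) - 2 * m * m + m\<^sup>2"
    using f by (simp add: m_def bm_integrable bm_intros prob_space)
  finally show ?thesis by (simp add: m_def power2_eq_square)
qed

lemma (in prob_space) abs_integral_le_sqrt:
  assumes f: "f \<in> bounded_measurable M"
  shows "(\<integral>x. \<bar>f x\<bar> \<partial>M) \<le> sqrt (\<integral>x. (f x)\<^sup>2 \<partial>M)"
  by (rule real_le_rsqrt) (use square_integral_le[OF bm_abs[OF f]] in simp)

lemma (in prob_space) cauchy_schwarz_bm:
  assumes f: "f \<in> bounded_measurable M" and g: "g \<in> bounded_measurable M"
  shows "(\<integral>x. f x * g x \<partial>M)\<^sup>2 \<le> (\<integral>x. (f x)\<^sup>2 \<partial>M) * (\<integral>x. (g x)\<^sup>2 \<partial>M)"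
proof -
  define a b c where "a = (\<integral>x. (f x)\<^sup>2 \<partial>M)" and "b = (\<integral>x. f x * g x \<partial>M)" and "c = (\<integral>x. (g x)\<^sup>2 \<partial>M)"
  have pos: "0 \<le> a * u\<^sup>2 - 2 * b * u * v + c * v\<^sup>2" for u v
  proof -
    have "0 \<le> (\<integral>x. (u * f x - v * g x)\<^sup>2 \<partial>M)" by simp
    also have "\<dots> = (\<integral>x. u\<^sup>2 * (f x)\<^sup>2 - 2 * u * v * (f x * g x) + v\<^sup>2 * (g x)\<^sup>2 \<partial>M)"
      by (intro Bochner_Integration.integral_cong) (auto simp: power2_eq_square algebra_simps)
    also have "\<dots> = u\<^sup>2 * a - 2 * u * v * b + v\<^sup>2 * c"
      using f g by (simp add: a_def b_def c_def bm_integrable bm_intros)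
    finally show ?thesis by (simp add: algebra_simps)
  qed
  have "c \<ge> 0" "a \<ge> 0" by (auto simp: a_def c_def)
  show ?thesis
  proof (cases "c = 0")
    case True
    have "b = 0"
    proof (rule ccontr)
      assume "b \<noteq> 0"
      then show False using pos[of 1 "(a + 1) / (2 * b)"] True by simp
    qed
    then show ?thesis by (simp add: a_def b_def c_def)
  next
    case False
    have "0 \<le> c * (a * c - b\<^sup>2)"
      using pos[of c b] by (simp add: power2_eq_square algebra_simps)
    then have "b\<^sup>2 \<le> a * c" using False \<open>c \<ge> 0\<close> by (simp add: zero_le_mult_iff)
    then show ?thesis by (simp add: a_def b_def c_def)
  qed
qed

section \<open>Pair sums over an i.i.d. sample\<close>

text \<open>
  The U-statistic of order two with kernel \<open>h\<close>, without its normalisation.  Indexing by a set makes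
  it recursive under the insertion of one sample point, which drives all inductions below.
\<close>
definition pair_sum :: "('a \<Rightarrow> 'a \<Rightarrow> real) \<Rightarrow> 'i set \<Rightarrow> ('i \<Rightarrow> 'a) \<Rightarrow> real" where
  "pair_sum h I x = 1/2 * (\<Sum>i\<in>I. \<Sum>j\<in>I - {i}. h (x i) (x j))"

lemma pair_sum_insert:
  assumes "finite I" "k \<notin> I" "\<And>u v. h u v = h v u"
  shows "pair_sum h (insert k I) (x(k := y)) = pair_sum h I x + (\<Sum>i\<in>I. h (x i) y)"
proof -
  have *: "(\<Sum>j\<in>insert k I - {i}. h (x i) ((x(k := y)) j)) = h (x i) y + (\<Sum>j\<in>I - {i}. h (x i) (x j))"
    if "i \<in> I" for i
  proof -
    have "insert k I - {i} = insert k (I - {i})" using assms that by auto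
    moreover have "(\<Sum>j\<in>I - {i}. h (x i) ((x(k := y)) j)) = (\<Sum>j\<in>I - {i}. h (x i) (x j))"
      using assms by (intro sum.cong) auto
    ultimately show ?thesis using assms by simp
  qed
  have "insert k I - {k} = I" using assms by auto
  then have "(\<Sum>i\<in>insert k I. \<Sum>j\<in>insert k I - {i}. h ((x(k := y)) i) ((x(k := y)) j))
     = (\<Sum>j\<in>I. h y ((x(k := y)) j)) + (\<Sum>i\<in>I. \<Sum>j\<in>insert k I - {i}. h ((x(k := y)) i) ((x(k := y)) j))"
    using assms by simp
  also have "(\<Sum>j\<in>I. h y ((x(k := y)) j)) = (\<Sum>j\<in>I. h (x j) y)"
    using assms by (intro sum.cong) auto
  also have "(\<Sum>i\<in>I. \<Sum>j\<in>insert k I - {i}. h ((x(k := y)) i) ((x(k := y)) j))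
     = (\<Sum>i\<in>I. h (x i) y + (\<Sum>j\<in>I - {i}. h (x i) (x j)))"
    by (intro sum.cong refl, subst *[symmetric]) (use assms in auto)
  finally show ?thesis by (simp add: pair_sum_def sum.distrib)
qed

context prob_space
begin

abbreviation sample :: "'i set \<Rightarrow> ('i \<Rightarrow> 'a) measure" where
  "sample I \<equiv> Pi\<^sub>M I (\<lambda>_. M)"

lemma prob_space_sample: "prob_space (sample I)"
  by (rule prob_space_PiM) (rule prob_space_axioms)

lemma product_sigma_finite_const: "product_sigma_finite (\<lambda>_::'i. M)"
  unfolding product_sigma_finite_def using sigma_finite_measure_axioms by simp

lemma bm_component:
  "i \<in> I \<Longrightarrow> \<phi> \<in> bounded_measurable M \<Longrightarrow> (\<lambda>x. \<phi> (x i)) \<in> bounded_measurable (sample I)"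
  by (rule bm_comp) (auto intro: measurable_component_singleton)

lemma bm_component2:
  assumes "i \<in> I" "j \<in> I" "case_prod h \<in> bounded_measurable (M \<Otimes>\<^sub>M M)"
  shows "(\<lambda>x. h (x i) (x j)) \<in> bounded_measurable (sample I)"
  using bm_comp[OF assms(3), of "\<lambda>x. (x i, x j)" "sample I"] assms by simp

lemma bm_pair_sum:
  "case_prod h \<in> bounded_measurable (M \<Otimes>\<^sub>M M) \<Longrightarrow> pair_sum h I \<in> bounded_measurable (sample I)"
  unfolding pair_sum_def by (intro bm_intros bm_component2) auto

lemma bm_row:
  assumes "case_prod h \<in> bounded_measurable (M \<Otimes>\<^sub>M M)"
  shows "(\<lambda>(x, y). \<Sum>i\<in>I. h (x i) y) \<in> bounded_measurable (sample I \<Otimes>\<^sub>M M)"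
proof -
  have "(\<lambda>p. h (fst p i) (snd p)) \<in> bounded_measurable (sample I \<Otimes>\<^sub>M M)" if "i \<in> I" for i
    using bm_comp[OF assms, of "\<lambda>p. (fst p i, snd p)" "sample I \<Otimes>\<^sub>M M"] that by simp
  then show ?thesis unfolding case_prod_beta by (intro bm_intros)
qed

lemma sample_integral_insert:
  assumes "finite I" "k \<notin> I" "F \<in> bounded_measurable (sample (insert k I))"
  shows "(\<integral>x. F x \<partial>sample (insert k I)) = (\<integral>x. \<integral>y. F (x(k := y)) \<partial>M \<partial>sample I)"
proof -
  interpret S: product_sigma_finite "\<lambda>_. M" by (rule product_sigma_finite_const)
  interpret Q: prob_space "sample (insert k I)" by (rule prob_space_sample)
  show ?thesis
    by (rule S.product_integral_insert) (use assms Q.bm_integrable in auto)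
qed

lemma bm_gram_integrand:
  assumes "case_prod h \<in> bounded_measurable (M \<Otimes>\<^sub>M M)"
  shows "(\<lambda>((x, y), z). h x z * h y z) \<in> bounded_measurable ((M \<Otimes>\<^sub>M M) \<Otimes>\<^sub>M M)"
proof -
  have "(\<lambda>p. h (fst (fst p)) (snd p)) \<in> bounded_measurable ((M \<Otimes>\<^sub>M M) \<Otimes>\<^sub>M M)"
    using bm_comp[OF assms, of "\<lambda>p. (fst (fst p), snd p)" "(M \<Otimes>\<^sub>M M) \<Otimes>\<^sub>M M"] by simp
  moreover have "(\<lambda>p. h (snd (fst p)) (snd p)) \<in> bounded_measurable ((M \<Otimes>\<^sub>M M) \<Otimes>\<^sub>M M)"
    using bm_comp[OF assms, of "\<lambda>p. (snd (fst p), snd p)" "(M \<Otimes>\<^sub>M M) \<Otimes>\<^sub>M M"] by simp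
  ultimately show ?thesis unfolding case_prod_beta by (rule bm_mult)
qed

lemma bm_gram:
  assumes "case_prod h \<in> bounded_measurable (M \<Otimes>\<^sub>M M)"
  shows "(\<lambda>(x, y). \<integral>z. h x z * h y z \<partial>M) \<in> bounded_measurable (M \<Otimes>\<^sub>M M)"
  using bm_integral[of "\<lambda>p z. h (fst p) z * h (snd p) z" "M \<Otimes>\<^sub>M M"] bm_gram_integrand[OF assms]
  by (simp add: case_prod_beta')

lemma bm_gram_section:
  assumes "case_prod h \<in> bounded_measurable (M \<Otimes>\<^sub>M M)" and x: "x \<in> space M"
  shows "(\<lambda>(y, z). h x z * h y z) \<in> bounded_measurable (M \<Otimes>\<^sub>M M)"
proof -
  have "(\<lambda>p. ((x, fst p), snd p)) \<in> measurable (M \<Otimes>\<^sub>M M) ((M \<Otimes>\<^sub>M M) \<Otimes>\<^sub>M M)"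
    using x by (intro measurable_Pair measurable_const measurable_fst measurable_snd) auto
  from bm_comp[OF bm_gram_integrand[OF assms(1)] this] show ?thesis by (simp add: case_prod_beta')
qed

lemma bm_row_sum:
  "\<phi> \<in> bounded_measurable M \<Longrightarrow> (\<lambda>x. \<Sum>i\<in>I. \<phi> (x i)) \<in> bounded_measurable (sample I)"
  by (intro bm_intros bm_component) auto

lemma sum_insert_update:
  "finite I \<Longrightarrow> k \<notin> I \<Longrightarrow> (\<Sum>i\<in>insert k I. \<phi> ((x(k := y)) i)) = (\<Sum>i\<in>I. \<phi> (x i)) + \<phi> y"
  by (subst sum.insert, simp, simp, subst sum.cong[of I I _ "\<lambda>i. \<phi> (x i)"]) (auto simp: algebra_simps)

text \<open>
  Moments of sums of centred i.i.d. terms, by induction on the index set: integrating out the newest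
  variable first removes every mixed term in which it occurs to the first power.
\<close>
lemma sample_sum_mean:
  assumes I: "finite I" and \<phi>: "\<phi> \<in> bounded_measurable M" "(\<integral>x. \<phi> x \<partial>M) = 0"
  shows "(\<integral>x. (\<Sum>i\<in>I. \<phi> (x i)) \<partial>sample I) = 0"
  using I
proof (induction I)
  case empty show ?case by simp
next
  case (insert k I)
  have "(\<integral>x. (\<Sum>i\<in>insert k I. \<phi> (x i)) \<partial>sample (insert k I))
      = (\<integral>x. \<integral>y. (\<Sum>i\<in>I. \<phi> (x i)) + \<phi> y \<partial>M \<partial>sample I)"
    by (subst sample_integral_insert)
      (use insert.hyps \<phi> in \<open>auto simp only: sum_insert_update[OF insert.hyps(1,2), where \<phi> = \<phi>] intro!: bm_row_sum\<close>)
  also have "\<dots> = (\<integral>x. (\<Sum>i\<in>I. \<phi> (x i)) \<partial>sample I)"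
    using \<phi> by (simp add: bm_integrable prob_space)
  finally show ?case using insert.IH by simp
qed

lemma sample_sum_sq:
  assumes I: "finite I" and \<phi>: "\<phi> \<in> bounded_measurable M" "(\<integral>x. \<phi> x \<partial>M) = 0"
  shows "(\<integral>x. (\<Sum>i\<in>I. \<phi> (x i))\<^sup>2 \<partial>sample I) = card I * (\<integral>x. (\<phi> x)\<^sup>2 \<partial>M)"
  using I
proof (induction I)
  case empty
  show ?case by simp
next
  case (insert k I)
  interpret Q: prob_space "sample I" by (rule prob_space_sample)
  define S where "S x = (\<Sum>i\<in>I. \<phi> (x i))" for x :: "'b \<Rightarrow> 'a"
  have S: "S \<in> bounded_measurable (sample I)"
    unfolding S_def using \<phi> by (intro bm_row_sum)
  have "(\<integral>x. (\<Sum>i\<in>insert k I. \<phi> (x i))\<^sup>2 \<partial>sample (insert k I)) = (\<integral>x. \<integral>y. (S x + \<phi> y)\<^sup>2 \<partial>M \<partial>sample I)"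
    unfolding S_def
    by (subst sample_integral_insert)
      (use insert.hyps \<phi> in \<open>auto simp only: sum_insert_update[OF insert.hyps(1,2), where \<phi> = \<phi>] intro!: bm_row_sum bm_power\<close>)
  also have "\<dots> = (\<integral>x. (S x)\<^sup>2 + (\<integral>y. (\<phi> y)\<^sup>2 \<partial>M) \<partial>sample I)"
  proof (intro Bochner_Integration.integral_cong refl)
    fix x
    have "(\<integral>y. (S x + \<phi> y)\<^sup>2 \<partial>M) = (\<integral>y. (S x)\<^sup>2 + 2 * S x * \<phi> y + (\<phi> y)\<^sup>2 \<partial>M)"
      by (simp add: power2_sum algebra_simps)
    also have "\<dots> = (S x)\<^sup>2 + (\<integral>y. (\<phi> y)\<^sup>2 \<partial>M)"
      using \<phi> by (simp add: bm_integrable bm_intros prob_space)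
    finally show "(\<integral>y. (S x + \<phi> y)\<^sup>2 \<partial>M) = (S x)\<^sup>2 + (\<integral>y. (\<phi> y)\<^sup>2 \<partial>M)" .
  qed
  also have "\<dots> = (\<integral>x. (S x)\<^sup>2 \<partial>sample I) + (\<integral>y. (\<phi> y)\<^sup>2 \<partial>M)"
    using S by (simp add: Q.bm_integrable bm_intros Q.prob_space)
  finally show ?case using insert by (simp add: S_def algebra_simps)
qed

lemma sample_sum_fourth:
  assumes I: "finite I" and \<phi>: "\<phi> \<in> bounded_measurable M" "(\<integral>x. \<phi> x \<partial>M) = 0"
  shows "(\<integral>x. (\<Sum>i\<in>I. \<phi> (x i))^4 \<partial>sample I)
     \<le> card I * (\<integral>x. (\<phi> x)^4 \<partial>M) + 3 * (real (card I))\<^sup>2 * (\<integral>x. (\<phi> x)\<^sup>2 \<partial>M)\<^sup>2"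
  using I
proof (induction I)
  case empty
  show ?case by simp
next
  case (insert k I)
  interpret Q: prob_space "sample I" by (rule prob_space_sample)
  define S where "S x = (\<Sum>i\<in>I. \<phi> (x i))" for x :: "'b \<Rightarrow> 'a"
  define a where "a n = (\<integral>y. (\<phi> y)^n \<partial>M)" for n
  have S: "S \<in> bounded_measurable (sample I)"
    unfolding S_def using \<phi> by (intro bm_row_sum)
  have "(\<integral>x. (\<Sum>i\<in>insert k I. \<phi> (x i))^4 \<partial>sample (insert k I)) = (\<integral>x. \<integral>y. (S x + \<phi> y)^4 \<partial>M \<partial>sample I)"
    unfolding S_def
    by (subst sample_integral_insert)
      (use insert.hyps \<phi> in \<open>auto simp only: sum_insert_update[OF insert.hyps(1,2), where \<phi> = \<phi>] intro!: bm_row_sum bm_power\<close>)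
  also have "\<dots> = (\<integral>x. S x^4 + 6 * (S x)\<^sup>2 * a 2 + 4 * S x * a 3 + a 4 \<partial>sample I)"
  proof (intro Bochner_Integration.integral_cong refl)
    fix x
    have "(S x + \<phi> y)^4 = S x^4 + 4 * S x^3 * \<phi> y + 6 * (S x)\<^sup>2 * (\<phi> y)\<^sup>2 + 4 * S x * \<phi> y^3 + \<phi> y^4" for y
      by (simp add: eval_nat_numeral algebra_simps)
    then show "(\<integral>y. (S x + \<phi> y)^4 \<partial>M) = S x^4 + 6 * (S x)\<^sup>2 * a 2 + 4 * S x * a 3 + a 4"
      using \<phi> by (simp add: bm_integrable bm_intros prob_space a_def)
  qed
  also have "\<dots> = (\<integral>x. S x^4 \<partial>sample I) + 6 * (\<integral>x. (S x)\<^sup>2 \<partial>sample I) * a 2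
      + 4 * (\<integral>x. S x \<partial>sample I) * a 3 + a 4"
    using S by (simp add: Q.bm_integrable bm_intros Q.prob_space)
  also have "(\<integral>x. S x \<partial>sample I) = 0"
    unfolding S_def by (rule sample_sum_mean[OF insert.hyps(1) \<phi>])
  also have "(\<integral>x. (S x)\<^sup>2 \<partial>sample I) = card I * a 2"
    unfolding S_def a_def by (rule sample_sum_sq[OF insert.hyps(1) \<phi>])
  also have "(\<integral>x. S x^4 \<partial>sample I) + 6 * (card I * a 2) * a 2 + 4 * 0 * a 3 + a 4
      \<le> (card I * a 4 + 3 * (real (card I))\<^sup>2 * (a 2)\<^sup>2) + 6 * (card I * a 2) * a 2 + 4 * 0 * a 3 + a 4"
    using insert.IH by (simp add: S_def a_def)
  also have "\<dots> \<le> (real (card I) + 1) * a 4 + 3 * (real (card I) + 1)\<^sup>2 * (a 2)\<^sup>2"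
    by (simp add: power2_eq_square algebra_simps)
  finally show ?case using insert.hyps by (simp add: a_def add.commute)
qed

end

section \<open>Completely degenerate kernels\<close>

lemma bm_Fubini:
  assumes "prob_space M" "prob_space N" "(\<lambda>(x, y). f x y) \<in> bounded_measurable (M \<Otimes>\<^sub>M N)"
  shows "(\<integral>x. \<integral>y. f x y \<partial>N \<partial>M) = (\<integral>y. \<integral>x. f x y \<partial>M \<partial>N)"
proof -
  interpret M: prob_space M by fact
  interpret N: prob_space N by fact
  interpret P: pair_prob_space M N ..
  show ?thesis
    by (rule P.Fubini_integral[symmetric]) (rule P.P.bm_integrable[OF assms(3)])
qed

text \<open>
  For a degenerate kernel, adding a sample point adds to the pair sum a term of conditional mean zero
  given the other points: the pair sums form a martingale.
\<close>
locale degenerate_kernel = prob_space +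
  fixes H :: "'a \<Rightarrow> 'a \<Rightarrow> real"
  assumes H_bm: "case_prod H \<in> bounded_measurable (M \<Otimes>\<^sub>M M)"
    and H_sym: "\<And>x y. H x y = H y x"
    and H_centred: "\<And>x. x \<in> space M \<Longrightarrow> (\<integral>y. H x y \<partial>M) = 0"
begin

text \<open>
  \<open>gram\<close> is the kernel of the square of the integral operator with kernel \<open>H\<close>; its \<open>L\<^sup>2\<close> norm \<open>g2\<close> is small,
  compared with \<open>m2\<close> squared, exactly when no eigenvalue of that operator dominates.
\<close>
definition Q :: "'a \<Rightarrow> real" where "Q x = (\<integral>y. (H x y)\<^sup>2 \<partial>M)"

definition gram :: "'a \<Rightarrow> 'a \<Rightarrow> real" where "gram x y = (\<integral>z. H x z * H y z \<partial>M)"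

definition m2 :: real where "m2 = (\<integral>x. Q x \<partial>M)"
definition m4 :: real where "m4 = (\<integral>x. \<integral>y. (H x y)^4 \<partial>M \<partial>M)"
definition q2 :: real where "q2 = (\<integral>x. (Q x)\<^sup>2 \<partial>M)"
definition g2 :: real where "g2 = (\<integral>x. \<integral>y. (gram x y)\<^sup>2 \<partial>M \<partial>M)"

lemma H_power_bm: "(\<lambda>(x, y). (H x y)^n) \<in> bounded_measurable (M \<Otimes>\<^sub>M M)"
  by (rule bm_power_uncurried[OF H_bm])

lemma Q_bm: "Q \<in> bounded_measurable M"
  unfolding Q_def by (rule bm_integral) (rule H_power_bm)

lemma gram_bm: "case_prod gram \<in> bounded_measurable (M \<Otimes>\<^sub>M M)"
  unfolding gram_def by (rule bm_gram[OF H_bm])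

lemma gram_sym: "gram x y = gram y x"
  by (simp add: gram_def mult.commute)

lemma gram_centred:
  assumes x: "x \<in> space M"
  shows "(\<integral>y. gram x y \<partial>M) = 0"
proof -
  have "(\<integral>y. gram x y \<partial>M) = (\<integral>z. \<integral>y. H x z * H y z \<partial>M \<partial>M)"
    unfolding gram_def by (rule bm_Fubini[OF prob_space_axioms prob_space_axioms bm_gram_section[OF H_bm x]])
  also have "\<dots> = (\<integral>z. H x z * (\<integral>y. H z y \<partial>M) \<partial>M)"
    by (simp add: H_sym[of _ z for z] cong: Bochner_Integration.integral_cong)
  also have "\<dots> = (\<integral>z. 0 \<partial>M)"
    by (intro Bochner_Integration.integral_cong refl) (simp add: H_centred)
  finally show ?thesis by simp
qed

text \<open>This makes the second moment formula for pair sums below available for \<open>gram\<close> as well.\<close>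
lemma gram_degenerate: "degenerate_kernel M gram"
  by unfold_locales (use gram_bm gram_sym gram_centred in auto)

lemma H_section_bm: "x \<in> space M \<Longrightarrow> H x \<in> bounded_measurable M"
  by (rule bm_section[OF H_bm])

lemma row_bm: "(\<lambda>(x, y). \<Sum>i\<in>I. H (x i) y) \<in> bounded_measurable (sample I \<Otimes>\<^sub>M M)"
  by (rule bm_row[OF H_bm])

lemma row_power_bm: "(\<lambda>(x, y). (\<Sum>i\<in>I. H (x i) y)^n) \<in> bounded_measurable (sample I \<Otimes>\<^sub>M M)"
  by (rule bm_power_uncurried[OF row_bm])

lemma row_centred:
  assumes "x \<in> space (sample I)"
  shows "(\<integral>y. (\<Sum>i\<in>I. H (x i) y) \<partial>M) = 0"
proof -
  have "x i \<in> space M" if "i \<in> I" for i using assms that by (auto simp: space_PiM)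
  then show ?thesis
    by (subst Bochner_Integration.integral_sum) (auto simp: H_centred intro!: bm_integrable H_section_bm)
qed

text \<open>
  The increments of the martingale.  After exchanging the integrals, the newest point is fixed and
  the row is a sum of centred i.i.d. terms.
\<close>
lemma row_sq:
  assumes "finite I"
  shows "(\<integral>x. \<integral>y. (\<Sum>i\<in>I. H (x i) y)\<^sup>2 \<partial>M \<partial>sample I) = card I * m2"
proof -
  have "(\<integral>x. \<integral>y. (\<Sum>i\<in>I. H (x i) y)\<^sup>2 \<partial>M \<partial>sample I) = (\<integral>y. \<integral>x. (\<Sum>i\<in>I. H (x i) y)\<^sup>2 \<partial>sample I \<partial>M)"
    by (rule bm_Fubini[OF prob_space_sample prob_space_axioms row_power_bm])
  also have "\<dots> = (\<integral>y. card I * Q y \<partial>M)"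
  proof (intro Bochner_Integration.integral_cong refl)
    fix y assume y: "y \<in> space M"
    show "(\<integral>x. (\<Sum>i\<in>I. H (x i) y)\<^sup>2 \<partial>sample I) = card I * Q y"
      unfolding Q_def H_sym[of _ y]
      by (rule sample_sum_sq) (use assms y H_section_bm H_centred in auto)
  qed
  finally show ?thesis by (simp add: m2_def)
qed

lemma row_fourth:
  assumes "finite I"
  shows "(\<integral>x. \<integral>y. (\<Sum>i\<in>I. H (x i) y)^4 \<partial>M \<partial>sample I) \<le> card I * m4 + 3 * (real (card I))\<^sup>2 * q2"
proof -
  have bm4: "(\<lambda>y. \<integral>z. (H y z)^4 \<partial>M) \<in> bounded_measurable M"
    by (rule bm_integral) (rule H_power_bm)
  have "(\<integral>x. \<integral>y. (\<Sum>i\<in>I. H (x i) y)^4 \<partial>M \<partial>sample I) = (\<integral>y. \<integral>x. (\<Sum>i\<in>I. H (x i) y)^4 \<partial>sample I \<partial>M)"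
    by (rule bm_Fubini[OF prob_space_sample prob_space_axioms row_power_bm])
  also have "\<dots> \<le> (\<integral>y. card I * (\<integral>z. (H y z)^4 \<partial>M) + 3 * (real (card I))\<^sup>2 * (Q y)\<^sup>2 \<partial>M)"
  proof (intro integral_mono)
    have "(\<lambda>(y, x). (\<Sum>i\<in>I. H (x i) y)^4) \<in> bounded_measurable (M \<Otimes>\<^sub>M sample I)"
      using bm_comp[OF row_power_bm measurable_pair_swap'] by (simp add: case_prod_beta')
    then show "integrable M (\<lambda>y. \<integral>x. (\<Sum>i\<in>I. H (x i) y)^4 \<partial>sample I)"
      by (intro bm_integrable prob_space.bm_integral[OF prob_space_sample])
    show "integrable M (\<lambda>y. card I * (\<integral>z. (H y z)^4 \<partial>M) + 3 * (real (card I))\<^sup>2 * (Q y)\<^sup>2)"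
      by (intro bm_integrable bm_intros bm4 Q_bm)
    fix y assume y: "y \<in> space M"
    show "(\<integral>x. (\<Sum>i\<in>I. H (x i) y)^4 \<partial>sample I)
        \<le> card I * (\<integral>z. (H y z)^4 \<partial>M) + 3 * (real (card I))\<^sup>2 * (Q y)\<^sup>2"
      unfolding Q_def H_sym[of _ y]
      by (rule sample_sum_fourth) (use assms y H_section_bm H_centred in auto)
  qed
  also have "\<dots> = card I * m4 + 3 * (real (card I))\<^sup>2 * q2"
    by (subst Bochner_Integration.integral_add)
      (simp_all add: m4_def q2_def bm_integrable bm_intros bm4 Q_bm)
  finally show ?thesis .
qed

lemma pair_sum_insert_H:
  "finite I \<Longrightarrow> k \<notin> I \<Longrightarrow> pair_sum H (insert k I) (x(k := y)) = pair_sum H I x + (\<Sum>i\<in>I. H (x i) y)"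
  by (rule pair_sum_insert) (auto intro: H_sym)

lemma pair_sum_sq:
  assumes "finite I"
  shows "(\<integral>x. (pair_sum H I x)\<^sup>2 \<partial>sample I) = card I * (real (card I) - 1) / 2 * m2"
  using assms
proof (induction I)
  case empty
  show ?case by (simp add: pair_sum_def)
next
  case (insert k I)
  interpret S: prob_space "sample I" by (rule prob_space_sample)
  define D where "D x y = (\<Sum>i\<in>I. H (x i) y)" for x :: "'b \<Rightarrow> 'a" and y
  have D: "case_prod D \<in> bounded_measurable (sample I \<Otimes>\<^sub>M M)"
    unfolding D_def by (rule row_bm)
  have D2: "(\<lambda>(x, y). (D x y)\<^sup>2) \<in> bounded_measurable (sample I \<Otimes>\<^sub>M M)"
    unfolding D_def by (rule row_power_bm)
  have "(\<integral>x. (pair_sum H (insert k I) x)\<^sup>2 \<partial>sample (insert k I))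
      = (\<integral>x. \<integral>y. (pair_sum H I x + D x y)\<^sup>2 \<partial>M \<partial>sample I)"
    unfolding D_def
    by (subst sample_integral_insert)
      (use insert.hyps in \<open>auto simp only: pair_sum_insert_H[OF insert.hyps(1,2)] intro!: bm_power bm_pair_sum H_bm\<close>)
  also have "\<dots> = (\<integral>x. (pair_sum H I x)\<^sup>2 + (\<integral>y. (D x y)\<^sup>2 \<partial>M) \<partial>sample I)"
  proof (intro Bochner_Integration.integral_cong refl)
    fix x assume x: "x \<in> space (sample I)"
    have Dx: "D x \<in> bounded_measurable M" by (rule bm_section[OF D x])
    have "(\<integral>y. (pair_sum H I x + D x y)\<^sup>2 \<partial>M)
        = (\<integral>y. (pair_sum H I x)\<^sup>2 + 2 * pair_sum H I x * D x y + (D x y)\<^sup>2 \<partial>M)"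
      by (simp add: power2_sum algebra_simps)
    also have "\<dots> = (pair_sum H I x)\<^sup>2 + 2 * pair_sum H I x * (\<integral>y. D x y \<partial>M) + (\<integral>y. (D x y)\<^sup>2 \<partial>M)"
      using Dx by (simp add: bm_integrable bm_intros prob_space)
    also have "(\<integral>y. D x y \<partial>M) = 0" unfolding D_def by (rule row_centred[OF x])
    finally show "(\<integral>y. (pair_sum H I x + D x y)\<^sup>2 \<partial>M) = (pair_sum H I x)\<^sup>2 + (\<integral>y. (D x y)\<^sup>2 \<partial>M)"
      by simp
  qed
  also have "\<dots> = (\<integral>x. (pair_sum H I x)\<^sup>2 \<partial>sample I) + (\<integral>x. \<integral>y. (D x y)\<^sup>2 \<partial>M \<partial>sample I)"
    by (intro Bochner_Integration.integral_add S.bm_integrable bm_power bm_pair_sum H_bm bm_integral D2)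
  also have "(\<integral>x. \<integral>y. (D x y)\<^sup>2 \<partial>M \<partial>sample I) = card I * m2"
    unfolding D_def by (rule row_sq[OF insert.hyps(1)])
  finally show ?case using insert by (simp add: field_simps)
qed

text \<open>
  Expanding the square, the conditional variance of the next increment is a sum of i.i.d. terms \<open>Q\<close>
  from the diagonal plus twice the pair sum of \<open>gram\<close>.  Both parts are centred sums, so they are
  concentrated; this is what replaces a conditional variance condition in the martingale CLT.
\<close>
lemma conditional_variance_deviation:
  assumes I: "finite I"
  shows "(\<integral>x. \<bar>(\<integral>y. (\<Sum>i\<in>I. H (x i) y)\<^sup>2 \<partial>M) - card I * m2\<bar> \<partial>sample I)
    \<le> sqrt (card I * q2) + sqrt 2 * card I * sqrt g2"
proof -
  interpret S: prob_space "sample I" by (rule prob_space_sample)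
  interpret G: degenerate_kernel M gram by (rule gram_degenerate)
  have m2: "G.m2 = g2" by (simp add: g2_def G.m2_def G.Q_def)
  define A where "A x = (\<Sum>i\<in>I. Q (x i) - m2)" for x :: "'b \<Rightarrow> 'a"
  define B where "B x = pair_sum gram I x" for x :: "'b \<Rightarrow> 'a"
  have A_bm: "A \<in> bounded_measurable (sample I)"
    unfolding A_def by (rule bm_row_sum[of "\<lambda>u. Q u - m2"]) (intro bm_intros Q_bm)
  have B_bm: "B \<in> bounded_measurable (sample I)"
    unfolding B_def by (intro bm_pair_sum gram_bm)
  have split: "(\<integral>y. (\<Sum>i\<in>I. H (x i) y)\<^sup>2 \<partial>M) - card I * m2 = A x + 2 * B x"
    if x: "x \<in> space (sample I)" for x
  proof -
    have xi: "x i \<in> space M" if "i \<in> I" for i using x that by (auto simp: space_PiM)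
    have int: "integrable M (\<lambda>y. H (x i) y * H (x j) y)" if "i \<in> I" "j \<in> I" for i j
      using that by (intro bm_integrable bm_intros H_section_bm xi)
    have int2: "integrable M (\<lambda>y. (H (x i) y)\<^sup>2)" if "i \<in> I" for i
      using that by (intro bm_integrable bm_intros H_section_bm xi)
    have "(\<Sum>i\<in>I. H (x i) y)\<^sup>2 = (\<Sum>i\<in>I. (H (x i) y)\<^sup>2 + (\<Sum>j\<in>I - {i}. H (x i) y * H (x j) y))" for y
      unfolding power2_eq_square sum_product
      by (intro sum.cong refl, subst sum.remove[OF I]) auto
    then have "(\<integral>y. (\<Sum>i\<in>I. H (x i) y)\<^sup>2 \<partial>M)
        = (\<integral>y. (\<Sum>i\<in>I. (H (x i) y)\<^sup>2 + (\<Sum>j\<in>I - {i}. H (x i) y * H (x j) y)) \<partial>M)"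
      by (simp only:)
    also have "\<dots> = (\<Sum>i\<in>I. (\<integral>y. (H (x i) y)\<^sup>2 + (\<Sum>j\<in>I - {i}. H (x i) y * H (x j) y) \<partial>M))"
      by (rule Bochner_Integration.integral_sum)
        (intro Bochner_Integration.integrable_add Bochner_Integration.integrable_sum int int2; simp)
    also have "\<dots> = (\<Sum>i\<in>I. (\<integral>y. (H (x i) y)\<^sup>2 \<partial>M) + (\<Sum>j\<in>I - {i}. \<integral>y. H (x i) y * H (x j) y \<partial>M))"
    proof (intro sum.cong refl)
      fix i assume i: "i \<in> I"
      have "(\<integral>y. (\<Sum>j\<in>I - {i}. H (x i) y * H (x j) y) \<partial>M) = (\<Sum>j\<in>I - {i}. \<integral>y. H (x i) y * H (x j) y \<partial>M)"
        by (rule Bochner_Integration.integral_sum) (use i in \<open>auto intro: int\<close>)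
      moreover have "integrable M (\<lambda>y. \<Sum>j\<in>I - {i}. H (x i) y * H (x j) y)"
        by (rule Bochner_Integration.integrable_sum) (use i in \<open>auto intro: int\<close>)
      ultimately show "(\<integral>y. (H (x i) y)\<^sup>2 + (\<Sum>j\<in>I - {i}. H (x i) y * H (x j) y) \<partial>M)
        = (\<integral>y. (H (x i) y)\<^sup>2 \<partial>M) + (\<Sum>j\<in>I - {i}. \<integral>y. H (x i) y * H (x j) y \<partial>M)"
        by (subst Bochner_Integration.integral_add[OF int2[OF i]]) simp_all
    qed
    finally have "(\<integral>y. (\<Sum>i\<in>I. H (x i) y)\<^sup>2 \<partial>M)
        = (\<Sum>i\<in>I. (\<integral>y. (H (x i) y)\<^sup>2 \<partial>M) + (\<Sum>j\<in>I - {i}. \<integral>y. H (x i) y * H (x j) y \<partial>M))" .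
    then show ?thesis
      by (simp add: A_def B_def pair_sum_def Q_def gram_def sum.distrib sum_subtractf)
  qed
  have "(\<integral>x. \<bar>(\<integral>y. (\<Sum>i\<in>I. H (x i) y)\<^sup>2 \<partial>M) - card I * m2\<bar> \<partial>sample I)
      = (\<integral>x. \<bar>A x + 2 * B x\<bar> \<partial>sample I)"
    by (intro Bochner_Integration.integral_cong refl) (simp only: split)
  also have "\<dots> \<le> (\<integral>x. \<bar>A x\<bar> + 2 * \<bar>B x\<bar> \<partial>sample I)"
    by (intro integral_mono S.bm_integrable bm_intros A_bm B_bm) linarith
  also have "\<dots> = (\<integral>x. \<bar>A x\<bar> \<partial>sample I) + 2 * (\<integral>x. \<bar>B x\<bar> \<partial>sample I)"
    by (simp add: S.bm_integrable bm_intros A_bm B_bm)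
  also have "(\<integral>x. \<bar>A x\<bar> \<partial>sample I) \<le> sqrt (card I * q2)"
  proof -
    have "(\<integral>x. (A x)\<^sup>2 \<partial>sample I) = card I * (\<integral>u. (Q u - m2)\<^sup>2 \<partial>M)"
      unfolding A_def by (rule sample_sum_sq[OF I])
        (auto intro!: bm_intros Q_bm simp: m2_def bm_integrable Q_bm prob_space)
    also have "(\<integral>u. (Q u - m2)\<^sup>2 \<partial>M) = (\<integral>u. (Q u)\<^sup>2 - 2 * m2 * Q u + m2\<^sup>2 \<partial>M)"
      by (intro Bochner_Integration.integral_cong) (auto simp: power2_eq_square algebra_simps)
    also have "\<dots> = q2 - m2\<^sup>2"
      using Q_bm by (simp add: q2_def m2_def bm_integrable bm_intros prob_space power2_eq_square)
    also have "card I * (q2 - m2\<^sup>2) \<le> card I * q2" by (intro mult_left_mono) auto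
    finally show ?thesis using S.abs_integral_le_sqrt[OF A_bm] by (meson order_trans real_sqrt_le_mono)
  qed
  also have "(\<integral>x. \<bar>B x\<bar> \<partial>sample I) \<le> sqrt 2 / 2 * card I * sqrt g2"
  proof -
    have "g2 \<ge> 0" by (simp add: g2_def)
    have "(\<integral>x. (B x)\<^sup>2 \<partial>sample I) = card I * (real (card I) - 1) / 2 * g2"
      unfolding B_def using G.pair_sum_sq[OF I] by (simp add: m2)
    also have "\<dots> \<le> (sqrt 2 / 2 * card I * sqrt g2)\<^sup>2"
      using \<open>g2 \<ge> 0\<close> by (simp add: power_mult_distrib power_divide)
        (simp add: power2_eq_square algebra_simps)
    finally have "sqrt (\<integral>x. (B x)\<^sup>2 \<partial>sample I) \<le> sqrt 2 / 2 * card I * sqrt g2"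
      using \<open>g2 \<ge> 0\<close> by (intro real_le_lsqrt) auto
    then show ?thesis using S.abs_integral_le_sqrt[OF B_bm] by linarith
  qed
  finally show ?thesis by simp
qed

end


section \<open>Characteristic functions of degenerate pair sums\<close>

lemma iexp_minus_quadratic: "cmod (iexp x - (1 + \<i> * x - x\<^sup>2 / 2)) \<le> \<bar>x\<bar>^3 / 6" for x :: real
proof -
  have "(\<Sum>k\<le>2. (\<i> * complex_of_real x)^k / fact k) = 1 + \<i> * x - x\<^sup>2 / 2"
    by (simp add: eval_nat_numeral algebra_simps)
  with iexp_approx1[of x 2] show ?thesis by (simp add: eval_nat_numeral)
qed

lemma exp_minus_linear: 
  fixes x :: real assumes "x \<ge> 0" shows "\<bar>1 - x - exp (-x)\<bar> \<le> x\<^sup>2 / 2"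
proof -
  have 1: "1 - x \<le> exp (-x)" using exp_ge_add_one_self[of "-x"] by simp
  have "1 + x + x\<^sup>2 / 2 \<le> exp x" using exp_lower_Taylor_quadratic[OF assms] by simp
  then have "exp (-x) \<le> 1 / (1 + x + x\<^sup>2 / 2)"
    unfolding exp_minus inverse_eq_divide using assms by (intro divide_left_mono mult_pos_pos add_pos_nonneg) auto
  also have "\<dots> \<le> 1 - x + x\<^sup>2 / 2"
  proof -
    have "(1 - x + x\<^sup>2 / 2) * (1 + x + x\<^sup>2 / 2) = 1 + x^4 / 4"
      by (simp add: power2_eq_square eval_nat_numeral algebra_simps)
    then have "1 \<le> (1 - x + x\<^sup>2 / 2) * (1 + x + x\<^sup>2 / 2)" by simp
    moreover have "1 + x + x\<^sup>2 / 2 > 0" using assms by (intro add_pos_nonneg) auto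
    ultimately show ?thesis by (simp only: pos_divide_le_eq)
  qed
  finally show ?thesis using 1 by linarith
qed

lemma (in prob_space) char_centred_approx:
  assumes f: "f \<in> bounded_measurable M" and mean: "(\<integral>x. f x \<partial>M) = 0" and v: "v \<ge> 0"
  shows "cmod ((\<integral>x. iexp (t * f x) \<partial>M) - complex_of_real (exp (- (t\<^sup>2 * v / 2))))
    \<le> t\<^sup>2 / 2 * \<bar>(\<integral>x. (f x)\<^sup>2 \<partial>M) - v\<bar> + \<bar>t\<bar>^3 / 6 * (\<integral>x. \<bar>f x\<bar>^3 \<partial>M) + (t\<^sup>2 * v / 2)\<^sup>2 / 2"
proof -
  have [measurable]: "f \<in> borel_measurable M" by (rule bm_measurable[OF f])
  define w where "w = (\<integral>x. (f x)\<^sup>2 \<partial>M)"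
  have i1: "integrable M (\<lambda>x. iexp (t * f x))"
    by (rule integrable_const_bound[where B = 1]) auto
  have i2: "integrable M (\<lambda>x. complex_of_real (f x))" "integrable M (\<lambda>x. complex_of_real ((f x)\<^sup>2))"
    by (rule integrable_of_real, intro bm_integrable bm_intros f)+
  have m1: "(\<integral>x. complex_of_real (f x) \<partial>M) = 0" using mean by simp
  have m2: "(\<integral>x. complex_of_real ((f x)\<^sup>2) \<partial>M) = w" unfolding w_def by (rule integral_complex_of_real)
  define P where "P x = 1 + \<i> * complex_of_real t * complex_of_real (f x)
      - complex_of_real (t\<^sup>2 / 2) * complex_of_real ((f x)\<^sup>2)" for x
  have Pi: "integrable M P" unfolding P_def using i2 by simp
  have P: "(\<integral>x. P x \<partial>M) = complex_of_real (1 - t\<^sup>2 * w / 2)"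
    unfolding P_def using i2 by (simp add: mean w_def prob_space del: of_real_power)
  have "cmod ((\<integral>x. iexp (t * f x) \<partial>M) - (\<integral>x. P x \<partial>M)) = cmod (\<integral>x. iexp (t * f x) - P x \<partial>M)"
    using i1 Pi by simp
  also have "\<dots> \<le> (\<integral>x. cmod (iexp (t * f x) - P x) \<partial>M)" by (rule integral_norm_bound)
  also have "\<dots> \<le> (\<integral>x. \<bar>t\<bar>^3 / 6 * \<bar>f x\<bar>^3 \<partial>M)"
  proof (intro integral_mono)
    show "integrable M (\<lambda>x. cmod (iexp (t * f x) - P x))" using i1 Pi by simp
    show "integrable M (\<lambda>x. \<bar>t\<bar>^3 / 6 * \<bar>f x\<bar>^3)" by (intro bm_integrable bm_intros f)
    show "cmod (iexp (t * f x) - P x) \<le> \<bar>t\<bar>^3 / 6 * \<bar>f x\<bar>^3" for x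
      using iexp_minus_quadratic[of "t * f x"]
      by (simp add: P_def power_mult_distrib abs_mult mult_ac)
  qed
  finally have 1: "cmod ((\<integral>x. iexp (t * f x) \<partial>M) - complex_of_real (1 - t\<^sup>2 * w / 2))
      \<le> \<bar>t\<bar>^3 / 6 * (\<integral>x. \<bar>f x\<bar>^3 \<partial>M)" by (simp add: P)
  have "\<bar>(1 - t\<^sup>2 * w / 2) - exp (- (t\<^sup>2 * v / 2))\<bar> \<le> \<bar>t\<^sup>2 / 2 * (v - w)\<bar> + \<bar>1 - t\<^sup>2 * v / 2 - exp (- (t\<^sup>2 * v / 2))\<bar>"
    by (rule order_trans[OF _ abs_triangle_ineq]) (simp add: right_diff_distrib diff_divide_distrib)
  also have "\<bar>1 - t\<^sup>2 * v / 2 - exp (- (t\<^sup>2 * v / 2))\<bar> \<le> (t\<^sup>2 * v / 2)\<^sup>2 / 2"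
    using v by (intro exp_minus_linear) auto
  also have "\<bar>t\<^sup>2 / 2 * (v - w)\<bar> = t\<^sup>2 / 2 * \<bar>w - v\<bar>" by (simp add: abs_mult abs_minus_commute)
  finally have 2: "cmod (complex_of_real (1 - t\<^sup>2 * w / 2) - complex_of_real (exp (- (t\<^sup>2 * v / 2))))
      \<le> t\<^sup>2 / 2 * \<bar>w - v\<bar> + (t\<^sup>2 * v / 2)\<^sup>2 / 2"
    by (simp only: of_real_diff[symmetric] norm_of_real)
  from norm_triangle_mono[OF 1 2] show ?thesis by (simp add: w_def)
qed

text \<open>
  One step of the Lindeberg argument.  Adding to \<open>u\<close> an increment \<open>D\<close> of conditional mean zero
  multiplies the characteristic function by almost the Gaussian factor of variance \<open>v\<close>.  Since
  \<open>iexp (t * u x)\<close> has modulus one, only the error given \<open>x\<close> matters.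
\<close>
lemma char_step:
  assumes P: "prob_space P" and N: "prob_space N"
    and u: "u \<in> borel_measurable P" and D: "(\<lambda>(x, y). D x y) \<in> bounded_measurable (P \<Otimes>\<^sub>M N)"
    and mean: "\<And>x. x \<in> space P \<Longrightarrow> (\<integral>y. D x y \<partial>N) = 0" and v: "v \<ge> 0"
  shows "cmod ((\<integral>x. \<integral>y. iexp (t * (u x + D x y)) \<partial>N \<partial>P) - complex_of_real (exp (- (t\<^sup>2 * v / 2))) * (\<integral>x. iexp (t * u x) \<partial>P))
    \<le> t\<^sup>2 / 2 * (\<integral>x. \<bar>(\<integral>y. (D x y)\<^sup>2 \<partial>N) - v\<bar> \<partial>P) + \<bar>t\<bar>^3 / 6 * (\<integral>x. \<integral>y. \<bar>D x y\<bar>^3 \<partial>N \<partial>P)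
      + (t\<^sup>2 * v / 2)\<^sup>2 / 2"
proof -
  interpret P: prob_space P by fact
  interpret N: prob_space N by fact
  note [measurable] = u
  have [measurable]: "(\<lambda>(x, y). D x y) \<in> borel_measurable (P \<Otimes>\<^sub>M N)" by (rule bm_measurable[OF D])
  have D2: "(\<lambda>x. \<integral>y. (D x y)\<^sup>2 \<partial>N) \<in> bounded_measurable P"
    using bm_power[OF D, of 2] by (intro N.bm_integral) (simp add: case_prod_beta')
  have D3: "(\<lambda>x. \<integral>y. \<bar>D x y\<bar>^3 \<partial>N) \<in> bounded_measurable P"
    using bm_power[OF bm_abs[OF D], of 3] by (intro N.bm_integral) (simp add: case_prod_beta')
  define E where "E x = (\<integral>y. iexp (t * D x y) \<partial>N)" for x
  define c where "c = complex_of_real (exp (- (t\<^sup>2 * v / 2)))"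
  have E1: "cmod (E x) \<le> 1" for x
    unfolding E_def by (rule order_trans[OF integral_norm_bound]) (simp add: N.prob_space)
  have Em [measurable]: "E \<in> borel_measurable P" unfolding E_def by measurable
  have iE: "integrable P (\<lambda>x. iexp (t * u x) * E x)"
    by (rule P.integrable_const_bound[where B = 1]) (auto simp: norm_mult E1)
  have iu: "integrable P (\<lambda>x. c * iexp (t * u x))"
    by (rule P.integrable_const_bound[where B = "cmod c"]) (auto simp: norm_mult)
  have "(\<integral>x. \<integral>y. iexp (t * (u x + D x y)) \<partial>N \<partial>P) = (\<integral>x. iexp (t * u x) * E x \<partial>P)"
    unfolding E_def by (simp add: distrib_left exp_add)
  then have "cmod ((\<integral>x. \<integral>y. iexp (t * (u x + D x y)) \<partial>N \<partial>P) - c * (\<integral>x. iexp (t * u x) \<partial>P))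
      = cmod (\<integral>x. iexp (t * u x) * E x - c * iexp (t * u x) \<partial>P)"
    using iE iu by simp
  also have "\<dots> \<le> (\<integral>x. cmod (iexp (t * u x) * E x - c * iexp (t * u x)) \<partial>P)" by (rule integral_norm_bound)
  also have "\<dots> = (\<integral>x. cmod (E x - c) \<partial>P)"
  proof -
    have "cmod (iexp (t * u x) * E x - c * iexp (t * u x)) = cmod (E x - c)" for x
    proof -
      have "iexp (t * u x) * E x - c * iexp (t * u x) = iexp (t * u x) * (E x - c)"
        by (simp add: algebra_simps)
      then show ?thesis by (simp only: norm_mult norm_exp_i_times mult_1)
    qed
    then show ?thesis by simp
  qed
  also have "\<dots> \<le> (\<integral>x. t\<^sup>2 / 2 * \<bar>(\<integral>y. (D x y)\<^sup>2 \<partial>N) - v\<bar> + \<bar>t\<bar>^3 / 6 * (\<integral>y. \<bar>D x y\<bar>^3 \<partial>N)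
      + (t\<^sup>2 * v / 2)\<^sup>2 / 2 \<partial>P)"
  proof (intro integral_mono)
    show "integrable P (\<lambda>x. cmod (E x - c))"
      by (rule P.integrable_const_bound[where B = "1 + cmod c"])
        (use E1 in \<open>auto intro!: order_trans[OF norm_triangle_ineq4]\<close>)
    show "integrable P (\<lambda>x. t\<^sup>2 / 2 * \<bar>(\<integral>y. (D x y)\<^sup>2 \<partial>N) - v\<bar> + \<bar>t\<bar>^3 / 6 * (\<integral>y. \<bar>D x y\<bar>^3 \<partial>N)
      + (t\<^sup>2 * v / 2)\<^sup>2 / 2)" by (intro P.bm_integrable bm_intros D2 D3)
    fix x assume x: "x \<in> space P"
    show "cmod (E x - c) \<le> t\<^sup>2 / 2 * \<bar>(\<integral>y. (D x y)\<^sup>2 \<partial>N) - v\<bar> + \<bar>t\<bar>^3 / 6 * (\<integral>y. \<bar>D x y\<bar>^3 \<partial>N)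
      + (t\<^sup>2 * v / 2)\<^sup>2 / 2"
      unfolding E_def c_def by (rule N.char_centred_approx[OF bm_section[OF D x] mean[OF x] v])
  qed
  also have "\<dots> = t\<^sup>2 / 2 * (\<integral>x. \<bar>(\<integral>y. (D x y)\<^sup>2 \<partial>N) - v\<bar> \<partial>P) + \<bar>t\<bar>^3 / 6 * (\<integral>x. \<integral>y. \<bar>D x y\<bar>^3 \<partial>N \<partial>P)
      + (t\<^sup>2 * v / 2)\<^sup>2 / 2"
    using D2 D3 by (simp add: P.bm_integrable bm_intros P.prob_space)
  finally show ?thesis unfolding c_def .
qed


lemma (in prob_space) sample_integral_insert_complex:
  fixes F :: "('i \<Rightarrow> 'a) \<Rightarrow> complex"
  assumes "finite I" "k \<notin> I" "F \<in> borel_measurable (sample (insert k I))" "\<And>x. cmod (F x) \<le> B"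
  shows "(\<integral>x. F x \<partial>sample (insert k I)) = (\<integral>x. \<integral>y. F (x(k := y)) \<partial>M \<partial>sample I)"
proof -
  interpret S: product_sigma_finite "\<lambda>_. M" by (rule product_sigma_finite_const)
  interpret Q: prob_space "sample (insert k I)" by (rule prob_space_sample)
  show ?thesis
    by (rule S.product_integral_insert) (use assms in \<open>auto intro!: Q.integrable_const_bound[where B = B]\<close>)
qed

context degenerate_kernel
begin

lemma m2_nonneg: "m2 \<ge> 0" and m4_nonneg: "m4 \<ge> 0" and q2_nonneg: "q2 \<ge> 0" and g2_nonneg: "g2 \<ge> 0"
  by (auto simp: m2_def Q_def m4_def q2_def g2_def intro!: integral_nonneg_AE)

lemma m2_sq_le: "m2\<^sup>2 \<le> q2"
  unfolding m2_def q2_def by (rule square_integral_le[OF Q_bm])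

text \<open>
  A third absolute moment is interpolated between the second and the fourth; \<open>\<delta>\<close> is the
  truncation level in Lindeberg's condition, at which the two are balanced.
\<close>
lemma row_third:
  assumes I: "finite I" and \<delta>: "\<delta> > 0"
  shows "(\<integral>x. \<integral>y. \<bar>\<Sum>i\<in>I. H (x i) y\<bar>^3 \<partial>M \<partial>sample I)
    \<le> (\<delta> * (card I * m2) + (card I * m4 + 3 * (real (card I))\<^sup>2 * q2) / \<delta>) / 2"
proof -
  interpret S: prob_space "sample I" by (rule prob_space_sample)
  define D where "D x y = (\<Sum>i\<in>I. H (x i) y)" for x :: "'b \<Rightarrow> 'a" and y
  have D: "case_prod D \<in> bounded_measurable (sample I \<Otimes>\<^sub>M M)" unfolding D_def by (rule row_bm)
  have Dn: "(\<lambda>(x, y). (D x y)^n) \<in> bounded_measurable (sample I \<Otimes>\<^sub>M M)" for n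
    unfolding D_def by (rule row_power_bm)
  have D3: "(\<lambda>(x, y). \<bar>D x y\<bar>^3) \<in> bounded_measurable (sample I \<Otimes>\<^sub>M M)"
    using bm_power[OF bm_abs[OF D], of 3] by (simp add: case_prod_beta')
  have AM_GM: "\<bar>d\<bar>^3 \<le> \<delta> / 2 * d\<^sup>2 + 1 / (2 * \<delta>) * d^4" for d :: real
  proof -
    have "0 \<le> (\<delta> - \<bar>d\<bar>)\<^sup>2 * d\<^sup>2" by simp
    also have "\<dots> = \<delta>\<^sup>2 * d\<^sup>2 + d^4 - 2 * \<delta> * \<bar>d\<bar>^3"
      by (cases "d \<ge> 0") (simp_all add: power2_eq_square eval_nat_numeral algebra_simps)
    finally show ?thesis using \<delta> by (simp add: field_simps power2_eq_square)
  qed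
  have "(\<integral>x. \<integral>y. \<bar>D x y\<bar>^3 \<partial>M \<partial>sample I)
      \<le> (\<integral>x. \<delta> / 2 * (\<integral>y. (D x y)\<^sup>2 \<partial>M) + 1 / (2 * \<delta>) * (\<integral>y. (D x y)^4 \<partial>M) \<partial>sample I)"
  proof (intro integral_mono)
    show "integrable (sample I) (\<lambda>x. \<integral>y. \<bar>D x y\<bar>^3 \<partial>M)"
      by (intro S.bm_integrable bm_integral D3)
    show "integrable (sample I) (\<lambda>x. \<delta> / 2 * (\<integral>y. (D x y)\<^sup>2 \<partial>M) + 1 / (2 * \<delta>) * (\<integral>y. (D x y)^4 \<partial>M))"
      by (intro S.bm_integrable bm_intros bm_integral Dn)
    fix x assume x: "x \<in> space (sample I)"
    have Dx: "D x \<in> bounded_measurable M" by (rule bm_section[OF D x])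
    have "(\<integral>y. \<bar>D x y\<bar>^3 \<partial>M) \<le> (\<integral>y. \<delta> / 2 * (D x y)\<^sup>2 + 1 / (2 * \<delta>) * (D x y)^4 \<partial>M)"
      by (intro integral_mono bm_integrable bm_intros Dx AM_GM)
    also have "\<dots> = \<delta> / 2 * (\<integral>y. (D x y)\<^sup>2 \<partial>M) + 1 / (2 * \<delta>) * (\<integral>y. (D x y)^4 \<partial>M)"
      by (subst Bochner_Integration.integral_add) (simp_all only: bm_integrable bm_intros Dx integral_mult_right_zero)
    finally show "(\<integral>y. \<bar>D x y\<bar>^3 \<partial>M) \<le> \<dots>" .
  qed
  also have "\<dots> = \<delta> / 2 * (\<integral>x. \<integral>y. (D x y)\<^sup>2 \<partial>M \<partial>sample I) + 1 / (2 * \<delta>) * (\<integral>x. \<integral>y. (D x y)^4 \<partial>M \<partial>sample I)"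
    by (subst Bochner_Integration.integral_add)
      (simp_all only: S.bm_integrable bm_intros bm_integral Dn integral_mult_right_zero)
  also have "\<dots> \<le> \<delta> / 2 * (card I * m2) + 1 / (2 * \<delta>) * (card I * m4 + 3 * (real (card I))\<^sup>2 * q2)"
    using row_sq[OF I] row_fourth[OF I] \<delta>
    by (intro add_mono mult_left_mono) (auto simp: D_def)
  finally show ?thesis using \<delta> by (simp add: D_def field_simps)
qed

text \<open>The error of one step of the Lindeberg argument for a sample of size at most \<open>n\<close>.\<close>
definition char_error :: "real \<Rightarrow> real \<Rightarrow> real \<Rightarrow> real" where
  "char_error t \<delta> n = t\<^sup>2 / 2 * (sqrt (n * q2) + sqrt 2 * n * sqrt g2)
     + \<bar>t\<bar>^3 / 6 * ((\<delta> * (n * m2) + (n * m4 + 3 * n\<^sup>2 * q2) / \<delta>) / 2) + t^4 / 8 * (n\<^sup>2 * q2)"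

lemma char_error_mono:
  assumes "0 \<le> m" "m \<le> n" "\<delta> > 0"
  shows "char_error t \<delta> m \<le> char_error t \<delta> n"
  unfolding char_error_def using assms m2_nonneg m4_nonneg q2_nonneg g2_nonneg
  by (intro add_mono mult_left_mono mult_right_mono divide_right_mono real_sqrt_le_mono power_mono) auto

text \<open>
  Quantitative central limit theorem for degenerate pair sums.  The induction replaces one increment
  after the other by its Gaussian factor; the factors have modulus at most one, so the errors of the
  steps just add up.
\<close>
theorem char_pair_sum:
  assumes I: "finite I" and n: "real (card I) \<le> n" and \<delta>: "\<delta> > 0"
  shows "cmod ((\<integral>x. iexp (t * pair_sum H I x) \<partial>sample I)
      - complex_of_real (exp (- (t\<^sup>2 * (card I * (real (card I) - 1) / 2 * m2) / 2))))
    \<le> card I * char_error t \<delta> n"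
  using I n
proof (induction I)
  case empty
  interpret S: prob_space "sample {}" by (rule prob_space_sample)
  show ?case by (simp add: pair_sum_def S.prob_space)
next
  case (insert k I)
  interpret S: prob_space "sample I" by (rule prob_space_sample)
  define m where "m = real (card I)"
  have m: "m \<ge> 0" "m \<le> n" "real (card (insert k I)) = m + 1"
    using insert by (auto simp: m_def)
  define D where "D x y = (\<Sum>i\<in>I. H (x i) y)" for x :: "'b \<Rightarrow> 'a" and y
  define \<psi> where "\<psi> = (\<integral>x. iexp (t * pair_sum H I x) \<partial>sample I)"
  define \<psi>' where "\<psi>' = (\<integral>x. iexp (t * pair_sum H (insert k I) x) \<partial>sample (insert k I))"
  define c where "c = exp (- (t\<^sup>2 * (m * m2) / 2))"
  define e where "e = exp (- (t\<^sup>2 * (m * (m - 1) / 2 * m2) / 2))"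
  have meas: "pair_sum H J \<in> borel_measurable (sample J)" for J :: "'b set"
    by (rule bm_measurable[OF bm_pair_sum[OF H_bm]])
  have meas': "(\<lambda>x. iexp (t * pair_sum H J x)) \<in> borel_measurable (sample J)" for J :: "'b set"
    using meas[of J] by measurable
  have step: "\<psi>' = (\<integral>x. \<integral>y. iexp (t * (pair_sum H I x + D x y)) \<partial>M \<partial>sample I)"
    unfolding D_def \<psi>'_def
    by (subst sample_integral_insert_complex[where B = 1])
      (use insert.hyps meas' in \<open>auto simp only: pair_sum_insert_H[OF insert.hyps(1,2)] norm_exp_i_times\<close>)
  have "cmod (\<psi>' - complex_of_real c * \<psi>)
    \<le> t\<^sup>2 / 2 * (\<integral>x. \<bar>(\<integral>y. (D x y)\<^sup>2 \<partial>M) - m * m2\<bar> \<partial>sample I) + \<bar>t\<bar>^3 / 6 * (\<integral>x. \<integral>y. \<bar>D x y\<bar>^3 \<partial>M \<partial>sample I)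
      + (t\<^sup>2 * (m * m2) / 2)\<^sup>2 / 2"
    unfolding step \<psi>_def c_def
    by (rule char_step[OF S.prob_space_axioms prob_space_axioms meas])
      (use m m2_nonneg in \<open>auto simp: D_def row_bm row_centred\<close>)
  also have "\<dots> \<le> char_error t \<delta> m"
  proof -
    have "(t\<^sup>2 * (m * m2) / 2)\<^sup>2 / 2 = t^4 / 8 * (m\<^sup>2 * m2\<^sup>2)"
      by (simp add: power_mult_distrib power_divide)
    also have "\<dots> \<le> t^4 / 8 * (m\<^sup>2 * q2)" by (intro mult_left_mono m2_sq_le) auto
    finally show ?thesis
      unfolding char_error_def D_def m_def
      using row_third[OF insert.hyps(1) \<delta>] conditional_variance_deviation[OF insert.hyps(1)]
      by (intro add_mono mult_left_mono) auto
  qed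
  also have "\<dots> \<le> char_error t \<delta> n" by (rule char_error_mono) (use m \<delta> in auto)
  finally have 1: "cmod (\<psi>' - complex_of_real c * \<psi>) \<le> char_error t \<delta> n" .
  have "c \<le> 1" using m m2_nonneg by (simp add: c_def)
  moreover have "c \<ge> 0" by (simp add: c_def)
  ultimately have "cmod (complex_of_real c * \<psi> - complex_of_real c * complex_of_real e) \<le> cmod (\<psi> - complex_of_real e)"
    by (simp add: norm_mult right_diff_distrib[symmetric] mult_left_le_one_le)
  also have "\<dots> \<le> m * char_error t \<delta> n"
    using insert.IH m unfolding \<psi>_def e_def m_def by simp
  finally have 2: "cmod (complex_of_real c * \<psi> - complex_of_real c * complex_of_real e) \<le> m * char_error t \<delta> n" .
  have ce: "complex_of_real c * complex_of_real e = complex_of_real (exp (- (t\<^sup>2 * ((m + 1) * (m + 1 - 1) / 2 * m2) / 2)))"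
    unfolding c_def e_def of_real_mult[symmetric] exp_add[symmetric] by (simp add: field_simps)
  have "cmod (\<psi>' - complex_of_real c * complex_of_real e) \<le> char_error t \<delta> n + m * char_error t \<delta> n"
    using norm_triangle_mono[OF 1 2] by simp
  then show ?case unfolding ce m(3) \<psi>'_def by (simp add: algebra_simps)
qed

end

section \<open>Hoeffding decomposition of bounded kernels\<close>

locale bounded_kernel = prob_space +
  fixes h :: "'a \<Rightarrow> 'a \<Rightarrow> real" and B :: real
  assumes h_measurable: "case_prod h \<in> borel_measurable (M \<Otimes>\<^sub>M M)"
    and h_sym: "\<And>x y. h x y = h y x"
    and h_nonneg: "\<And>x y. h x y \<ge> 0" and h_le: "\<And>x y. h x y \<le> B"
begin

text \<open>
  \<open>proj\<close> is the first-order (Hajek) projection of the kernel and \<open>residual\<close> the degenerate kernel that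
  remains after subtracting both projections.
\<close>
definition proj :: "'a \<Rightarrow> real" where "proj x = (\<integral>y. h x y \<partial>M)"
definition mean :: real where "mean = (\<integral>x. proj x \<partial>M)"
definition residual :: "'a \<Rightarrow> 'a \<Rightarrow> real" where "residual x y = h x y - (proj x + proj y - mean)"
definition sq :: "'a \<Rightarrow> real" where "sq x = (\<integral>y. (h x y)\<^sup>2 \<partial>M)"

lemma h_bm: "case_prod h \<in> bounded_measurable (M \<Otimes>\<^sub>M M)"
  by (rule bmI[OF h_measurable, of B]) (use h_nonneg h_le in auto)

lemma h_section_bm: "x \<in> space M \<Longrightarrow> h x \<in> bounded_measurable M"
  by (rule bm_section[OF h_bm])

lemma proj_bm: "proj \<in> bounded_measurable M"
  unfolding proj_def by (rule bm_integral[OF h_bm])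

lemma h_sq_bm: "(\<lambda>(x, y). (h x y)\<^sup>2) \<in> bounded_measurable (M \<Otimes>\<^sub>M M)"
  by (rule bm_power_uncurried[OF h_bm])

lemma sq_bm: "sq \<in> bounded_measurable M"
  unfolding sq_def by (rule bm_integral[OF h_sq_bm])

lemma fst_bm: "\<phi> \<in> bounded_measurable M \<Longrightarrow> (\<lambda>p. \<phi> (fst p)) \<in> bounded_measurable (M \<Otimes>\<^sub>M M)"
  by (erule bm_comp) simp

lemma snd_bm: "\<phi> \<in> bounded_measurable M \<Longrightarrow> (\<lambda>p. \<phi> (snd p)) \<in> bounded_measurable (M \<Otimes>\<^sub>M M)"
  by (erule bm_comp) simp

lemma rho_bm: "(\<lambda>(x, y). proj x + proj y - mean) \<in> bounded_measurable (M \<Otimes>\<^sub>M M)"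
  unfolding case_prod_beta by (intro bm_intros fst_bm snd_bm proj_bm)

lemma residual_bm: "case_prod residual \<in> bounded_measurable (M \<Otimes>\<^sub>M M)"
  using bm_diff[OF h_bm rho_bm] by (simp add: residual_def case_prod_beta')

lemma residual_sym: "residual x y = residual y x"
  by (simp add: residual_def h_sym[of x y] add.commute)

lemma residual_centred: "x \<in> space M \<Longrightarrow> (\<integral>y. residual x y \<partial>M) = 0"
  using h_section_bm[of x] proj_bm
  by (simp add: residual_def bm_integrable bm_intros prob_space proj_def[symmetric] mean_def[symmetric])

sublocale R: degenerate_kernel M residual
  by unfold_locales (auto simp: residual_bm residual_centred intro: residual_sym)

lemma hoeffding_decomposition:
  assumes "finite I"
  shows "pair_sum h I x - card I * (real (card I) - 1) / 2 * mean
    = pair_sum residual I x + (real (card I) - 1) * (\<Sum>i\<in>I. proj (x i) - mean)"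
proof -
  define c where "c = real (card I)"
  define S where "S = (\<Sum>i\<in>I. proj (x i))"
  have card: "real (card (I - {i})) = c - 1" if "i \<in> I" for i
  proof -
    have "card I \<ge> 1" using that assms by (metis card_0_eq empty_iff less_one not_less)
    then show ?thesis using that assms by (simp add: c_def card_Diff_singleton of_nat_diff)
  qed
  have 1: "(\<Sum>i\<in>I. \<Sum>j\<in>I - {i}. proj (x i) + proj (x j) - mean) = (\<Sum>i\<in>I. (c - 1) * proj (x i) + (S - proj (x i)) - (c - 1) * mean)"
  proof (intro sum.cong refl)
    fix i assume i: "i \<in> I"
    have "(\<Sum>j\<in>I - {i}. proj (x j)) = S - proj (x i)"
      unfolding S_def using i assms by (simp add: sum_diff1)
    then show "(\<Sum>j\<in>I - {i}. proj (x i) + proj (x j) - mean) = (c - 1) * proj (x i) + (S - proj (x i)) - (c - 1) * mean"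
      by (simp add: sum.distrib sum_subtractf card[OF i])
  qed
  have 2: "(\<Sum>i\<in>I. (c - 1) * proj (x i) + (S - proj (x i)) - (c - 1) * mean) = 2 * (c - 1) * S - c * (c - 1) * mean"
    by (simp add: sum.distrib sum_subtractf sum_distrib_left[symmetric] S_def[symmetric] c_def[symmetric] algebra_simps)
  have "pair_sum residual I x = pair_sum h I x - 1/2 * (\<Sum>i\<in>I. \<Sum>j\<in>I - {i}. proj (x i) + proj (x j) - mean)"
    by (simp only: pair_sum_def residual_def sum_subtractf right_diff_distrib)
  then show ?thesis
    unfolding 1 2 by (simp add: sum_subtractf c_def[symmetric] S_def[symmetric] field_simps)
qed

definition a2 :: real where "a2 = (\<integral>x. sq x \<partial>M)"
definition v1 :: real where "v1 = (\<integral>x. (proj x)\<^sup>2 \<partial>M)"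

lemma proj_nonneg: "proj x \<ge> 0"
  unfolding proj_def by (intro integral_nonneg_AE) (simp add: h_nonneg)

lemma proj_le: "x \<in> space M \<Longrightarrow> proj x \<le> B"
  using bm_integral_bound[OF h_section_bm, of x B] h_nonneg h_le by (simp add: proj_def abs_le_iff)

lemma sq_nonneg: "sq x \<ge> 0"
  unfolding sq_def by simp

lemma proj_sq_le: "x \<in> space M \<Longrightarrow> (proj x)\<^sup>2 \<le> sq x"
  unfolding proj_def sq_def by (rule square_integral_le[OF h_section_bm])

lemma v1_le: "v1 \<le> a2"
  unfolding v1_def a2_def
  by (intro integral_mono bm_integrable bm_intros proj_bm sq_bm proj_sq_le)

lemma v1_nonneg: "v1 \<ge> 0" and a2_nonneg: "a2 \<ge> 0"
  by (auto simp: v1_def a2_def intro!: integral_nonneg_AE sq_nonneg)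

lemma mean_sq_le: "mean\<^sup>2 \<le> v1"
  unfolding mean_def v1_def by (rule square_integral_le[OF proj_bm])

lemma integral_rho_sq:
  "(\<integral>x. \<integral>y. (proj x + proj y - mean)\<^sup>2 \<partial>M \<partial>M) = 2 * v1 - mean\<^sup>2"
proof -
  have "(\<integral>y. (proj x + proj y - mean)\<^sup>2 \<partial>M) = (proj x)\<^sup>2 + v1 - mean\<^sup>2" for x
  proof -
    have "(\<integral>y. (proj x + proj y - mean)\<^sup>2 \<partial>M)
        = (\<integral>y. (proj x - mean)\<^sup>2 + 2 * (proj x - mean) * proj y + (proj y)\<^sup>2 \<partial>M)"
      by (intro Bochner_Integration.integral_cong) (auto simp: power2_eq_square algebra_simps)
    also have "\<dots> = (proj x - mean)\<^sup>2 + 2 * (proj x - mean) * mean + v1"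
      by (simp add: bm_integrable bm_intros proj_bm prob_space mean_def v1_def)
    finally show ?thesis by (simp add: power2_eq_square algebra_simps)
  qed
  then show ?thesis
    by (simp add: bm_integrable bm_intros proj_bm prob_space v1_def[symmetric])
qed

text \<open>Pythagoras: the residual is orthogonal to the projections in \<open>L\<^sup>2\<close>.\<close>
lemma m2_eq: "R.m2 = a2 - 2 * v1 + mean\<^sup>2"
proof -
  have 1: "R.Q x = sq x - (proj x)\<^sup>2 - 2 * (\<integral>y. h x y * proj y \<partial>M) + v1 + 2 * mean * proj x - mean\<^sup>2"
    if x: "x \<in> space M" for x
  proof -
    have "R.Q x = (\<integral>y. (h x y)\<^sup>2 - 2 * (proj x - mean) * h x y - 2 * (h x y * proj y)
        + ((proj x - mean)\<^sup>2 + 2 * (proj x - mean) * proj y + (proj y)\<^sup>2) \<partial>M)"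
      unfolding R.Q_def residual_def
      by (intro Bochner_Integration.integral_cong) (auto simp: power2_eq_square algebra_simps)
    also have "\<dots> = sq x - 2 * (proj x - mean) * proj x - 2 * (\<integral>y. h x y * proj y \<partial>M)
        + ((proj x - mean)\<^sup>2 + 2 * (proj x - mean) * mean + v1)"
      using h_section_bm[OF x]
      by (simp add: bm_integrable bm_intros proj_bm prob_space mean_def v1_def sq_def proj_def[symmetric])
    finally show ?thesis by (simp add: power2_eq_square algebra_simps)
  qed
  have bm: "(\<lambda>(x, y). h x y * proj y) \<in> bounded_measurable (M \<Otimes>\<^sub>M M)"
    using bm_mult[OF h_bm snd_bm[OF proj_bm]] by (simp add: case_prod_beta')
  have bm': "(\<lambda>x. \<integral>y. h x y * proj y \<partial>M) \<in> bounded_measurable M"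
    by (rule bm_integral[OF bm])
  have "(\<integral>x. \<integral>y. h x y * proj y \<partial>M \<partial>M) = (\<integral>y. \<integral>x. h x y * proj y \<partial>M \<partial>M)"
    by (rule bm_Fubini[OF prob_space_axioms prob_space_axioms bm])
  also have "\<dots> = (\<integral>y. (proj y)\<^sup>2 \<partial>M)"
    by (simp add: h_sym[of _ y for y] proj_def[symmetric] power2_eq_square)
  finally have 2: "(\<integral>x. \<integral>y. h x y * proj y \<partial>M \<partial>M) = v1" by (simp add: v1_def)
  have "R.m2 = (\<integral>x. sq x - (proj x)\<^sup>2 - 2 * (\<integral>y. h x y * proj y \<partial>M) + v1 + 2 * mean * proj x - mean\<^sup>2 \<partial>M)"
    unfolding R.m2_def by (intro Bochner_Integration.integral_cong refl 1)
  also have "\<dots> = a2 - v1 - 2 * v1 + v1 + 2 * mean * mean - mean\<^sup>2"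
    by (simp add: bm_integrable bm_intros proj_bm sq_bm bm' prob_space 2 a2_def[symmetric]
        v1_def[symmetric] mean_def[symmetric])
  finally show ?thesis by (simp add: power2_eq_square)
qed

lemma m2_le: "R.m2 \<le> a2" and m2_ge: "a2 - 2 * v1 \<le> R.m2"
  using mean_sq_le v1_nonneg unfolding m2_eq by auto

lemma residual_abs_le: "x \<in> space M \<Longrightarrow> y \<in> space M \<Longrightarrow> \<bar>residual x y\<bar> \<le> 2 * B"
proof -
  assume x: "x \<in> space M" and y: "y \<in> space M"
  have "mean \<ge> 0" unfolding mean_def by (intro integral_nonneg_AE) (simp add: proj_nonneg)
  moreover have "mean \<le> B"
    unfolding mean_def by (rule integral_le_const) (auto intro: bm_integrable proj_bm proj_le)
  ultimately show ?thesis
    using proj_nonneg[of x] proj_nonneg[of y] proj_le[OF x] proj_le[OF y] h_nonneg[of x y] h_le[of x y]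
    by (auto simp: residual_def abs_le_iff)
qed

lemma m4_le: "R.m4 \<le> 4 * B\<^sup>2 * a2"
proof -
  have "R.m4 \<le> (\<integral>x. \<integral>y. 4 * B\<^sup>2 * (residual x y)\<^sup>2 \<partial>M \<partial>M)"
    unfolding R.m4_def
  proof (intro integral_mono)
    show "integrable M (\<lambda>x. \<integral>y. (residual x y)^4 \<partial>M)"
      by (intro bm_integrable bm_integral R.H_power_bm)
    show "integrable M (\<lambda>x. \<integral>y. 4 * B\<^sup>2 * (residual x y)\<^sup>2 \<partial>M)"
      by (simp add: bm_integrable bm_intros bm_integral R.H_power_bm)
    fix x y assume x: "x \<in> space M" and y: "y \<in> space M"
    show "integrable M (\<lambda>y. (residual x y)^4)" "integrable M (\<lambda>y. 4 * B\<^sup>2 * (residual x y)\<^sup>2)"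
      by (intro bm_integrable bm_intros R.H_section_bm x)+
    have "(residual x y)\<^sup>2 \<le> (2 * B)\<^sup>2"
      using residual_abs_le[OF x y] by (meson abs_ge_zero order_trans power2_le_iff_abs_le)
    then have "(residual x y)\<^sup>2 * (residual x y)\<^sup>2 \<le> 4 * B\<^sup>2 * (residual x y)\<^sup>2"
      by (intro mult_right_mono) (auto simp: power_mult_distrib)
    then show "(residual x y)^4 \<le> 4 * B\<^sup>2 * (residual x y)\<^sup>2"
      by (simp add: eval_nat_numeral mult_ac)
  qed
  also have "\<dots> = 4 * B\<^sup>2 * R.m2" by (simp add: R.m2_def R.Q_def)
  also have "\<dots> \<le> 4 * B\<^sup>2 * a2" by (intro mult_left_mono m2_le) auto
  finally show ?thesis .
qed

lemma q2_le: "R.q2 \<le> 16 * (\<integral>x. (sq x)\<^sup>2 \<partial>M)"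
proof -
  have v: "v1\<^sup>2 \<le> (\<integral>x. (sq x)\<^sup>2 \<partial>M)"
  proof -
    have "v1\<^sup>2 \<le> a2\<^sup>2" using v1_le v1_nonneg by (rule power_mono)
    also have "\<dots> \<le> (\<integral>x. (sq x)\<^sup>2 \<partial>M)" unfolding a2_def by (rule square_integral_le[OF sq_bm])
    finally show ?thesis .
  qed
  have le: "R.Q x \<le> 2 * sq x + 2 * v1" if x: "x \<in> space M" for x
  proof -
    have hx: "h x \<in> bounded_measurable M" by (rule h_section_bm[OF x])
    have "R.Q x \<le> (\<integral>y. 2 * (h x y - proj x)\<^sup>2 + 2 * (proj y - mean)\<^sup>2 \<partial>M)"
      unfolding R.Q_def
    proof (intro integral_mono bm_integrable bm_intros R.H_section_bm x hx proj_bm)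
      fix y
      show "(residual x y)\<^sup>2 \<le> 2 * (h x y - proj x)\<^sup>2 + 2 * (proj y - mean)\<^sup>2"
        using sum_squares_bound[of "h x y - proj x" "- (proj y - mean)"]
        by (simp add: residual_def power2_eq_square algebra_simps)
    qed
    also have "\<dots> = (\<integral>y. 2 * (h x y)\<^sup>2 - 4 * proj x * h x y + 2 * (proj x)\<^sup>2
        + (2 * (proj y)\<^sup>2 - 4 * mean * proj y + 2 * mean\<^sup>2) \<partial>M)"
      by (intro Bochner_Integration.integral_cong) (auto simp: power2_eq_square algebra_simps)
    also have "\<dots> = 2 * sq x - 4 * proj x * proj x + 2 * (proj x)\<^sup>2 + (2 * v1 - 4 * mean * mean + 2 * mean\<^sup>2)"
      using hx by (simp add: bm_integrable bm_intros proj_bm prob_space sq_def v1_def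
          proj_def[of x, symmetric] mean_def[symmetric])
    also have "\<dots> \<le> 2 * sq x + 2 * v1" by (simp add: power2_eq_square)
    finally show ?thesis .
  qed
  have "R.q2 \<le> (\<integral>x. 8 * (sq x)\<^sup>2 + 8 * v1\<^sup>2 \<partial>M)"
    unfolding R.q2_def
  proof (intro integral_mono bm_integrable bm_intros R.Q_bm sq_bm)
    fix x assume x: "x \<in> space M"
    have "(R.Q x)\<^sup>2 \<le> (2 * sq x + 2 * v1)\<^sup>2"
      by (rule power_mono[OF le[OF x]]) (simp add: R.Q_def)
    also have "\<dots> \<le> 8 * (sq x)\<^sup>2 + 8 * v1\<^sup>2"
      using sum_squares_bound[of "sq x" v1] by (simp add: power2_eq_square algebra_simps)
    finally show "(R.Q x)\<^sup>2 \<le> 8 * (sq x)\<^sup>2 + 8 * v1\<^sup>2" .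
  qed
  also have "\<dots> = 8 * (\<integral>x. (sq x)\<^sup>2 \<partial>M) + 8 * v1\<^sup>2"
    by (simp add: bm_integrable bm_intros sq_bm prob_space)
  finally show ?thesis using v by linarith
qed

text \<open>
  The constant \<open>c\<close> is free because the mean is the best constant approximation of \<open>proj\<close>; for a
  convolution kernel the total mass of the kernel is a convenient choice.
\<close>
lemma linear_part_sq:
  assumes I: "finite I"
  shows "(\<integral>x. ((real (card I) - 1) * (\<Sum>i\<in>I. proj (x i) - mean))\<^sup>2 \<partial>sample I)
    \<le> (real (card I))^3 * (\<integral>x. (proj x - c)\<^sup>2 \<partial>M)"
proof -
  define m where "m = real (card I)"
  have 1: "(\<integral>x. (proj x - d)\<^sup>2 \<partial>M) = v1 - 2 * d * mean + d\<^sup>2" for d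
  proof -
    have "(\<integral>x. (proj x - d)\<^sup>2 \<partial>M) = (\<integral>x. (proj x)\<^sup>2 - 2 * d * proj x + d\<^sup>2 \<partial>M)"
      by (intro Bochner_Integration.integral_cong) (auto simp: power2_eq_square algebra_simps)
    also have "\<dots> = v1 - 2 * d * mean + d\<^sup>2"
      by (simp add: bm_integrable bm_intros proj_bm prob_space v1_def mean_def)
    finally show ?thesis .
  qed
  have "(\<integral>x. (proj x - mean)\<^sup>2 \<partial>M) \<le> (\<integral>x. (proj x - c)\<^sup>2 \<partial>M)"
    unfolding 1 using zero_le_power2[of "c - mean"] by (simp add: power2_eq_square algebra_simps)
  moreover have "(\<integral>x. (\<Sum>i\<in>I. proj (x i) - mean)\<^sup>2 \<partial>sample I) = m * (\<integral>x. (proj x - mean)\<^sup>2 \<partial>M)"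
    unfolding m_def
    by (rule sample_sum_sq[OF I]) (auto intro!: bm_intros proj_bm simp: bm_integrable proj_bm prob_space mean_def)
  moreover have "(m - 1)\<^sup>2 * m \<le> m^3"
  proof (cases "card I = 0")
    case False
    then have "m \<ge> 1" by (simp add: m_def)
    then have "(m - 1)\<^sup>2 \<le> m\<^sup>2" by (intro power_mono) auto
    then show ?thesis using \<open>m \<ge> 1\<close> by (simp add: power3_eq_cube power2_eq_square)
  qed (simp add: m_def)
  ultimately have "(m - 1)\<^sup>2 * (m * (\<integral>x. (proj x - mean)\<^sup>2 \<partial>M)) \<le> m^3 * (\<integral>x. (proj x - c)\<^sup>2 \<partial>M)"
    by (metis (no_types, lifting) mult.assoc mult_mono integral_nonneg_AE AE_I2 zero_le_power2 zero_le_power m_def of_nat_0_le_iff)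
  then show ?thesis
    using \<open>(\<integral>x. (\<Sum>i\<in>I. proj (x i) - mean)\<^sup>2 \<partial>sample I) = m * (\<integral>x. (proj x - mean)\<^sup>2 \<partial>M)\<close>
    by (simp add: power_mult_distrib m_def)
qed

lemma residual_sum_bm: "pair_sum residual I \<in> bounded_measurable (sample I)"
  by (rule bm_pair_sum[OF residual_bm])

lemma linear_bm: "(\<lambda>x. (real (card I) - 1) * (\<Sum>i\<in>I. proj (x i) - mean)) \<in> bounded_measurable (sample I)"
  by (rule bm_mult[OF bm_const bm_row_sum[of "\<lambda>u. proj u - mean"]]) (intro bm_intros proj_bm)

lemma pair_sum_variance:
  assumes I: "finite I"
  shows "(\<integral>x. (pair_sum h I x - card I * (real (card I) - 1) / 2 * mean)\<^sup>2 \<partial>sample I)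
    \<le> (real (card I))\<^sup>2 * a2 + 2 * (real (card I))^3 * (\<integral>x. (proj x - c)\<^sup>2 \<partial>M)"
proof -
  interpret S: prob_space "sample I" by (rule prob_space_sample)
  define L where "L x = (real (card I) - 1) * (\<Sum>i\<in>I. proj (x i) - mean)" for x :: "'b \<Rightarrow> 'a"
  have L_bm: "L \<in> bounded_measurable (sample I)" unfolding L_def by (rule linear_bm)
  have "(\<integral>x. (pair_sum h I x - card I * (real (card I) - 1) / 2 * mean)\<^sup>2 \<partial>sample I)
      = (\<integral>x. (pair_sum residual I x + L x)\<^sup>2 \<partial>sample I)"
    by (simp only: hoeffding_decomposition[OF I] L_def)
  also have "\<dots> \<le> (\<integral>x. 2 * (pair_sum residual I x)\<^sup>2 + 2 * (L x)\<^sup>2 \<partial>sample I)"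
  proof (intro integral_mono S.bm_integrable bm_intros residual_sum_bm L_bm)
    fix x
    show "(pair_sum residual I x + L x)\<^sup>2 \<le> 2 * (pair_sum residual I x)\<^sup>2 + 2 * (L x)\<^sup>2"
      using sum_squares_bound[of "pair_sum residual I x" "L x"] by (simp add: power2_eq_square algebra_simps)
  qed
  also have "\<dots> = 2 * (\<integral>x. (pair_sum residual I x)\<^sup>2 \<partial>sample I) + 2 * (\<integral>x. (L x)\<^sup>2 \<partial>sample I)"
    by (simp add: S.bm_integrable bm_intros residual_sum_bm L_bm)
  also have "2 * (\<integral>x. (pair_sum residual I x)\<^sup>2 \<partial>sample I) \<le> (real (card I))\<^sup>2 * a2"
  proof -
    have "2 * (\<integral>x. (pair_sum residual I x)\<^sup>2 \<partial>sample I) = card I * (real (card I) - 1) * R.m2"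
      using R.pair_sum_sq[OF I] by simp
    also have "\<dots> \<le> (real (card I))\<^sup>2 * R.m2"
      using R.m2_nonneg by (intro mult_right_mono) (auto simp: power2_eq_square algebra_simps)
    also have "\<dots> \<le> (real (card I))\<^sup>2 * a2" by (intro mult_left_mono m2_le) auto
    finally show ?thesis .
  qed
  also have "2 * (\<integral>x. (L x)\<^sup>2 \<partial>sample I) \<le> 2 * (real (card I))^3 * (\<integral>x. (proj x - c)\<^sup>2 \<partial>M)"
    using linear_part_sq[OF I, of c] by (simp add: L_def)
  finally show ?thesis by simp
qed

lemma pair_sum_residual_distance:
  assumes I: "finite I"
  shows "(\<integral>x. \<bar>(pair_sum h I x - card I * (real (card I) - 1) / 2 * mean) - pair_sum residual I x\<bar> \<partial>sample I)
    \<le> sqrt ((real (card I))^3 * (\<integral>x. (proj x - c)\<^sup>2 \<partial>M))"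
proof -
  interpret S: prob_space "sample I" by (rule prob_space_sample)
  show ?thesis
    unfolding hoeffding_decomposition[OF I] add_diff_cancel_left'
    by (rule order_trans[OF S.abs_integral_le_sqrt[OF linear_bm]])
      (rule real_sqrt_le_mono[OF linear_part_sq[OF I]])
qed

definition hgram :: "'a \<Rightarrow> 'a \<Rightarrow> real" where "hgram x y = (\<integral>z. h x z * h y z \<partial>M)"

lemma hgram_bm: "case_prod hgram \<in> bounded_measurable (M \<Otimes>\<^sub>M M)"
  unfolding hgram_def by (rule bm_gram[OF h_bm])

lemma hgram_nonneg: "hgram x y \<ge> 0"
  unfolding hgram_def by (intro integral_nonneg_AE) (simp add: h_nonneg)

lemma integral_hgram: "(\<integral>x. \<integral>y. hgram x y \<partial>M \<partial>M) = v1"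
proof -
  have "(\<integral>y. hgram x y \<partial>M) = (\<integral>z. h x z * proj z \<partial>M)" if x: "x \<in> space M" for x
  proof -
    have "(\<integral>y. hgram x y \<partial>M) = (\<integral>z. \<integral>y. h x z * h y z \<partial>M \<partial>M)"
      unfolding hgram_def by (rule bm_Fubini[OF prob_space_axioms prob_space_axioms bm_gram_section[OF h_bm x]])
    also have "\<dots> = (\<integral>z. h x z * proj z \<partial>M)"
      by (simp add: h_sym[of _ z for z] proj_def)
    finally show ?thesis .
  qed
  then have "(\<integral>x. \<integral>y. hgram x y \<partial>M \<partial>M) = (\<integral>x. \<integral>z. h x z * proj z \<partial>M \<partial>M)"
    by (rule Bochner_Integration.integral_cong[OF refl])
  also have "\<dots> = (\<integral>z. \<integral>x. h x z * proj z \<partial>M \<partial>M)"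
    by (rule bm_Fubini[OF prob_space_axioms prob_space_axioms])
      (use bm_mult[OF h_bm snd_bm[OF proj_bm]] in \<open>simp add: case_prod_beta'\<close>)
  also have "\<dots> = v1"
    by (simp add: h_sym[of _ z for z] proj_def[symmetric] power2_eq_square v1_def)
  finally show ?thesis .
qed

text \<open>
  The integral on the left runs over closed walks of length four.  Bounding one factor \<open>hgram\<close> by a
  constant reduces it to walks of length two, and so avoids a fourth moment of the density.
\<close>
lemma integral_hgram_sq:
  assumes s: "\<And>x. x \<in> space M \<Longrightarrow> proj x \<le> s"
  shows "(\<integral>x. \<integral>y. (hgram x y)\<^sup>2 \<partial>M \<partial>M) \<le> B * s * v1"
proof -
  have B: "B \<ge> 0" using h_nonneg h_le order_trans by blast
  have le: "hgram x y \<le> B * s" if x: "x \<in> space M" and y: "y \<in> space M" for x y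
  proof -
    have "hgram x y \<le> (\<integral>z. B * h x z \<partial>M)"
      unfolding hgram_def
      by (intro integral_mono bm_integrable bm_intros h_section_bm x y)
        (subst mult.commute, intro mult_right_mono h_le h_nonneg)
    also have "\<dots> = B * proj x" by (simp add: proj_def)
    also have "\<dots> \<le> B * s" by (intro mult_left_mono s x B)
    finally show ?thesis .
  qed
  have hgram_sq: "(\<lambda>(x, y). (hgram x y)\<^sup>2) \<in> bounded_measurable (M \<Otimes>\<^sub>M M)"
    by (rule bm_power_uncurried[OF hgram_bm])
  have "(\<integral>x. \<integral>y. (hgram x y)\<^sup>2 \<partial>M \<partial>M) \<le> (\<integral>x. B * s * (\<integral>y. hgram x y \<partial>M) \<partial>M)"
  proof (intro integral_mono)
    show "integrable M (\<lambda>x. \<integral>y. (hgram x y)\<^sup>2 \<partial>M)" by (intro bm_integrable bm_integral hgram_sq)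
    show "integrable M (\<lambda>x. B * s * (\<integral>y. hgram x y \<partial>M))"
      by (intro bm_integrable bm_intros bm_integral hgram_bm)
    fix x assume x: "x \<in> space M"
    have hx: "hgram x \<in> bounded_measurable M" by (rule bm_section[OF hgram_bm x])
    have "(\<integral>y. (hgram x y)\<^sup>2 \<partial>M) \<le> (\<integral>y. B * s * hgram x y \<partial>M)"
      by (intro integral_mono bm_integrable bm_intros hx)
        (auto simp: power2_eq_square intro!: mult_right_mono le x hgram_nonneg)
    then show "(\<integral>y. (hgram x y)\<^sup>2 \<partial>M) \<le> B * s * (\<integral>y. hgram x y \<partial>M)" by simp
  qed
  also have "\<dots> = B * s * v1" by (simp add: integral_hgram)
  finally show ?thesis .
qed

text \<open>
  Writing the residual as \<open>h - \<rho>\<close>, every term of its Gram kernel other than \<open>hgram\<close> contains a factor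
  \<open>\<rho>\<close> and is controlled by the Cauchy-Schwarz inequality.
\<close>
lemma g2_le:
  assumes s: "\<And>x. x \<in> space M \<Longrightarrow> proj x \<le> s"
  shows "R.g2 \<le> 4 * (B * s * v1 + 4 * a2 * v1 + 4 * v1\<^sup>2)"
proof -
  define \<rho> where "\<rho> x y = proj x + proj y - mean" for x y
  define r where "r x = (\<integral>y. (\<rho> x y)\<^sup>2 \<partial>M)" for x
  have \<rho>_bm: "case_prod \<rho> \<in> bounded_measurable (M \<Otimes>\<^sub>M M)"
    unfolding \<rho>_def by (rule rho_bm)
  have \<rho>_section: "\<rho> x \<in> bounded_measurable M" if "x \<in> space M" for x
    by (rule bm_section[OF \<rho>_bm that])
  have r_bm: "r \<in> bounded_measurable M"
    unfolding r_def by (rule bm_integral[OF bm_power_uncurried[OF \<rho>_bm]])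
  have r_int: "(\<integral>x. r x \<partial>M) \<le> 2 * v1" "(\<integral>x. r x \<partial>M) \<ge> 0"
    using integral_rho_sq mean_sq_le v1_nonneg by (auto simp: r_def \<rho>_def)
  have hgram_sq: "(\<lambda>(x, y). (hgram x y)\<^sup>2) \<in> bounded_measurable (M \<Otimes>\<^sub>M M)"
    by (rule bm_power_uncurried[OF hgram_bm])
  have gram_sq: "(\<lambda>(x, y). (R.gram x y)\<^sup>2) \<in> bounded_measurable (M \<Otimes>\<^sub>M M)"
    by (rule bm_power_uncurried[OF R.gram_bm])
  have pointwise: "(R.gram x y)\<^sup>2 \<le> 4 * (hgram x y)\<^sup>2 + (4 * sq x * r y + 4 * r x * sq y + 4 * r x * r y)"
    if x: "x \<in> space M" and y: "y \<in> space M" for x y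
  proof -
    note hx = h_section_bm[OF x] and hy = h_section_bm[OF y] and rx = \<rho>_section[OF x] and ry = \<rho>_section[OF y]
    define c1 c2 c3 where "c1 = (\<integral>z. h x z * \<rho> y z \<partial>M)" and "c2 = (\<integral>z. \<rho> x z * h y z \<partial>M)"
      and "c3 = (\<integral>z. \<rho> x z * \<rho> y z \<partial>M)"
    have "R.gram x y = (\<integral>z. h x z * h y z - h x z * \<rho> y z - \<rho> x z * h y z + \<rho> x z * \<rho> y z \<partial>M)"
      unfolding R.gram_def residual_def \<rho>_def by (intro Bochner_Integration.integral_cong) (auto simp: algebra_simps)
    also have "\<dots> = hgram x y - c1 - c2 + c3"
      using bm_integrable[OF bm_mult[OF hx hy]] bm_integrable[OF bm_mult[OF hx ry]]
        bm_integrable[OF bm_mult[OF rx hy]] bm_integrable[OF bm_mult[OF rx ry]]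
      by (simp add: hgram_def c1_def c2_def c3_def)
    finally have g: "R.gram x y = hgram x y - c1 - c2 + c3" .
    have "c1\<^sup>2 \<le> sq x * r y"
      unfolding c1_def sq_def r_def by (intro cauchy_schwarz_bm hx hy rx ry)
    moreover have "c2\<^sup>2 \<le> r x * sq y"
      unfolding c2_def sq_def r_def by (intro cauchy_schwarz_bm hx hy rx ry)
    moreover have "c3\<^sup>2 \<le> r x * r y"
      unfolding c3_def r_def by (intro cauchy_schwarz_bm hx hy rx ry)
    moreover have "(hgram x y - c1 - c2 + c3)\<^sup>2 \<le> 4 * (hgram x y)\<^sup>2 + 4 * c1\<^sup>2 + 4 * c2\<^sup>2 + 4 * c3\<^sup>2"
    proof -
      have "(a - b - c + d)\<^sup>2 \<le> 4 * a\<^sup>2 + 4 * b\<^sup>2 + 4 * c\<^sup>2 + 4 * d\<^sup>2" for a b c d :: real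
      proof -
        have "4 * a\<^sup>2 + 4 * b\<^sup>2 + 4 * c\<^sup>2 + 4 * d\<^sup>2 - (a - b - c + d)\<^sup>2
          = (a + b)\<^sup>2 + (a + c)\<^sup>2 + (a - d)\<^sup>2 + (b - c)\<^sup>2 + (b + d)\<^sup>2 + (c + d)\<^sup>2"
          by (simp add: power2_eq_square algebra_simps)
        then show ?thesis by (smt (verit) zero_le_power2)
      qed
      then show ?thesis .
    qed
    ultimately show ?thesis unfolding g by linarith
  qed
  have "R.g2 \<le> (\<integral>x. 4 * (\<integral>y. (hgram x y)\<^sup>2 \<partial>M)
      + (4 * sq x * (\<integral>y. r y \<partial>M) + 4 * r x * a2 + 4 * r x * (\<integral>y. r y \<partial>M)) \<partial>M)"
    unfolding R.g2_def
  proof (intro integral_mono)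
    show "integrable M (\<lambda>x. \<integral>y. (R.gram x y)\<^sup>2 \<partial>M)" by (intro bm_integrable bm_integral gram_sq)
    show "integrable M (\<lambda>x. 4 * (\<integral>y. (hgram x y)\<^sup>2 \<partial>M)
      + (4 * sq x * (\<integral>y. r y \<partial>M) + 4 * r x * a2 + 4 * r x * (\<integral>y. r y \<partial>M)))"
      by (intro bm_integrable bm_intros bm_integral hgram_sq sq_bm r_bm)
    fix x assume x: "x \<in> space M"
    have hx: "hgram x \<in> bounded_measurable M" "R.gram x \<in> bounded_measurable M"
      using bm_section[OF hgram_bm x] bm_section[OF R.gram_bm x] .
    have "(\<integral>y. (R.gram x y)\<^sup>2 \<partial>M)
        \<le> (\<integral>y. 4 * (hgram x y)\<^sup>2 + (4 * sq x * r y + 4 * r x * sq y + 4 * r x * r y) \<partial>M)"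
      by (intro integral_mono bm_integrable bm_intros hx sq_bm r_bm pointwise x)
    also have "\<dots> = 4 * (\<integral>y. (hgram x y)\<^sup>2 \<partial>M)
      + (4 * sq x * (\<integral>y. r y \<partial>M) + 4 * r x * a2 + 4 * r x * (\<integral>y. r y \<partial>M))"
      using bm_integrable[OF sq_bm] bm_integrable[OF r_bm] bm_integrable[OF bm_power[OF hx(1)]]
      by (simp add: a2_def)
    finally show "(\<integral>y. (R.gram x y)\<^sup>2 \<partial>M) \<le> \<dots>" .
  qed
  also have "\<dots> = 4 * (\<integral>x. \<integral>y. (hgram x y)\<^sup>2 \<partial>M \<partial>M)
      + (4 * a2 * (\<integral>y. r y \<partial>M) + 4 * (\<integral>y. r y \<partial>M) * a2 + 4 * (\<integral>y. r y \<partial>M) * (\<integral>y. r y \<partial>M))"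
    using bm_integrable[OF sq_bm] bm_integrable[OF r_bm] bm_integrable[OF bm_integral[OF hgram_sq]]
    by (simp add: a2_def)
  also have "\<dots> \<le> 4 * (B * s * v1) + (4 * a2 * (2 * v1) + 4 * (2 * v1) * a2 + 4 * (2 * v1) * (2 * v1))"
    using integral_hgram_sq[OF s] r_int a2_nonneg v1_nonneg
    by (intro add_mono mult_mono mult_left_mono mult_nonneg_nonneg) auto
  finally show ?thesis by (simp add: power2_eq_square algebra_simps)
qed

end

section \<open>Convolution estimates\<close>

lemma nn_integral_lborel_minus:
  fixes f :: "'a::euclidean_space \<Rightarrow> ennreal"
  assumes [measurable]: "f \<in> borel_measurable borel"
  shows "(\<integral>\<^sup>+y. f (x - y) \<partial>lborel) = (\<integral>\<^sup>+y. f y \<partial>lborel)" (is ?A)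
    and "(\<integral>\<^sup>+y. f (y - x) \<partial>lborel) = (\<integral>\<^sup>+y. f y \<partial>lborel)" (is ?B)
proof -
  have "(\<integral>\<^sup>+y. f y \<partial>lborel) = (\<integral>\<^sup>+y. f y \<partial>density (distr lborel borel (\<lambda>y. x + (- 1) *\<^sub>R y)) (\<lambda>_. \<bar>- 1 :: real\<bar>^DIM('a)))"
    by (subst lborel_affine[of "- 1" x]) auto
  also have "\<dots> = (\<integral>\<^sup>+y. f (x - y) \<partial>lborel)"
    by (simp add: nn_integral_density nn_integral_distr)
  finally show ?A ..
  have "(\<integral>\<^sup>+y. f y \<partial>lborel) = (\<integral>\<^sup>+y. f y \<partial>density (distr lborel borel (\<lambda>y. (- x) + 1 *\<^sub>R y)) (\<lambda>_. \<bar>1 :: real\<bar>^DIM('a)))"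
    by (subst lborel_affine[of 1 "- x"]) auto
  also have "\<dots> = (\<integral>\<^sup>+y. f (y - x) \<partial>lborel)"
    by (simp add: nn_integral_density nn_integral_distr)
  finally show ?B ..
qed

lemma nn_edge_left:
  fixes k u :: "'a::euclidean_space \<Rightarrow> ennreal"
  assumes [measurable]: "k \<in> borel_measurable borel" "u \<in> borel_measurable borel"
  shows "(\<integral>\<^sup>+x. \<integral>\<^sup>+y. k (x - y) * u x \<partial>lborel \<partial>lborel) = (\<integral>\<^sup>+z. k z \<partial>lborel) * (\<integral>\<^sup>+x. u x \<partial>lborel)"
  by (simp add: nn_integral_multc nn_integral_cmult nn_integral_lborel_minus)

lemma nn_edge_right:
  fixes k u :: "'a::euclidean_space \<Rightarrow> ennreal"
  assumes [measurable]: "k \<in> borel_measurable borel" "u \<in> borel_measurable borel"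
  shows "(\<integral>\<^sup>+x. \<integral>\<^sup>+y. k (x - y) * u y \<partial>lborel \<partial>lborel) = (\<integral>\<^sup>+z. k z \<partial>lborel) * (\<integral>\<^sup>+x. u x \<partial>lborel)"
proof -
  have "(\<integral>\<^sup>+x. \<integral>\<^sup>+y. k (x - y) * u y \<partial>lborel \<partial>lborel) = (\<integral>\<^sup>+y. \<integral>\<^sup>+x. k (x - y) * u y \<partial>lborel \<partial>lborel)"
    by (rule lborel_pair.Fubini') measurable
  then show ?thesis by (simp add: nn_integral_multc nn_integral_cmult nn_integral_lborel_minus)
qed

lemma ennreal_prod3_le: "a * b * c \<le> a^3 + b^3 + c^3" for a b c :: ennreal
proof -
  define m where "m = max a (max b c)"
  have "a * b * c \<le> m * m * m" by (intro mult_mono) (auto simp: m_def le_max_iff_disj)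
  also have "\<dots> = m^3" by (simp add: power3_eq_cube)
  also have "\<dots> \<le> a^3 + b^3 + c^3"
    unfolding m_def by (auto simp: max_def add_increasing add_increasing2)
  finally show ?thesis .
qed

text \<open>
  The graph with edges \<open>x y\<close> and \<open>x z\<close>.  By the arithmetic-geometric mean inequality the product of the
  three vertex weights may be replaced by the cube of one of them; the other two vertices are then
  integrated out by translation invariance.  Only third moments of the weights are needed, which is
  why the perturbation is assumed to be in \<open>L\<^sup>3\<close>.
\<close>
lemma nn_cherry:
  fixes k l f u v :: "'a::euclidean_space \<Rightarrow> ennreal"
  assumes [measurable]: "k \<in> borel_measurable borel" "l \<in> borel_measurable borel"
    "f \<in> borel_measurable borel" "u \<in> borel_measurable borel" "v \<in> borel_measurable borel"
  shows "(\<integral>\<^sup>+x. f x * ((\<integral>\<^sup>+y. k (x - y) * u y \<partial>lborel) * (\<integral>\<^sup>+z. l (x - z) * v z \<partial>lborel)) \<partial>lborel)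
    \<le> (\<integral>\<^sup>+z. k z \<partial>lborel) * (\<integral>\<^sup>+z. l z \<partial>lborel)
      * ((\<integral>\<^sup>+x. f x^3 \<partial>lborel) + (\<integral>\<^sup>+x. u x^3 \<partial>lborel) + (\<integral>\<^sup>+x. v x^3 \<partial>lborel))"
proof -
  define K L where "K = (\<integral>\<^sup>+z. k z \<partial>lborel)" and "L = (\<integral>\<^sup>+z. l z \<partial>lborel)"
  have inner: "f x * ((\<integral>\<^sup>+y. k (x - y) * u y \<partial>lborel) * (\<integral>\<^sup>+z. l (x - z) * v z \<partial>lborel))
    \<le> K * L * f x^3 + L * (\<integral>\<^sup>+y. k (x - y) * u y^3 \<partial>lborel) + K * (\<integral>\<^sup>+z. l (x - z) * v z^3 \<partial>lborel)" for x
  proof -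
    have "f x * ((\<integral>\<^sup>+y. k (x - y) * u y \<partial>lborel) * (\<integral>\<^sup>+z. l (x - z) * v z \<partial>lborel))
      = (\<integral>\<^sup>+y. \<integral>\<^sup>+z. k (x - y) * l (x - z) * (f x * u y * v z) \<partial>lborel \<partial>lborel)"
    proof -
      have "(\<integral>\<^sup>+z. k (x - y) * l (x - z) * (f x * u y * v z) \<partial>lborel)
          = f x * (k (x - y) * u y) * (\<integral>\<^sup>+z. l (x - z) * v z \<partial>lborel)" for y
        by (subst nn_integral_cmult[symmetric]) (auto simp: mult_ac)
      then show ?thesis
        by (simp only:) (simp add: nn_integral_cmult nn_integral_multc, simp add: mult.assoc)
    qed
    also have "\<dots> \<le> (\<integral>\<^sup>+y. \<integral>\<^sup>+z. k (x - y) * l (x - z) * (f x^3 + u y^3 + v z^3) \<partial>lborel \<partial>lborel)"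
      by (intro nn_integral_mono mult_left_mono ennreal_prod3_le) auto
    also have "\<dots> = (\<integral>\<^sup>+y. k (x - y) * L * f x^3 + k (x - y) * u y^3 * L
        + k (x - y) * (\<integral>\<^sup>+z. l (x - z) * v z^3 \<partial>lborel) \<partial>lborel)"
    proof (intro nn_integral_cong)
      fix y
      have "(\<integral>\<^sup>+z. k (x - y) * l (x - z) * (f x^3 + u y^3 + v z^3) \<partial>lborel)
        = (\<integral>\<^sup>+z. (k (x - y) * f x^3) * l (x - z) + (k (x - y) * u y^3) * l (x - z)
            + k (x - y) * (l (x - z) * v z^3) \<partial>lborel)"
        by (intro nn_integral_cong) (simp add: algebra_simps)
      also have "\<dots> = (k (x - y) * f x^3) * L + (k (x - y) * u y^3) * L
            + k (x - y) * (\<integral>\<^sup>+z. l (x - z) * v z^3 \<partial>lborel)"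
        by (simp add: nn_integral_add nn_integral_cmult nn_integral_lborel_minus L_def)
      finally show "(\<integral>\<^sup>+z. k (x - y) * l (x - z) * (f x^3 + u y^3 + v z^3) \<partial>lborel)
        = k (x - y) * L * f x^3 + k (x - y) * u y^3 * L + k (x - y) * (\<integral>\<^sup>+z. l (x - z) * v z^3 \<partial>lborel)"
        by (simp add: mult_ac)
    qed
    also have "\<dots> = K * L * f x^3 + L * (\<integral>\<^sup>+y. k (x - y) * u y^3 \<partial>lborel) + K * (\<integral>\<^sup>+z. l (x - z) * v z^3 \<partial>lborel)"
      by (simp add: nn_integral_add nn_integral_cmult nn_integral_multc nn_integral_lborel_minus K_def mult_ac)
    finally show ?thesis .
  qed
  have "(\<integral>\<^sup>+x. f x * ((\<integral>\<^sup>+y. k (x - y) * u y \<partial>lborel) * (\<integral>\<^sup>+z. l (x - z) * v z \<partial>lborel)) \<partial>lborel)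
    \<le> (\<integral>\<^sup>+x. K * L * f x^3 + L * (\<integral>\<^sup>+y. k (x - y) * u y^3 \<partial>lborel)
        + K * (\<integral>\<^sup>+z. l (x - z) * v z^3 \<partial>lborel) \<partial>lborel)"
    by (intro nn_integral_mono inner)
  also have "\<dots> = K * L * (\<integral>\<^sup>+x. f x^3 \<partial>lborel) + L * (\<integral>\<^sup>+x. \<integral>\<^sup>+y. k (x - y) * u y^3 \<partial>lborel \<partial>lborel)
      + K * (\<integral>\<^sup>+x. \<integral>\<^sup>+z. l (x - z) * v z^3 \<partial>lborel \<partial>lborel)"
    by (simp add: nn_integral_add nn_integral_cmult)
  also have "\<dots> = K * L * ((\<integral>\<^sup>+x. f x^3 \<partial>lborel) + (\<integral>\<^sup>+x. u x^3 \<partial>lborel) + (\<integral>\<^sup>+x. v x^3 \<partial>lborel))"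
    using nn_edge_right[of k "\<lambda>x. u x^3"] nn_edge_right[of l "\<lambda>x. v x^3"]
    by (simp add: K_def[symmetric] L_def[symmetric] algebra_simps)
  finally show ?thesis by (simp add: K_def L_def)
qed

lemma weighted_AM_GM:
  fixes a b \<delta> :: real
  assumes "\<delta> > 0"
  shows "\<bar>a * b\<bar> \<le> \<delta> * a\<^sup>2 + b\<^sup>2 / \<delta>"
proof -
  have "0 \<le> (\<delta> * \<bar>a\<bar> - \<bar>b\<bar>)\<^sup>2" by simp
  then have "2 * \<delta> * (\<bar>a\<bar> * \<bar>b\<bar>) \<le> \<delta>\<^sup>2 * a\<^sup>2 + b\<^sup>2"
    by (simp add: power2_eq_square algebra_simps)
  moreover have "\<delta> * (\<bar>a\<bar> * \<bar>b\<bar>) \<ge> 0" using assms by simp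
  ultimately have "\<delta> * (\<bar>a\<bar> * \<bar>b\<bar>) \<le> \<delta>\<^sup>2 * a\<^sup>2 + b\<^sup>2" by linarith
  then show ?thesis using assms by (simp add: field_simps abs_mult power2_eq_square)
qed

definition square_integrable :: "('a::euclidean_space \<Rightarrow> real) \<Rightarrow> bool" where
  "square_integrable u \<longleftrightarrow> u \<in> borel_measurable borel \<and> integrable lborel (\<lambda>x. (u x)\<^sup>2)"

lemma square_integrable_measurable: "square_integrable u \<Longrightarrow> u \<in> borel_measurable borel"
  by (simp add: square_integrable_def)

lemma square_integrable_mult:
  assumes "square_integrable u" "square_integrable v"
  shows "integrable lborel (\<lambda>x. u x * v x)"
proof (rule Bochner_Integration.integrable_bound)
  show "integrable lborel (\<lambda>x. (u x)\<^sup>2 + (v x)\<^sup>2)" using assms by (simp add: square_integrable_def)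
  show "(\<lambda>x. u x * v x) \<in> borel_measurable lborel" using assms by (auto simp: square_integrable_def)
  have "norm (u x * v x) \<le> norm ((u x)\<^sup>2 + (v x)\<^sup>2)" for x
  proof -
    have "2 * \<bar>u x\<bar> * \<bar>v x\<bar> \<le> \<bar>u x\<bar>\<^sup>2 + \<bar>v x\<bar>\<^sup>2" by (rule sum_squares_bound)
    moreover have "\<bar>u x\<bar> * \<bar>v x\<bar> \<ge> 0" by simp
    ultimately have "\<bar>u x\<bar> * \<bar>v x\<bar> \<le> \<bar>u x\<bar>\<^sup>2 + \<bar>v x\<bar>\<^sup>2" by linarith
    then show ?thesis by (simp add: abs_mult)
  qed
  then show "AE x in lborel. norm (u x * v x) \<le> norm ((u x)\<^sup>2 + (v x)\<^sup>2)" by simp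
qed

lemma square_integrable_add:
  assumes "square_integrable u" "square_integrable v"
  shows "square_integrable (\<lambda>x. u x + v x)"
proof -
  have "integrable lborel (\<lambda>x. (u x)\<^sup>2 + 2 * (u x * v x) + (v x)\<^sup>2)"
    using assms square_integrable_mult[OF assms] by (auto simp: square_integrable_def)
  then show ?thesis using assms by (auto simp: square_integrable_def power2_sum algebra_simps)
qed

lemma square_integrable_scale: "square_integrable u \<Longrightarrow> square_integrable (\<lambda>x. c * u x)"
  by (auto simp: square_integrable_def power_mult_distrib)

lemma square_integrable_diff:
  "square_integrable u \<Longrightarrow> square_integrable v \<Longrightarrow> square_integrable (\<lambda>x. u x - v x)"
  using square_integrable_add[OF _ square_integrable_scale[of v "-1"], of u] by simp

text \<open>
  The bilinear form of the convolution operator with kernel \<open>k\<close>.  An integral over the product space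
  makes it bilinear without any discussion of the points where an inner integral diverges.
\<close>
definition form :: "('a::euclidean_space \<Rightarrow> real) \<Rightarrow> ('a \<Rightarrow> real) \<Rightarrow> ('a \<Rightarrow> real) \<Rightarrow> real" where
  "form k u v = (\<integral>p. k (fst p - snd p) * (u (fst p) * v (snd p)) \<partial>(lborel \<Otimes>\<^sub>M lborel))"

locale mollifier =
  fixes k :: "'a::euclidean_space \<Rightarrow> real" and r :: real
  assumes k_measurable [measurable]: "k \<in> borel_measurable borel"
    and k_nonneg: "\<And>z. k z \<ge> 0" and k_even: "\<And>z. k (- z) = k z"
    and k_support: "\<And>z. norm z > r \<Longrightarrow> k z = 0"
    and k_integrable: "integrable lborel k"
begin

definition mass :: real where "mass = (\<integral>z. k z \<partial>lborel)"

lemma mass_nonneg: "mass \<ge> 0"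
  by (auto simp: mass_def intro!: integral_nonneg_AE k_nonneg)

lemma k_commute: "k (x - y) = k (y - x)"
  using k_even[of "x - y"] by simp

lemma nn_mass: "(\<integral>\<^sup>+z. ennreal (k z) \<partial>lborel) = ennreal mass"
  unfolding mass_def by (rule nn_integral_eq_integral[OF k_integrable]) (simp add: k_nonneg)

lemma nn_mass_translate: "(\<integral>\<^sup>+y. ennreal (k (x - y)) \<partial>lborel) = ennreal mass"
  using nn_integral_lborel_minus(1)[of "\<lambda>z. ennreal (k z)" x] nn_mass by simp

lemma k_translate_integrable: "integrable lborel (\<lambda>y. k (x - y))"
  by (rule integrableI_nonneg) (auto simp: k_nonneg nn_mass_translate)

lemma k_translate_mass: "(\<integral>y. k (x - y) \<partial>lborel) = mass"
  by (rule integral_eq_nn_integral[THEN trans]) (auto simp: k_nonneg nn_mass_translate mass_nonneg)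

lemma k_diff_measurable [measurable]: "(\<lambda>p. k (fst p - snd p)) \<in> borel_measurable (lborel \<Otimes>\<^sub>M lborel)"
  by measurable

lemma edge_integrable_left:
  assumes u: "integrable lborel u"
  shows "integrable (lborel \<Otimes>\<^sub>M lborel) (\<lambda>p. k (fst p - snd p) * u (fst p))"
    and "(\<integral>p. k (fst p - snd p) * u (fst p) \<partial>(lborel \<Otimes>\<^sub>M lborel)) = mass * (\<integral>x. u x \<partial>lborel)"
proof -
  have [measurable]: "u \<in> borel_measurable borel" using u by (simp add: borel_measurable_integrable)
  show int: "integrable (lborel \<Otimes>\<^sub>M lborel) (\<lambda>p. k (fst p - snd p) * u (fst p))"
  proof (rule integrableI_bounded)
    have "(\<integral>\<^sup>+p. ennreal (norm (k (fst p - snd p) * u (fst p))) \<partial>(lborel \<Otimes>\<^sub>M lborel))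
      = (\<integral>\<^sup>+x. \<integral>\<^sup>+y. ennreal (k (x - y)) * ennreal \<bar>u x\<bar> \<partial>lborel \<partial>lborel)"
      by (subst lborel.nn_integral_fst[symmetric]) (auto simp: abs_mult ennreal_mult k_nonneg)
    also have "\<dots> = ennreal mass * (\<integral>\<^sup>+x. ennreal \<bar>u x\<bar> \<partial>lborel)"
      by (subst nn_edge_left) (auto simp: nn_mass)
    also have "\<dots> < \<infinity>" using u by (auto simp: integrable_iff_bounded ennreal_mult_less_top)
    finally show "(\<integral>\<^sup>+p. ennreal (norm (k (fst p - snd p) * u (fst p))) \<partial>(lborel \<Otimes>\<^sub>M lborel)) < \<infinity>" .
  qed measurable
  show "(\<integral>p. k (fst p - snd p) * u (fst p) \<partial>(lborel \<Otimes>\<^sub>M lborel)) = mass * (\<integral>x. u x \<partial>lborel)"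
    using lborel_pair.integral_fst'[OF int] by (simp add: k_translate_mass)
qed

lemma pair_swap:
  "integrable (lborel \<Otimes>\<^sub>M lborel) (\<lambda>p. k (fst p - snd p) * F (snd p) (fst p))
      \<longleftrightarrow> integrable (lborel \<Otimes>\<^sub>M lborel) (\<lambda>p. k (fst p - snd p) * F (fst p) (snd p))"
  "case_prod F \<in> borel_measurable (lborel \<Otimes>\<^sub>M lborel) \<Longrightarrow>
    (\<integral>p. k (fst p - snd p) * F (snd p) (fst p) \<partial>(lborel \<Otimes>\<^sub>M lborel))
      = (\<integral>p. k (fst p - snd p) * F (fst p) (snd p) \<partial>(lborel \<Otimes>\<^sub>M lborel))"
proof -
  have eq: "(\<lambda>(x, y). (\<lambda>p. k (fst p - snd p) * F (fst p) (snd p)) (y, x))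
      = (\<lambda>p. k (fst p - snd p) * F (snd p) (fst p))"
    by (auto simp: fun_eq_iff k_commute)
  show "integrable (lborel \<Otimes>\<^sub>M lborel) (\<lambda>p. k (fst p - snd p) * F (snd p) (fst p))
      \<longleftrightarrow> integrable (lborel \<Otimes>\<^sub>M lborel) (\<lambda>p. k (fst p - snd p) * F (fst p) (snd p))"
    using lborel_pair.integrable_product_swap_iff[of "\<lambda>p. k (fst p - snd p) * F (fst p) (snd p)"]
    unfolding eq .
  assume "case_prod F \<in> borel_measurable (lborel \<Otimes>\<^sub>M lborel)"
  then have F[measurable]: "(\<lambda>p. F (fst p) (snd p)) \<in> borel_measurable (lborel \<Otimes>\<^sub>M lborel)"
    by (simp add: case_prod_beta')
  show "(\<integral>p. k (fst p - snd p) * F (snd p) (fst p) \<partial>(lborel \<Otimes>\<^sub>M lborel))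
      = (\<integral>p. k (fst p - snd p) * F (fst p) (snd p) \<partial>(lborel \<Otimes>\<^sub>M lborel))"
    using lborel_pair.integral_product_swap[of "\<lambda>p. k (fst p - snd p) * F (fst p) (snd p)"]
    unfolding eq by (auto simp: F)
qed

lemma edge_integrable_right:
  assumes u: "integrable lborel u"
  shows "integrable (lborel \<Otimes>\<^sub>M lborel) (\<lambda>p. k (fst p - snd p) * u (snd p))"
    and "(\<integral>p. k (fst p - snd p) * u (snd p) \<partial>(lborel \<Otimes>\<^sub>M lborel)) = mass * (\<integral>x. u x \<partial>lborel)"
proof -
  have [measurable]: "u \<in> borel_measurable borel" using u by (simp add: borel_measurable_integrable)
  show "integrable (lborel \<Otimes>\<^sub>M lborel) (\<lambda>p. k (fst p - snd p) * u (snd p))"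
    using pair_swap(1)[of "\<lambda>x y. u x"] edge_integrable_left(1)[OF u] by simp
  show "(\<integral>p. k (fst p - snd p) * u (snd p) \<partial>(lborel \<Otimes>\<^sub>M lborel)) = mass * (\<integral>x. u x \<partial>lborel)"
    using pair_swap(2)[of "\<lambda>x y. u x"] edge_integrable_left(2)[OF u] by simp
qed

text \<open>
  The weight \<open>\<delta>\<close> lets a small \<open>L\<^sup>2\<close> norm of one argument make the form small, although the bound is
  a sum and not a product of norms.
\<close>
lemma
  assumes u: "square_integrable u" and v: "square_integrable v" and \<delta>: "\<delta> > 0"
  shows form_integrable: "integrable (lborel \<Otimes>\<^sub>M lborel) (\<lambda>p. k (fst p - snd p) * (u (fst p) * v (snd p)))"
    and form_le: "\<bar>form k u v\<bar> \<le> mass * (\<delta> * (\<integral>x. (u x)\<^sup>2 \<partial>lborel) + (\<integral>x. (v x)\<^sup>2 \<partial>lborel) / \<delta>)"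
proof -
  have [measurable]: "u \<in> borel_measurable borel" "v \<in> borel_measurable borel"
    using u v by (auto intro: square_integrable_measurable)
  have iu: "integrable lborel (\<lambda>x. (u x)\<^sup>2)" and iv: "integrable lborel (\<lambda>x. (v x)\<^sup>2)"
    using u v by (auto simp: square_integrable_def)
  define G where "G p = \<delta> * (k (fst p - snd p) * (u (fst p))\<^sup>2) + (k (fst p - snd p) * (v (snd p))\<^sup>2) / \<delta>" for p
  have G: "integrable (lborel \<Otimes>\<^sub>M lborel) G"
    unfolding G_def by (intro Bochner_Integration.integrable_add integrable_mult_right integrable_divide
        edge_integrable_left edge_integrable_right iu iv)
  have le: "\<bar>k (fst p - snd p) * (u (fst p) * v (snd p))\<bar> \<le> G p" for p
  proof -
    have "\<bar>k (fst p - snd p) * (u (fst p) * v (snd p))\<bar> = k (fst p - snd p) * \<bar>u (fst p) * v (snd p)\<bar>"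
      by (simp add: abs_mult k_nonneg)
    also have "\<dots> \<le> k (fst p - snd p) * (\<delta> * (u (fst p))\<^sup>2 + (v (snd p))\<^sup>2 / \<delta>)"
      by (intro mult_left_mono weighted_AM_GM \<delta> k_nonneg)
    finally show ?thesis by (simp add: G_def algebra_simps)
  qed
  show int: "integrable (lborel \<Otimes>\<^sub>M lborel) (\<lambda>p. k (fst p - snd p) * (u (fst p) * v (snd p)))"
  proof (rule Bochner_Integration.integrable_bound[OF G])
    show "AE p in lborel \<Otimes>\<^sub>M lborel. norm (k (fst p - snd p) * (u (fst p) * v (snd p))) \<le> norm (G p)"
      using le by (intro AE_I2) (metis abs_ge_self order_trans real_norm_def)
  qed measurable
  have "\<bar>form k u v\<bar> \<le> (\<integral>p. \<bar>k (fst p - snd p) * (u (fst p) * v (snd p))\<bar> \<partial>(lborel \<Otimes>\<^sub>M lborel))"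
    unfolding form_def by (rule integral_abs_bound)
  also have "\<dots> \<le> (\<integral>p. G p \<partial>(lborel \<Otimes>\<^sub>M lborel))"
    by (intro integral_mono integrable_abs int G le)
  also have "\<dots> = \<delta> * (mass * (\<integral>x. (u x)\<^sup>2 \<partial>lborel)) + (mass * (\<integral>x. (v x)\<^sup>2 \<partial>lborel)) / \<delta>"
    unfolding G_def
    by (subst Bochner_Integration.integral_add)
      (simp_all add: edge_integrable_left[OF iu] edge_integrable_right[OF iv] integrable_divide)
  finally show "\<bar>form k u v\<bar> \<le> mass * (\<delta> * (\<integral>x. (u x)\<^sup>2 \<partial>lborel) + (\<integral>x. (v x)\<^sup>2 \<partial>lborel) / \<delta>)"
    by (simp add: algebra_simps)
qed

lemmas form_integrable' = form_integrable[OF _ _ zero_less_one]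

lemma form_eq:
  assumes "square_integrable u" "square_integrable v"
  shows "form k u v = (\<integral>x. u x * (\<integral>y. k (x - y) * v y \<partial>lborel) \<partial>lborel)"
proof -
  have "form k u v = (\<integral>x. \<integral>y. k (x - y) * (u x * v y) \<partial>lborel \<partial>lborel)"
    using lborel_pair.integral_fst'[OF form_integrable'[OF assms]] by (simp add: form_def)
  also have "\<dots> = (\<integral>x. u x * (\<integral>y. k (x - y) * v y \<partial>lborel) \<partial>lborel)"
    by (simp add: mult.left_commute)
  finally show ?thesis .
qed

lemma form_sym:
  assumes "square_integrable u" "square_integrable v"
  shows "form k u v = form k v u"
proof -
  have [measurable]: "u \<in> borel_measurable borel" "v \<in> borel_measurable borel"
    using assms by (auto intro: square_integrable_measurable)
  show ?thesis
    using pair_swap(2)[of "\<lambda>x y. v x * u y"] by (simp add: form_def mult.commute)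
qed

lemma form_add_left:
  assumes "square_integrable u" "square_integrable u'" "square_integrable v"
  shows "form k (\<lambda>x. u x + c * u' x) v = form k u v + c * form k u' v"
proof -
  have "form k (\<lambda>x. u x + c * u' x) v = (\<integral>p. k (fst p - snd p) * (u (fst p) * v (snd p))
      + c * (k (fst p - snd p) * (u' (fst p) * v (snd p))) \<partial>(lborel \<Otimes>\<^sub>M lborel))"
    unfolding form_def by (intro Bochner_Integration.integral_cong) (auto simp: algebra_simps)
  then show ?thesis using assms by (simp add: form_def form_integrable')
qed

lemma form_add_right:
  assumes "square_integrable v" "square_integrable v'" "square_integrable u"
  shows "form k u (\<lambda>x. v x + c * v' x) = form k u v + c * form k u v'"
proof -
  have *: "square_integrable (\<lambda>x. v x + c * v' x)"
    using assms by (intro square_integrable_add square_integrable_scale)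
  show ?thesis
    using form_sym[OF assms(3) *] form_add_left[OF assms] form_sym[OF assms(3,1)] form_sym[OF assms(3,2)] by simp
qed

end

section \<open>Densities on a window with thin boundary\<close>

text \<open>
  \<open>w\<close> is the indicator of a Borel version of the window, \<open>g\<close> a Borel version of the perturbation extended
  by zero, and \<open>near \<rho>\<close> the indicator of the boundary layer of width \<open>\<rho>\<close>.  The geometry of the window
  enters only through \<open>interior\<close> and the linear growth in \<open>\<rho>\<close> of the two integrals over the layer.
\<close>
locale window =
  fixes w g :: "'a::euclidean_space \<Rightarrow> real" and near :: "real \<Rightarrow> 'a \<Rightarrow> real" and C :: real
  assumes w_measurable [measurable]: "w \<in> borel_measurable borel"
    and w_01: "\<And>x. w x = 0 \<or> w x = 1"
    and w_integrable: "integrable lborel w" and w_integral: "(\<integral>x. w x \<partial>lborel) = 1"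
    and g_measurable [measurable]: "g \<in> borel_measurable borel"
    and g_outside: "\<And>x. w x = 0 \<Longrightarrow> g x = 0"
    and g_cube: "integrable lborel (\<lambda>x. \<bar>g x\<bar>^3)"
    and g_mean: "(\<integral>x. g x \<partial>lborel) = 0"
    and near_measurable [measurable]: "\<And>\<rho>. near \<rho> \<in> borel_measurable borel"
    and near_01: "\<And>\<rho> x. near \<rho> x = 0 \<or> near \<rho> x = 1"
    and interior: "\<And>\<rho> x. w x = 1 \<Longrightarrow> near \<rho> x = 0 \<Longrightarrow> AE y in lborel. norm (x - y) \<le> \<rho> \<longrightarrow> w y = 1"
    and C_nonneg: "C \<ge> 0"
    and near_w: "\<And>\<rho>. \<rho> > 0 \<Longrightarrow> (\<integral>x. near \<rho> x * w x \<partial>lborel) \<le> C * \<rho>"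
    and near_g: "\<And>\<rho>. \<rho> > 0 \<Longrightarrow> (\<integral>x. near \<rho> x * \<bar>g x\<bar> \<partial>lborel) \<le> C * \<rho>"
begin

definition G2 :: real where "G2 = (\<integral>x. (g x)\<^sup>2 \<partial>lborel)"
definition G3 :: real where "G3 = (\<integral>x. \<bar>g x\<bar>^3 \<partial>lborel)"

lemma w_nonneg: "w x \<ge> 0" and w_le_1: "w x \<le> 1" and w_power: "n > 0 \<Longrightarrow> w x ^ n = w x"
  using w_01[of x] by auto

lemma w_mult_g [simp]: "w x * g x = g x"
  using w_01[of x] g_outside[of x] by auto

lemma near_nonneg: "near \<rho> x \<ge> 0" and near_le_1: "near \<rho> x \<le> 1"
  using near_01[of \<rho> x] by auto

lemma power_le_cube:
  assumes n: "n \<le> 3" "0 < n"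
  shows "\<bar>g x\<bar>^n \<le> w x + \<bar>g x\<bar>^3"
proof (cases "w x = 0")
  case False
  have "\<bar>g x\<bar>^n \<le> 1 + \<bar>g x\<bar>^3"
  proof (cases "\<bar>g x\<bar> \<le> 1")
    case True
    then have "\<bar>g x\<bar>^n \<le> 1" by (simp add: power_le_one)
    then show ?thesis by (simp add: add_increasing2)
  next
    case False
    then have "\<bar>g x\<bar>^n \<le> \<bar>g x\<bar>^3" using n by (intro power_increasing) auto
    then show ?thesis by simp
  qed
  then show ?thesis using False w_01[of x] by auto
qed (use n in \<open>simp add: g_outside zero_power\<close>)

lemma g_power_integrable:
  assumes "n \<le> 3" "0 < n"
  shows "integrable lborel (\<lambda>x. \<bar>g x\<bar>^n)"
proof (rule Bochner_Integration.integrable_bound)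
  show "integrable lborel (\<lambda>x. w x + \<bar>g x\<bar>^3)" using w_integrable g_cube by simp
  show "AE x in lborel. norm (\<bar>g x\<bar>^n) \<le> norm (w x + \<bar>g x\<bar>^3)"
    using power_le_cube[OF assms] by (intro AE_I2) (simp add: w_nonneg)
qed measurable

lemma abs_g_integrable: "integrable lborel (\<lambda>x. \<bar>g x\<bar>)"
  using g_power_integrable[of 1] by simp

lemma g_integrable: "integrable lborel g"
  using abs_g_integrable by (rule integrable_abs_cancel) simp

lemma g_square_integrable: "square_integrable g"
  using g_power_integrable[of 2] by (simp add: square_integrable_def)

lemma w_square_integrable: "square_integrable w"
  using w_integrable by (simp add: square_integrable_def w_power)

lemma G_nonneg: "G2 \<ge> 0" "G3 \<ge> 0"
  by (auto simp: G2_def G3_def intro!: integral_nonneg_AE)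

lemma near_times_integrable:
  assumes "integrable lborel u" shows "integrable lborel (\<lambda>x. near \<rho> x * u x)"
proof (rule Bochner_Integration.integrable_bound[OF assms])
  have [measurable]: "u \<in> borel_measurable borel" using assms by (simp add: borel_measurable_integrable)
  show "(\<lambda>x. near \<rho> x * u x) \<in> borel_measurable lborel" by measurable
  show "AE x in lborel. norm (near \<rho> x * u x) \<le> norm (u x)"
    by (intro AE_I2) (simp add: abs_mult mult_left_le_one_le near_nonneg near_le_1)
qed

end

locale window_mollifier = window w g near C + mollifier k r
  for w g :: "'a::euclidean_space \<Rightarrow> real" and near C and k :: "'a \<Rightarrow> real" and r +
  assumes r_pos: "r > 0"
begin

definition conv :: "('a \<Rightarrow> real) \<Rightarrow> 'a \<Rightarrow> real" where
  "conv u x = (\<integral>y. k (x - y) * u y \<partial>lborel)"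

lemma conv_measurable [measurable]: "u \<in> borel_measurable borel \<Longrightarrow> conv u \<in> borel_measurable borel"
proof -
  assume [measurable]: "u \<in> borel_measurable borel"
  show "conv u \<in> borel_measurable borel" unfolding conv_def by measurable
qed

lemma k_bounded_integrable:
  assumes [measurable]: "u \<in> borel_measurable borel" and B: "\<And>y. \<bar>u y\<bar> \<le> B"
  shows "integrable lborel (\<lambda>y. k (x - y) * u y)"
proof (rule Bochner_Integration.integrable_bound)
  show "integrable lborel (\<lambda>y. B * k (x - y))" by (intro integrable_mult_right k_translate_integrable)
  have "norm (k (x - y) * u y) \<le> norm (B * k (x - y))" for y
  proof -
    have "\<bar>u y\<bar> * k (x - y) \<le> B * k (x - y)" by (intro mult_right_mono B k_nonneg)
    then show ?thesis using B[of y] by (simp add: abs_mult k_nonneg mult.commute)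
  qed
  then show "AE y in lborel. norm (k (x - y) * u y) \<le> norm (B * k (x - y))" by simp
qed measurable

lemma conv_bound:
  assumes [measurable]: "u \<in> borel_measurable borel" and B: "\<And>y. \<bar>u y\<bar> \<le> B"
  shows "\<bar>conv u x\<bar> \<le> mass * B"
proof -
  have "\<bar>conv u x\<bar> \<le> (\<integral>y. \<bar>k (x - y) * u y\<bar> \<partial>lborel)" unfolding conv_def by (rule integral_abs_bound)
  also have "\<dots> \<le> (\<integral>y. B * k (x - y) \<partial>lborel)"
    by (intro integral_mono integrable_abs k_bounded_integrable[OF assms] integrable_mult_right k_translate_integrable)
      (auto simp: abs_mult k_nonneg mult.commute intro!: mult_right_mono B)
  also have "\<dots> = mass * B" by (simp add: k_translate_mass)
  finally show ?thesis .
qed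

lemma conv_window_interior:
  assumes "w x = 1" "near r x = 0" and [measurable]: "u \<in> borel_measurable borel"
  shows "conv (\<lambda>y. w y * u y) x = conv u x"
  unfolding conv_def
proof (rule integral_cong_AE)
  show "AE y in lborel. k (x - y) * (w y * u y) = k (x - y) * u y"
    using interior[OF assms(1,2)]
  proof eventually_elim
    case (elim y)
    then show ?case using k_support[of "x - y"] by (cases "norm (x - y) \<le> r") auto
  qed
qed measurable

lemma conv_w_nonneg: "conv w x \<ge> 0"
  unfolding conv_def by (intro integral_nonneg_AE AE_I2 mult_nonneg_nonneg k_nonneg w_nonneg)

lemma conv_w_le: "conv w x \<le> mass"
  using conv_bound[of w 1 x] w_nonneg w_le_1 by (simp add: abs_le_iff)

text \<open>Off the boundary layer the support of the translated kernel lies in the window.\<close>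
lemma conv_w_approx:
  assumes "w x = 1"
  shows "\<bar>conv w x - mass\<bar> \<le> mass * near r x"
proof (cases "near r x = 0")
  case True
  then have "conv w x = conv (\<lambda>_. 1) x" using conv_window_interior[OF assms True, of "\<lambda>_. 1"] by simp
  also have "\<dots> = mass" by (simp add: conv_def k_translate_mass)
  finally show ?thesis by (simp add: True)
next
  case False
  then show ?thesis using near_01[of r x] conv_w_nonneg[of x] conv_w_le[of x] by (simp add: abs_le_iff)
qed

lemma form_w_w: "\<bar>form k w w - mass\<bar> \<le> mass * (C * r)"
proof -
  have bnd: "\<bar>w x * (conv w x - mass)\<bar> \<le> mass * (near r x * w x)" for x
    using conv_w_approx[of x] w_01[of x] by auto
  have int: "integrable lborel (\<lambda>x. w x * (conv w x - mass))"
  proof (rule Bochner_Integration.integrable_bound)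
    show "integrable lborel (\<lambda>x. mass * (near r x * w x))"
      by (intro integrable_mult_right near_times_integrable w_integrable)
    show "AE x in lborel. norm (w x * (conv w x - mass)) \<le> norm (mass * (near r x * w x))"
      using bnd by (intro AE_I2) (metis abs_ge_self order_trans real_norm_def)
  qed measurable
  have "form k w w - mass = (\<integral>x. w x * (conv w x - mass) \<partial>lborel)"
  proof -
    have "form k w w = (\<integral>x. w x * (conv w x - mass) + mass * w x \<partial>lborel)"
      unfolding form_eq[OF w_square_integrable w_square_integrable] conv_def[symmetric]
      by (simp add: algebra_simps)
    also have "\<dots> = (\<integral>x. w x * (conv w x - mass) \<partial>lborel) + mass"
      using int w_integrable by (simp add: w_integral)
    finally show ?thesis by simp
  qed
  also have "\<bar>\<dots>\<bar> \<le> (\<integral>x. \<bar>w x * (conv w x - mass)\<bar> \<partial>lborel)" by (rule integral_abs_bound)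
  also have "\<dots> \<le> (\<integral>x. mass * (near r x * w x) \<partial>lborel)"
    by (intro integral_mono integrable_abs int integrable_mult_right near_times_integrable w_integrable bnd)
  also have "\<dots> \<le> mass * (C * r)" using near_w[OF r_pos] by (simp add: mult_left_mono mass_nonneg)
  finally show ?thesis .
qed

text \<open>
  Because \<open>g\<close> has mean zero, \<open>conv w\<close> may be replaced by its deviation from the constant \<open>mass\<close>, which
  lives on the boundary layer.  Hence the part of the mean shift that is linear in the perturbation
  is of lower order.
\<close>
lemma form_g_w: "\<bar>form k g w\<bar> \<le> mass * (C * r)"
proof -
  have bnd: "\<bar>g x * (conv w x - mass)\<bar> \<le> mass * (near r x * \<bar>g x\<bar>)" for x
  proof (cases "w x = 0")
    case False
    then have "\<bar>g x\<bar> * \<bar>conv w x - mass\<bar> \<le> \<bar>g x\<bar> * (mass * near r x)"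
      using conv_w_approx[of x] w_01[of x] by (intro mult_left_mono) auto
    then show ?thesis by (simp add: abs_mult mult_ac)
  qed (simp add: g_outside)
  have int: "integrable lborel (\<lambda>x. g x * (conv w x - mass))"
  proof (rule Bochner_Integration.integrable_bound)
    show "integrable lborel (\<lambda>x. mass * (near r x * \<bar>g x\<bar>))"
      by (intro integrable_mult_right near_times_integrable abs_g_integrable)
    show "AE x in lborel. norm (g x * (conv w x - mass)) \<le> norm (mass * (near r x * \<bar>g x\<bar>))"
      using bnd by (intro AE_I2) (metis abs_ge_self order_trans real_norm_def)
  qed measurable
  have "form k g w = (\<integral>x. g x * (conv w x - mass) + mass * g x \<partial>lborel)"
    unfolding form_eq[OF g_square_integrable w_square_integrable] conv_def[symmetric]
    by (simp add: algebra_simps)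
  also have "\<dots> = (\<integral>x. g x * (conv w x - mass) \<partial>lborel)"
    using int g_integrable by (simp add: g_mean)
  also have "\<bar>\<dots>\<bar> \<le> (\<integral>x. \<bar>g x * (conv w x - mass)\<bar> \<partial>lborel)" by (rule integral_abs_bound)
  also have "\<dots> \<le> (\<integral>x. mass * (near r x * \<bar>g x\<bar>) \<partial>lborel)"
    by (intro integral_mono integrable_abs int integrable_mult_right near_times_integrable abs_g_integrable bnd)
  also have "\<dots> \<le> mass * (C * r)" using near_g[OF r_pos] by (simp add: mult_left_mono mass_nonneg)
  finally show ?thesis .
qed

lemma form_g_g: "\<bar>form k g g\<bar> \<le> mass * (2 * G2)"
  using form_le[OF g_square_integrable g_square_integrable zero_less_one] by (simp add: G2_def)

lemma form_perturbed:
  "form k (\<lambda>x. w x + a * g x) (\<lambda>x. w x + a * g x) = form k w w + 2 * a * form k g w + a\<^sup>2 * form k g g"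
proof -
  note w = w_square_integrable and g = g_square_integrable
  have f: "square_integrable (\<lambda>x. w x + a * g x)"
    by (intro square_integrable_add square_integrable_scale w g)
  show ?thesis
    unfolding form_add_left[OF w g f] form_add_right[OF w g w] form_add_right[OF w g g] form_sym[OF w g]
    by (simp add: power2_eq_square algebra_simps)
qed

end

context window
begin

text \<open>
  First \<open>g\<close> is clamped to a bounded interval, then a sequence of continuous functions converging to
  \<open>g\<close> almost everywhere is clamped to the same interval.  Both errors vanish by dominated
  convergence, the second one since the window has finite measure.
\<close>
lemma bounded_continuous_approximation:
  assumes e: "e > 0"
  obtains \<phi> where "continuous_on UNIV \<phi>" "\<exists>B. \<forall>x. \<bar>\<phi> x\<bar> \<le> (B::real)"
    "(\<integral>x. (g x - w x * \<phi> x)\<^sup>2 \<partial>lborel) < e"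
proof -
  define clamp where "clamp n t = max (- real n) (min (real n) t)" for n and t :: real
  have clamp_bound: "\<bar>clamp n t\<bar> \<le> real n" for n t by (auto simp: clamp_def)
  have clamp_near: "norm ((t - clamp n t)\<^sup>2) \<le> t\<^sup>2" for n t
  proof -
    have "\<bar>t - clamp n t\<bar> \<le> \<bar>t\<bar>" by (auto simp: clamp_def)
    then show ?thesis by (simp add: abs_le_square_iff)
  qed
  have clamp_diff: "norm (w x * (clamp n s - clamp n t)\<^sup>2) \<le> 4 * (real n)\<^sup>2 * w x" for n s t x
  proof -
    have "\<bar>clamp n s - clamp n t\<bar> \<le> 2 * real n"
      using clamp_bound[of n s] clamp_bound[of n t] by linarith
    then have "(clamp n s - clamp n t)\<^sup>2 \<le> (2 * real n)\<^sup>2"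
      using power_mono[OF _ abs_ge_zero, where n = 2] by fastforce
    then show ?thesis using w_01[of x] by auto
  qed
  have clamp_cont: "continuous_on UNIV (clamp n)" for n
    unfolding clamp_def by (intro continuous_intros)
  have [measurable]: "clamp n \<in> borel_measurable borel" for n
    by (rule borel_measurable_continuous_onI[OF clamp_cont])
  have g2: "integrable lborel (\<lambda>x. (g x)\<^sup>2)" using g_square_integrable by (simp add: square_integrable_def)
  have "(\<lambda>n. \<integral>x. (g x - clamp n (g x))\<^sup>2 \<partial>lborel) \<longlonglongrightarrow> (\<integral>x. 0 \<partial>(lborel :: 'a measure))"
  proof (rule integral_dominated_convergence[where w = "\<lambda>x. (g x)\<^sup>2"])
    show "AE x in lborel. (\<lambda>n. (g x - clamp n (g x))\<^sup>2) \<longlonglongrightarrow> 0"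
    proof (intro AE_I2 tendsto_eventually)
      fix x
      obtain n0 where n0: "\<bar>g x\<bar> \<le> real n0" using real_arch_simple by blast
      have "(g x - clamp n (g x))\<^sup>2 = 0" if "n \<ge> n0" for n
      proof -
        have "\<bar>g x\<bar> \<le> real n" using n0 that by linarith
        then show ?thesis by (auto simp: clamp_def)
      qed
      then show "\<forall>\<^sub>F n in sequentially. (g x - clamp n (g x))\<^sup>2 = 0"
        by (auto simp: eventually_sequentially)
    qed
    show "AE x in lborel. norm ((g x - clamp n (g x))\<^sup>2) \<le> (g x)\<^sup>2" for n
      by (intro AE_I2 clamp_near)
  qed (use g2 in measurable)
  then have "\<forall>\<^sub>F n in sequentially. (\<integral>x. (g x - clamp n (g x))\<^sup>2 \<partial>lborel) < e / 4"
    using e by (intro order_tendstoD(2)[of _ 0]) auto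
  then obtain n where n: "(\<integral>x. (g x - clamp n (g x))\<^sup>2 \<partial>lborel) < e / 4"
    by (auto simp: eventually_sequentially)
  have "g \<in> borel_measurable lebesgue" by (rule borel_measurable_subalgebra[OF _ _ g_measurable]) auto
  then have "g measurable_on UNIV"
    by (intro lebesgue_measurable_imp_measurable_on) auto
  then obtain Z \<psi> where Z: "negligible Z" and \<psi>: "\<And>m. continuous_on UNIV (\<psi> m)"
    and lim: "\<And>x. x \<notin> Z \<Longrightarrow> (\<lambda>m. \<psi> m x) \<longlonglongrightarrow> g x"
    unfolding measurable_on_def by auto
  have [measurable]: "\<psi> m \<in> borel_measurable borel" for m :: nat
    by (rule borel_measurable_continuous_onI[OF \<psi>])
  have AE_Z: "AE x in lborel. x \<notin> Z"
  proof -
    have "AE x in lebesgue. x \<notin> Z" using Z by (intro AE_not_in) (simp add: negligible_iff_null_sets)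
    then show ?thesis using AE_completion_iff[of "\<lambda>x. x \<notin> Z" lborel] by simp
  qed
  have "(\<lambda>m. \<integral>x. w x * (clamp n (g x) - clamp n (\<psi> m x))\<^sup>2 \<partial>lborel) \<longlonglongrightarrow> (\<integral>x. 0 \<partial>(lborel :: 'a measure))"
  proof (rule integral_dominated_convergence[where w = "\<lambda>x. 4 * (real n)\<^sup>2 * w x"])
    show "AE x in lborel. (\<lambda>m. w x * (clamp n (g x) - clamp n (\<psi> m x))\<^sup>2) \<longlonglongrightarrow> 0"
      using AE_Z
    proof eventually_elim
      case (elim x)
      have "isCont (clamp n) (g x)"
        using clamp_cont by (simp add: continuous_on_eq_continuous_at)
      then have "(\<lambda>m. clamp n (\<psi> m x)) \<longlonglongrightarrow> clamp n (g x)"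
        by (rule isCont_tendsto_compose[OF _ lim[OF elim]])
      then have "(\<lambda>m. w x * (clamp n (g x) - clamp n (\<psi> m x))\<^sup>2) \<longlonglongrightarrow> w x * (clamp n (g x) - clamp n (g x))\<^sup>2"
        by (intro tendsto_intros)
      then show ?case by simp
    qed
    show "AE x in lborel. norm (w x * (clamp n (g x) - clamp n (\<psi> m x))\<^sup>2) \<le> 4 * (real n)\<^sup>2 * w x" for m
      by (intro AE_I2 clamp_diff)
  qed (auto simp: w_integrable)
  then have "\<forall>\<^sub>F m in sequentially. (\<integral>x. w x * (clamp n (g x) - clamp n (\<psi> m x))\<^sup>2 \<partial>lborel) < e / 4"
    using e by (intro order_tendstoD(2)[of _ 0]) auto
  then obtain m where m: "(\<integral>x. w x * (clamp n (g x) - clamp n (\<psi> m x))\<^sup>2 \<partial>lborel) < e / 4"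
    by (auto simp: eventually_sequentially)
  have i1: "integrable lborel (\<lambda>x. (g x - clamp n (g x))\<^sup>2)"
  proof (rule Bochner_Integration.integrable_bound[OF g2])
    show "AE x in lborel. norm ((g x - clamp n (g x))\<^sup>2) \<le> norm ((g x)\<^sup>2)"
      using clamp_near by (intro AE_I2) simp
  qed measurable
  have i2: "integrable lborel (\<lambda>x. w x * (clamp n (g x) - clamp n (\<psi> m x))\<^sup>2)"
  proof (rule Bochner_Integration.integrable_bound)
    show "integrable lborel (\<lambda>x. 4 * (real n)\<^sup>2 * w x)" using w_integrable by simp
    show "AE x in lborel. norm (w x * (clamp n (g x) - clamp n (\<psi> m x))\<^sup>2) \<le> norm (4 * (real n)\<^sup>2 * w x)"
      using clamp_diff by (intro AE_I2) (simp add: w_nonneg)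
  qed measurable
  define \<phi> where "\<phi> x = clamp n (\<psi> m x)" for x
  show ?thesis
  proof (rule that[of \<phi>])
    show "continuous_on UNIV \<phi>"
      unfolding \<phi>_def by (rule continuous_on_compose2[OF clamp_cont \<psi>]) auto
    show "\<exists>B. \<forall>x. \<bar>\<phi> x\<bar> \<le> (B::real)" using clamp_bound by (auto simp: \<phi>_def)
    have le: "(g x - w x * \<phi> x)\<^sup>2 \<le> 2 * (g x - clamp n (g x))\<^sup>2 + 2 * (w x * (clamp n (g x) - \<phi> x)\<^sup>2)" for x
    proof (cases "w x = 0")
      case False
      then have "w x = 1" using w_01[of x] by auto
      then show ?thesis
        using sum_squares_bound[of "g x - clamp n (g x)" "clamp n (g x) - \<phi> x"]
        by (simp add: power2_eq_square algebra_simps)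
    qed (simp add: g_outside)
    have "(\<integral>x. (g x - w x * \<phi> x)\<^sup>2 \<partial>lborel) \<le> (\<integral>x. 2 * (g x - clamp n (g x))\<^sup>2 + 2 * (w x * (clamp n (g x) - \<phi> x)\<^sup>2) \<partial>lborel)"
    proof (rule integral_mono')
      show "integrable lborel (\<lambda>x. 2 * (g x - clamp n (g x))\<^sup>2 + 2 * (w x * (clamp n (g x) - \<phi> x)\<^sup>2))"
        using i1 i2 by (simp add: \<phi>_def)
    qed (use le in \<open>auto simp: w_nonneg\<close>)
    also have "\<dots> = 2 * (\<integral>x. (g x - clamp n (g x))\<^sup>2 \<partial>lborel) + 2 * (\<integral>x. w x * (clamp n (g x) - \<phi> x)\<^sup>2 \<partial>lborel)"
      using i1 i2 by (simp add: \<phi>_def)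
    also have "\<dots> < e" using n m by (simp add: \<phi>_def)
    finally show "(\<integral>x. (g x - w x * \<phi> x)\<^sup>2 \<partial>lborel) < e" .
  qed
qed

end


lemma (in window_mollifier) conv_continuous_approx:
  assumes [measurable]: "\<phi> \<in> borel_measurable borel" and B: "\<And>y. \<bar>\<phi> y\<bar> \<le> B"
    and e: "\<And>y. norm (x - y) \<le> r \<Longrightarrow> \<bar>\<phi> y - \<phi> x\<bar> \<le> e"
  shows "\<bar>conv \<phi> x - mass * \<phi> x\<bar> \<le> mass * e"
proof -
  have int: "integrable lborel (\<lambda>y. k (x - y) * \<phi> y)" by (rule k_bounded_integrable[OF assms(1,2)])
  have int': "integrable lborel (\<lambda>y. k (x - y) * (\<phi> y - \<phi> x))"
    unfolding right_diff_distrib using int k_translate_integrable by simp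
  have "conv \<phi> x - mass * \<phi> x = (\<integral>y. k (x - y) * (\<phi> y - \<phi> x) \<partial>lborel)"
    unfolding right_diff_distrib using int k_translate_integrable[of x]
    by (simp add: conv_def k_translate_mass)
  also have "\<bar>\<dots>\<bar> \<le> (\<integral>y. \<bar>k (x - y) * (\<phi> y - \<phi> x)\<bar> \<partial>lborel)" by (rule integral_abs_bound)
  also have "\<dots> \<le> (\<integral>y. k (x - y) * e \<partial>lborel)"
  proof (intro integral_mono integrable_abs int' integrable_mult_left k_translate_integrable)
    fix y
    show "\<bar>k (x - y) * (\<phi> y - \<phi> x)\<bar> \<le> k (x - y) * e"
    proof (cases "norm (x - y) \<le> r")
      case True
      then show ?thesis by (auto simp: abs_mult k_nonneg intro!: mult_left_mono e)
    next
      case False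
      then show ?thesis using k_support[of "x - y"] by simp
    qed
  qed
  also have "\<dots> = mass * e" by (simp add: k_translate_mass)
  finally show ?thesis .
qed

text \<open>
  The normalised kernels are an approximate identity.  One argument \<open>g\<close> is replaced by a bounded
  continuous function cut off at the window; the convolution of the latter converges pointwise off the
  boundary layer, and dominated convergence with majorant \<open>\<bar>g\<bar>\<close> gives the limit.
\<close>
lemma (in window) form_g_g_limit:
  fixes k :: "nat \<Rightarrow> 'a \<Rightarrow> real" and r :: "nat \<Rightarrow> real"
  assumes k: "\<And>n. window_mollifier w g near C (k n) (r n)"
    and mass_pos: "\<And>n. (\<integral>z. k n z \<partial>lborel) > 0" and r: "r \<longlonglongrightarrow> 0"
  shows "(\<lambda>n. form (k n) g g / (\<integral>z. k n z \<partial>lborel)) \<longlonglongrightarrow> G2"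
proof (rule LIMSEQ_I)
  fix e :: real assume e: "e > 0"
  interpret K: window_mollifier w g near C "k n" "r n" for n by (rule k)
  \<comment> \<open>\<open>\<delta>\<close> weighs \<open>g\<close> against the approximation error, so that replacing \<open>g\<close> once costs at most \<open>e / 4\<close>\<close>
  define \<delta> where "\<delta> = e / (8 * (G2 + 1))"
  have \<delta>: "\<delta> > 0" "\<delta> * G2 \<le> e / 8"
    using e G_nonneg(1) by (auto simp: \<delta>_def field_simps)
  have "\<delta> * e / 8 > 0" using \<delta> e by simp
  from bounded_continuous_approximation[OF this] obtain \<phi> where \<phi>: "continuous_on UNIV \<phi>"
    and ex: "\<exists>B. \<forall>x. \<bar>\<phi> x\<bar> \<le> (B::real)" and close: "(\<integral>x. (g x - w x * \<phi> x)\<^sup>2 \<partial>lborel) < \<delta> * e / 8" .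
  from ex obtain B where B: "\<And>x. \<bar>\<phi> x\<bar> \<le> B" by blast
  have B0: "B \<ge> 0" using B[of undefined] by linarith
  have [measurable]: "\<phi> \<in> borel_measurable borel" by (rule borel_measurable_continuous_onI[OF \<phi>])
  define u where "u x = w x * \<phi> x" for x
  define \<psi> where "\<psi> x = g x - u x" for x
  have [measurable]: "u \<in> borel_measurable borel" unfolding u_def by measurable
  have u_bound: "\<bar>u y\<bar> \<le> B" for y
  proof (cases "w y = 0")
    case False
    then show ?thesis using w_01[of y] B[of y] by (simp add: u_def)
  qed (simp add: u_def B0)
  have u: "square_integrable u"
    unfolding square_integrable_def
  proof
    show "integrable lborel (\<lambda>x. (u x)\<^sup>2)"
    proof (rule Bochner_Integration.integrable_bound[where f = "\<lambda>x. B\<^sup>2 * w x"])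
      show "AE x in lborel. norm ((u x)\<^sup>2) \<le> norm (B\<^sup>2 * w x)"
      proof (rule AE_I2)
        fix x
        show "norm ((u x)\<^sup>2) \<le> norm (B\<^sup>2 * w x)"
        proof (cases "w x = 0")
          case False
          then show ?thesis using w_01[of x] power_mono[OF B abs_ge_zero, of x 2] by (simp add: u_def)
        qed (simp add: u_def)
      qed
    qed (auto simp: w_integrable)
  qed measurable
  have \<psi>: "square_integrable \<psi>"
    unfolding \<psi>_def by (intro square_integrable_diff g_square_integrable u)
  have small: "\<delta> * G2 + (\<integral>x. (\<psi> x)\<^sup>2 \<partial>lborel) / \<delta> \<le> e / 4"
  proof -
    have "(\<integral>x. (\<psi> x)\<^sup>2 \<partial>lborel) / \<delta> \<le> e / 8"
      using close \<delta>(1) by (simp add: \<psi>_def u_def field_simps)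
    then show ?thesis using \<delta>(2) by linarith
  qed
  have gu_int: "integrable lborel (\<lambda>x. g x * u x)" and g\<psi>_int: "integrable lborel (\<lambda>x. g x * \<psi> x)"
    by (intro square_integrable_mult g_square_integrable u \<psi>)+
  have limit_gap: "\<bar>(\<integral>x. g x * u x \<partial>lborel) - G2\<bar> \<le> e / 4"
  proof -
    have g2: "integrable lborel (\<lambda>x. g x * g x)"
      by (intro square_integrable_mult g_square_integrable)
    have "G2 - (\<integral>x. g x * u x \<partial>lborel) = (\<integral>x. g x * \<psi> x \<partial>lborel)"
      using g2 gu_int by (simp add: \<psi>_def right_diff_distrib G2_def power2_eq_square)
    also have "\<bar>\<dots>\<bar> \<le> (\<integral>x. \<bar>g x * \<psi> x\<bar> \<partial>lborel)" by (rule integral_abs_bound)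
    also have "\<dots> \<le> (\<integral>x. \<delta> * (g x)\<^sup>2 + (\<psi> x)\<^sup>2 / \<delta> \<partial>lborel)"
      using g_square_integrable \<psi>
      by (intro integral_mono integrable_abs g\<psi>_int weighted_AM_GM \<delta>)
        (auto simp: square_integrable_def integrable_divide)
    also have "\<dots> = \<delta> * G2 + (\<integral>x. (\<psi> x)\<^sup>2 \<partial>lborel) / \<delta>"
      using g_square_integrable \<psi> by (simp add: square_integrable_def G2_def integrable_divide)
    finally show ?thesis using small by linarith
  qed
  define c where "c n = (\<integral>z. k n z \<partial>lborel)" for n
  have c: "c n > 0" "K.mass n = c n" for n using mass_pos by (auto simp: c_def K.mass_def)
  define D where "D n x = K.conv n u x / c n - \<phi> x" for n x
  have [measurable]: "D n \<in> borel_measurable borel" for n unfolding D_def by measurable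
  have D_bound: "\<bar>D n x\<bar> \<le> 2 * B" for n x
  proof -
    have "\<bar>K.conv n u x / c n\<bar> \<le> B"
      using K.conv_bound[of u B n x] u_bound c[of n] by (simp add: field_simps)
    then show ?thesis using B[of x] unfolding D_def by linarith
  qed
  have gD_bound: "\<bar>g x * D n x\<bar> \<le> 2 * B * \<bar>g x\<bar>" for n x
    using mult_left_mono[OF D_bound, of "\<bar>g x\<bar>" n x] by (simp add: abs_mult mult_ac)
  have gD_int: "integrable lborel (\<lambda>x. g x * D n x)" for n
    by (rule Bochner_Integration.integrable_bound[where f = "\<lambda>x. 2 * B * \<bar>g x\<bar>"])
      (use gD_bound B0 in \<open>auto simp: abs_g_integrable abs_mult\<close>)
  have near_part: "(\<lambda>n. \<integral>x. near (r n) x * (g x * D n x) \<partial>lborel) \<longlonglongrightarrow> 0"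
  proof (rule Lim_null_comparison)
    show "(\<lambda>n. 2 * B * (C * r n)) \<longlonglongrightarrow> 0" using tendsto_mult_right_zero[OF tendsto_mult_right_zero[OF r]] .
    have "norm (\<integral>x. near (r n) x * (g x * D n x) \<partial>lborel) \<le> 2 * B * (C * r n)" for n
    proof -
      have "norm (\<integral>x. near (r n) x * (g x * D n x) \<partial>lborel) \<le> (\<integral>x. 2 * B * (near (r n) x * \<bar>g x\<bar>) \<partial>lborel)"
      proof (rule order_trans[OF integral_norm_bound integral_mono])
        show "integrable lborel (\<lambda>x. norm (near (r n) x * (g x * D n x)))"
          by (intro integrable_norm near_times_integrable gD_int)
        show "integrable lborel (\<lambda>x. 2 * B * (near (r n) x * \<bar>g x\<bar>))"
          by (intro integrable_mult_right near_times_integrable abs_g_integrable)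
        show "norm (near (r n) x * (g x * D n x)) \<le> 2 * B * (near (r n) x * \<bar>g x\<bar>)" for x
          using near_01[of "r n" x] gD_bound[of x n] by auto
      qed
      also have "\<dots> \<le> 2 * B * (C * r n)"
        using near_g[OF K.r_pos, of n] B0 by (simp add: mult_left_mono)
      finally show ?thesis .
    qed
    then show "\<forall>\<^sub>F n in sequentially. norm (\<integral>x. near (r n) x * (g x * D n x) \<partial>lborel) \<le> 2 * B * (C * r n)"
      by simp
  qed
  have far_part: "(\<lambda>n. \<integral>x. (1 - near (r n) x) * (g x * D n x) \<partial>lborel) \<longlonglongrightarrow> (\<integral>x. 0 \<partial>(lborel :: 'a measure))"
  proof (rule integral_dominated_convergence[where w = "\<lambda>x. 2 * B * \<bar>g x\<bar>"])
    show "AE x in lborel. (\<lambda>n. (1 - near (r n) x) * (g x * D n x)) \<longlonglongrightarrow> 0"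
    proof (intro AE_I2)
      fix x
      show "(\<lambda>n. (1 - near (r n) x) * (g x * D n x)) \<longlonglongrightarrow> 0"
      proof (cases "w x = 0")
        case False
        then have wx: "w x = 1" using w_01[of x] by auto
        show ?thesis
        proof (rule LIMSEQ_I)
          fix e' :: real assume e': "e' > 0"
          define e2 where "e2 = e' / (2 * (\<bar>g x\<bar> + 1))"
          have e2: "e2 > 0" "\<bar>g x\<bar> * e2 < e'"
            using e' by (auto simp: e2_def field_simps intro!: add_nonneg_pos)
          have "isCont \<phi> x" using \<phi> by (simp add: continuous_on_eq_continuous_at)
          then obtain d where d: "d > 0" "\<And>y. dist y x < d \<Longrightarrow> dist (\<phi> y) (\<phi> x) < e2"
            using e2 unfolding continuous_at_eps_delta by blast
          from r d(1) obtain n0 where n0: "\<And>n. n \<ge> n0 \<Longrightarrow> \<bar>r n\<bar> < d"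
            using LIMSEQ_D[OF r d(1)] by auto
          have "norm ((1 - near (r n) x) * (g x * D n x) - 0) < e'" if n: "n \<ge> n0" for n
          proof (cases "near (r n) x = 0")
            case True
            have "K.conv n u x = K.conv n \<phi> x"
              unfolding u_def using K.conv_window_interior[of x n \<phi>] wx True by simp
            moreover have "\<bar>K.conv n \<phi> x - c n * \<phi> x\<bar> \<le> c n * e2"
            proof (rule K.conv_continuous_approx[of \<phi> B x n e2, unfolded c])
              fix y assume "norm (x - y) \<le> r n"
              then have "dist y x < d" using n0[OF n] by (simp add: dist_norm norm_minus_commute)
              then show "\<bar>\<phi> y - \<phi> x\<bar> \<le> e2" using d(2)[of y] by (simp add: dist_real_def)
            qed (auto intro: B)
            ultimately have "\<bar>D n x\<bar> \<le> e2"
              using c(1)[of n] by (simp add: D_def field_simps)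
            then have "\<bar>g x\<bar> * \<bar>D n x\<bar> \<le> \<bar>g x\<bar> * e2" by (intro mult_left_mono) auto
            then show ?thesis using e2 True by (simp add: abs_mult)
          next
            case False
            then show ?thesis using near_01[of "r n" x] e' by auto
          qed
          then show "\<exists>n0. \<forall>n\<ge>n0. norm ((1 - near (r n) x) * (g x * D n x) - 0) < e'" by blast
        qed
      qed (simp add: g_outside)
    qed
    show "AE x in lborel. norm ((1 - near (r n) x) * (g x * D n x)) \<le> 2 * B * \<bar>g x\<bar>" for n
    proof (intro AE_I2)
      fix x
      show "norm ((1 - near (r n) x) * (g x * D n x)) \<le> 2 * B * \<bar>g x\<bar>"
        using near_01[of "r n" x] gD_bound[of x n] B0 by auto
    qed
  qed (auto simp: abs_g_integrable)
  have conv: "(\<lambda>n. form (k n) g u / c n - (\<integral>x. g x * u x \<partial>lborel)) \<longlonglongrightarrow> 0"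
  proof -
    have "(\<integral>x. near (r n) x * (g x * D n x) \<partial>lborel) + (\<integral>x. (1 - near (r n) x) * (g x * D n x) \<partial>lborel)
        = form (k n) g u / c n - (\<integral>x. g x * u x \<partial>lborel)" for n
    proof -
      have i: "integrable lborel (\<lambda>x. near (r n) x * (g x * D n x))"
        by (intro near_times_integrable gD_int)
      have "(\<integral>x. near (r n) x * (g x * D n x) \<partial>lborel) + (\<integral>x. (1 - near (r n) x) * (g x * D n x) \<partial>lborel)
          = (\<integral>x. g x * D n x \<partial>lborel)"
        unfolding left_diff_distrib using i gD_int by simp
      moreover have "(\<integral>x. g x * K.conv n u x \<partial>lborel) / c n = (\<integral>x. g x * D n x + g x * u x \<partial>lborel)"
      proof -
        have "g x * K.conv n u x / c n = g x * D n x + g x * u x" for x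
          using w_01[of x] g_outside[of x] by (auto simp: D_def u_def algebra_simps)
        then show ?thesis by (subst integral_divide_zero[symmetric]) simp
      qed
      moreover have "(\<integral>x. g x * D n x + g x * u x \<partial>lborel) = (\<integral>x. g x * D n x \<partial>lborel) + (\<integral>x. g x * u x \<partial>lborel)"
        using gD_int gu_int by simp
      moreover have "form (k n) g u = (\<integral>x. g x * K.conv n u x \<partial>lborel)"
        unfolding K.conv_def by (rule K.form_eq[OF g_square_integrable u])
      ultimately show ?thesis by simp
    qed
    then show ?thesis using tendsto_add[OF near_part far_part] by simp
  qed
  then obtain n0 where n0: "\<And>n. n \<ge> n0 \<Longrightarrow> \<bar>form (k n) g u / c n - (\<integral>x. g x * u x \<partial>lborel)\<bar> < e / 4"
    using LIMSEQ_D[OF conv, of "e / 4"] e by auto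
  have "norm (form (k n) g g / c n - G2) < e" if "n \<ge> n0" for n
  proof -
    have "form (k n) g g = form (k n) g u + form (k n) g \<psi>"
      using K.form_add_right[OF u \<psi> g_square_integrable, of n 1] by (simp add: \<psi>_def)
    moreover have "\<bar>form (k n) g \<psi> / c n\<bar> \<le> e / 4"
    proof -
      have "\<bar>form (k n) g \<psi>\<bar> \<le> c n * (\<delta> * G2 + (\<integral>x. (\<psi> x)\<^sup>2 \<partial>lborel) / \<delta>)"
        using K.form_le[OF g_square_integrable \<psi> \<delta>(1), of n] by (simp add: c G2_def)
      also have "\<dots> \<le> c n * (e / 4)" using small c(1)[of n] by (intro mult_left_mono) auto
      finally show ?thesis using c(1)[of n] by (simp add: field_simps)
    qed
    moreover from calculation(1) have "form (k n) g g / c n = form (k n) g u / c n + form (k n) g \<psi> / c n"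
      by (simp add: add_divide_distrib)
    ultimately show ?thesis
      using n0[OF that] limit_gap e unfolding real_norm_def by linarith
  qed
  then show "\<exists>n0. \<forall>n\<ge>n0. norm (form (k n) g g / (\<integral>z. k n z \<partial>lborel) - G2) < e"
    unfolding c_def by blast
qed

context window
begin

text \<open>
  \<open>K\<close> bounds the second and third moments of every density \<open>w + a * g\<close> with \<open>0 \<le> a \<le> 1\<close>, and \<open>D\<close> is the
  constant in the bound on the variance of the first-order projections; neither depends on the
  kernel, its radius or the amplitude \<open>a\<close>.
\<close>
definition K :: real where "K = 4 + 4 * G2 + 4 * G3"

definition D :: real where "D = 4 * C + 2 * K + 4 * G3"

lemma K_ge: "K \<ge> 1"
  using G_nonneg by (simp add: K_def)

lemma D_nonneg: "D \<ge> 0"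
  using C_nonneg K_ge G_nonneg by (simp add: D_def)

end

locale perturbed_window = window w g near C
  for w g :: "'a::euclidean_space \<Rightarrow> real" and near C +
  fixes a :: real
  assumes a_nonneg: "a \<ge> 0" and a_le_1: "a \<le> 1"
    and density_nonneg: "\<And>x. w x + a * g x \<ge> 0"
begin

definition f :: "'a \<Rightarrow> real" where "f x = w x + a * g x"

definition law :: "'a measure" where "law = density lborel (\<lambda>x. ennreal (f x))"

lemma f_measurable [measurable]: "f \<in> borel_measurable borel"
  unfolding f_def by measurable

lemma f_nonneg: "f x \<ge> 0"
  using density_nonneg by (simp add: f_def)

lemma f_outside: "w x = 0 \<Longrightarrow> f x = 0"
  by (simp add: f_def g_outside)

lemma f_integrable: "integrable lborel f" and f_integral: "(\<integral>x. f x \<partial>lborel) = 1"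
  unfolding f_def using w_integrable g_integrable by (auto simp: w_integral g_mean)

lemma space_law [simp]: "space law = UNIV" and sets_law [measurable_cong, simp]: "sets law = sets borel"
  by (auto simp: law_def)

lemma prob_space_law: "prob_space law"
proof
  have "emeasure law (space law) = (\<integral>\<^sup>+x. ennreal (f x) \<partial>lborel)"
    by (simp add: law_def emeasure_density)
  also have "\<dots> = ennreal 1"
    using nn_integral_eq_integral[OF f_integrable] f_nonneg by (simp add: f_integral)
  finally show "emeasure law (space law) = 1" by simp
qed

lemma f_square_integrable: "square_integrable f"
  unfolding f_def by (intro square_integrable_add square_integrable_scale w_square_integrable g_square_integrable)

lemma a_sq_le: "a\<^sup>2 \<le> 1" and a_cube_le: "a^3 \<le> 1"
  using a_nonneg a_le_1 by (auto simp: power_le_one)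

lemma f_sq_le: "(f x)\<^sup>2 \<le> 2 * w x + 2 * (g x)\<^sup>2"
proof -
  have "(f x)\<^sup>2 \<le> 2 * (w x)\<^sup>2 + 2 * (a\<^sup>2 * (g x)\<^sup>2)"
    using sum_squares_bound[of "w x" "a * g x"] by (simp add: f_def power2_eq_square algebra_simps)
  also have "\<dots> \<le> 2 * w x + 2 * (g x)\<^sup>2"
    using a_sq_le by (auto simp: w_power intro!: mult_left_le_one_le)
  finally show ?thesis .
qed

lemma f_cube_le: "(f x)^3 \<le> 4 * w x + 4 * \<bar>g x\<bar>^3"
proof -
  have convex: "(s + t)^3 \<le> 4 * s^3 + 4 * t^3" if "s \<ge> 0" "t \<ge> 0" for s t :: real
  proof -
    have "4 * s^3 + 4 * t^3 - (s + t)^3 = 3 * ((s + t) * (s - t)\<^sup>2)"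
      by (simp add: power2_eq_square power3_eq_cube algebra_simps)
    then show ?thesis using that by (smt (verit) mult_nonneg_nonneg zero_le_power2)
  qed
  have "f x \<le> w x + a * \<bar>g x\<bar>" unfolding f_def using a_nonneg by (simp add: mult_left_mono)
  then have "(f x)^3 \<le> (w x + a * \<bar>g x\<bar>)^3" using f_nonneg by (rule power_mono)
  also have "\<dots> \<le> 4 * (w x)^3 + 4 * (a * \<bar>g x\<bar>)^3"
    using a_nonneg by (intro convex w_nonneg) auto
  also have "\<dots> \<le> 4 * w x + 4 * \<bar>g x\<bar>^3"
    using a_cube_le a_nonneg by (auto simp: w_power power_mult_distrib intro!: mult_left_le_one_le)
  finally show ?thesis .
qed

lemma f_cube_integrable: "integrable lborel (\<lambda>x. (f x)^3)"
  and f_cube: "(\<integral>x. (f x)^3 \<partial>lborel) \<le> K" and f_sq: "(\<integral>x. (f x)\<^sup>2 \<partial>lborel) \<le> K"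
proof -
  have i: "integrable lborel (\<lambda>x. 4 * w x + 4 * \<bar>g x\<bar>^3)" using w_integrable g_cube by simp
  show i3: "integrable lborel (\<lambda>x. (f x)^3)"
    by (rule Bochner_Integration.integrable_bound[OF i])
      (use f_cube_le f_nonneg w_nonneg in \<open>auto intro!: AE_I2 simp: power_abs[symmetric]\<close>)
  have "(\<integral>x. (f x)^3 \<partial>lborel) \<le> (\<integral>x. 4 * w x + 4 * \<bar>g x\<bar>^3 \<partial>lborel)"
    by (intro integral_mono i i3 f_cube_le)
  also have "\<dots> = 4 + 4 * G3" using w_integrable g_cube by (simp add: w_integral G3_def)
  finally show "(\<integral>x. (f x)^3 \<partial>lborel) \<le> K" using G_nonneg by (simp add: K_def)
  have "(\<integral>x. (f x)\<^sup>2 \<partial>lborel) \<le> (\<integral>x. 2 * w x + 2 * (g x)\<^sup>2 \<partial>lborel)"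
    using f_square_integrable w_integrable g_square_integrable
    by (intro integral_mono f_sq_le) (auto simp: square_integrable_def)
  also have "\<dots> = 2 + 2 * G2"
    using w_integrable g_square_integrable by (simp add: w_integral G2_def square_integrable_def)
  finally show "(\<integral>x. (f x)\<^sup>2 \<partial>lborel) \<le> K" using G_nonneg by (simp add: K_def)
qed

lemma integral_law: "\<phi> \<in> borel_measurable borel \<Longrightarrow> (\<integral>x. \<phi> x \<partial>law) = (\<integral>x. f x * \<phi> x \<partial>lborel)" for \<phi> :: "'a \<Rightarrow> real"
  unfolding law_def by (subst integral_density) (auto simp: f_nonneg)

lemma integrable_law: "\<phi> \<in> borel_measurable borel \<Longrightarrow> integrable law \<phi> \<longleftrightarrow> integrable lborel (\<lambda>x. f x * \<phi> x)" for \<phi> :: "'a \<Rightarrow> real"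
  unfolding law_def by (subst integrable_density) (auto simp: f_nonneg)

lemma nn_integral_law: "\<phi> \<in> borel_measurable borel \<Longrightarrow> (\<integral>\<^sup>+x. \<phi> x \<partial>law) = (\<integral>\<^sup>+x. ennreal (f x) * \<phi> x \<partial>lborel)"
  unfolding law_def by (subst nn_integral_density) auto

end

locale bounded_window_kernel = perturbed_window w g near C a + window_mollifier w g near C k r
  for w g :: "'a::euclidean_space \<Rightarrow> real" and near C a and k :: "'a \<Rightarrow> real" and r +
  fixes B :: real
  assumes k_le: "\<And>z. k z \<le> B"
begin

definition energy :: real where "energy = (\<integral>z. (k z)\<^sup>2 \<partial>lborel)"

interpretation law: prob_space law by (rule prob_space_law)

sublocale U: bounded_kernel law "\<lambda>x y. k (x - y)" B
proof unfold_locales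
  show "(\<lambda>(x, y). k (x - y)) \<in> borel_measurable (law \<Otimes>\<^sub>M law)" by measurable
qed (auto simp: k_commute k_nonneg k_le)

lemma k_sq_mollifier: "window_mollifier w g near C (\<lambda>z. (k z)\<^sup>2) r"
proof unfold_locales
  have le: "(k z)\<^sup>2 \<le> B * k z" for z
    by (simp add: power2_eq_square mult_right_mono k_le k_nonneg)
  show "integrable lborel (\<lambda>z. (k z)\<^sup>2)"
    by (rule Bochner_Integration.integrable_bound[where f = "\<lambda>z. B * k z"])
      (use k_integrable le in \<open>auto intro!: AE_I2 order_trans[OF _ abs_ge_self]\<close>)
qed (auto simp: k_even k_support r_pos)

sublocale sq: window_mollifier w g near C "\<lambda>z. (k z)\<^sup>2" r
  rewrites "mollifier.mass (\<lambda>z. (k z)\<^sup>2) = energy"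
proof -
  show "window_mollifier w g near C (\<lambda>z. (k z)\<^sup>2) r" by (rule k_sq_mollifier)
  then interpret S: window_mollifier w g near C "\<lambda>z. (k z)\<^sup>2" r .
  show "S.mass = energy" by (simp add: S.mass_def energy_def)
qed

lemma proj_eq: "U.proj = conv f"
  by (simp add: U.proj_def conv_def integral_law mult.commute fun_eq_iff)

lemma sq_eq: "U.sq = sq.conv f"
  by (simp add: U.sq_def sq.conv_def integral_law mult.commute fun_eq_iff)

lemma k_f_integrable: "integrable lborel (\<lambda>y. k (x - y) * f y)"
  by (rule Bochner_Integration.integrable_bound[where f = "\<lambda>y. B * f y"])
    (use f_integrable k_le f_nonneg k_nonneg in \<open>auto intro!: AE_I2 mult_right_mono simp: abs_mult order_trans[OF _ abs_ge_self]\<close>)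

lemma mean_eq: "U.mean = form k f f"
  unfolding U.mean_def proj_eq
  by (simp add: integral_law form_eq[OF f_square_integrable f_square_integrable] conv_def)

lemma a2_eq: "U.a2 = form (\<lambda>z. (k z)\<^sup>2) f f"
  unfolding U.a2_def sq_eq
  by (simp add: integral_law sq.form_eq[OF f_square_integrable f_square_integrable] sq.conv_def)

lemma a2_le: "U.a2 \<le> 2 * K * energy"
proof -
  have "U.a2 \<le> energy * (2 * (\<integral>x. (f x)\<^sup>2 \<partial>lborel))"
    using sq.form_le[OF f_square_integrable f_square_integrable zero_less_one] by (simp add: a2_eq)
  also have "\<dots> \<le> energy * (2 * K)" using f_sq by (intro mult_left_mono sq.mass_nonneg) auto
  finally show ?thesis by (simp add: mult_ac)
qed

lemma a2_approx: "\<bar>U.a2 - energy\<bar> \<le> energy * (3 * C * r + 2 * G2 * a)"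
proof -
  define F where "F u v = form (\<lambda>z. (k z)\<^sup>2) u v" for u v
  have "U.a2 - energy = (F w w - energy) + 2 * a * F g w + a\<^sup>2 * F g g"
    unfolding a2_eq F_def using sq.form_perturbed[of a] by (simp add: f_def[abs_def])
  also have "\<bar>\<dots>\<bar> \<le> \<bar>F w w - energy\<bar> + \<bar>2 * a * F g w\<bar> + \<bar>a\<^sup>2 * F g g\<bar>" by linarith
  also have "\<dots> \<le> energy * (C * r) + 2 * (energy * (C * r)) + a * (energy * (2 * G2))"
  proof (intro add_mono)
    show "\<bar>F w w - energy\<bar> \<le> energy * (C * r)" unfolding F_def by (rule sq.form_w_w)
    have "\<bar>2 * a * F g w\<bar> = (2 * a) * \<bar>F g w\<bar>" using a_nonneg by (simp add: abs_mult)
    also have "\<dots> \<le> 2 * (energy * (C * r))"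
      using a_nonneg a_le_1 sq.form_g_w by (intro mult_mono) (auto simp: F_def)
    finally show "\<bar>2 * a * F g w\<bar> \<le> 2 * (energy * (C * r))" .
    have "\<bar>a\<^sup>2 * F g g\<bar> = a\<^sup>2 * \<bar>F g g\<bar>" by (simp add: abs_mult)
    also have "\<dots> \<le> a * (energy * (2 * G2))"
    proof (intro mult_mono)
      show "a\<^sup>2 \<le> a" using a_nonneg a_le_1 by (simp add: power2_eq_square mult_left_le_one_le)
    qed (use a_nonneg sq.form_g_g in \<open>auto simp: F_def\<close>)
    finally show "\<bar>a\<^sup>2 * F g g\<bar> \<le> a * (energy * (2 * G2))" .
  qed
  finally show ?thesis by (simp add: algebra_simps)
qed

text \<open>Real-valued form of the estimate \<open>nn_cherry\<close>, with the centre of the graph distributed by \<open>law\<close>.\<close>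
lemma cherry_bound:
  assumes l: "window_mollifier w g near C l r" and u [measurable]: "u \<in> borel_measurable borel"
    and u_nonneg: "\<And>x. u x \<ge> 0" and u3: "integrable lborel (\<lambda>x. (u x)^3)"
    and int: "\<And>x. integrable lborel (\<lambda>y. l (x - y) * u y)"
    and bm: "(\<lambda>x. \<integral>y. l (x - y) * u y \<partial>lborel) \<in> bounded_measurable law"
  shows "(\<integral>x. (\<integral>y. l (x - y) * u y \<partial>lborel)\<^sup>2 \<partial>law) \<le> (\<integral>z. l z \<partial>lborel)\<^sup>2 * (K + 2 * (\<integral>x. (u x)^3 \<partial>lborel))"
proof -
  interpret L: window_mollifier w g near C l r by (rule l)
  note [measurable] = L.k_measurable
  define c where "c x = (\<integral>y. l (x - y) * u y \<partial>lborel)" for x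
  have c_bm: "c \<in> bounded_measurable law" using bm by (simp add: c_def[abs_def])
  have [measurable]: "c \<in> borel_measurable borel" using bm_measurable[OF c_bm] by simp
  have c_nonneg: "c x \<ge> 0" for x
    unfolding c_def by (intro integral_nonneg_AE AE_I2 mult_nonneg_nonneg L.k_nonneg u_nonneg)
  have c_nn: "ennreal (c x) = (\<integral>\<^sup>+y. ennreal (l (x - y)) * ennreal (u y) \<partial>lborel)" for x
    unfolding c_def
    by (subst nn_integral_eq_integral[OF int, symmetric])
      (auto intro!: mult_nonneg_nonneg simp: L.k_nonneg u_nonneg ennreal_mult)
  have f3: "(\<integral>\<^sup>+x. ennreal (f x)^3 \<partial>lborel) \<le> ennreal K"
    using nn_integral_eq_integral[OF f_cube_integrable] f_nonneg f_cube by (simp add: ennreal_power ennreal_leI)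
  have u3': "(\<integral>\<^sup>+x. ennreal (u x)^3 \<partial>lborel) = ennreal (\<integral>x. (u x)^3 \<partial>lborel)"
    using nn_integral_eq_integral[OF u3] u_nonneg by (simp add: ennreal_power)
  have U: "(\<integral>x. (u x)^3 \<partial>lborel) \<ge> 0" using u_nonneg by (intro integral_nonneg_AE) auto
  have "ennreal (\<integral>x. (c x)\<^sup>2 \<partial>law) = (\<integral>\<^sup>+x. ennreal ((c x)\<^sup>2) \<partial>law)"
    by (rule nn_integral_eq_integral[symmetric]) (auto intro!: law.bm_integrable bm_intros c_bm)
  also have "\<dots> = (\<integral>\<^sup>+x. ennreal (f x) * (ennreal (c x) * ennreal (c x)) \<partial>lborel)"
    by (subst nn_integral_law) (auto simp: ennreal_mult[symmetric] c_nonneg power2_eq_square)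
  also have "\<dots> \<le> (\<integral>\<^sup>+z. ennreal (l z) \<partial>lborel) * (\<integral>\<^sup>+z. ennreal (l z) \<partial>lborel)
      * ((\<integral>\<^sup>+x. ennreal (f x)^3 \<partial>lborel) + (\<integral>\<^sup>+x. ennreal (u x)^3 \<partial>lborel) + (\<integral>\<^sup>+x. ennreal (u x)^3 \<partial>lborel))"
    unfolding c_nn by (rule nn_cherry) auto
  also have "\<dots> \<le> ennreal L.mass * ennreal L.mass * (ennreal K + ennreal (\<integral>x. (u x)^3 \<partial>lborel) + ennreal (\<integral>x. (u x)^3 \<partial>lborel))"
    unfolding L.nn_mass u3' using f3 by (intro mult_left_mono add_mono) auto
  also have "\<dots> = ennreal (L.mass\<^sup>2 * (K + 2 * (\<integral>x. (u x)^3 \<partial>lborel)))"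
    using L.mass_nonneg K_ge U
    by (simp add: ennreal_mult[symmetric] ennreal_plus[symmetric] power2_eq_square del: ennreal_plus)
  finally show ?thesis
    using K_ge U by (subst (asm) ennreal_le_iff) (auto simp: c_def[symmetric] L.mass_def)
qed

lemma v1_bound: "U.v1 \<le> 3 * K * mass\<^sup>2"
proof -
  have "U.v1 \<le> mass\<^sup>2 * (K + 2 * (\<integral>x. (f x)^3 \<partial>lborel))"
    unfolding U.v1_def proj_eq conv_def mass_def
    by (rule cherry_bound)
      (use U.proj_bm proj_eq k_f_integrable in \<open>auto simp: f_nonneg f_cube_integrable conv_def[abs_def]
        intro: window_mollifier_axioms\<close>)
  also have "\<dots> \<le> mass\<^sup>2 * (3 * K)" using f_cube by (intro mult_left_mono) auto
  finally show ?thesis by (simp add: mult_ac)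
qed

lemma sq_sq_bound: "(\<integral>x. (U.sq x)\<^sup>2 \<partial>law) \<le> 3 * K * energy\<^sup>2"
proof -
  have int: "integrable lborel (\<lambda>y. (k (x - y))\<^sup>2 * f y)" for x
  proof (rule Bochner_Integration.integrable_bound[where f = "\<lambda>y. B\<^sup>2 * f y"])
    show "AE y in lborel. norm ((k (x - y))\<^sup>2 * f y) \<le> norm (B\<^sup>2 * f y)"
      by (intro AE_I2) (simp add: abs_mult f_nonneg mult_right_mono power_mono k_le k_nonneg)
  qed (auto simp: f_integrable)
  have "(\<integral>x. (U.sq x)\<^sup>2 \<partial>law) \<le> energy\<^sup>2 * (K + 2 * (\<integral>x. (f x)^3 \<partial>lborel))"
    unfolding sq_eq sq.conv_def energy_def
    by (rule cherry_bound[OF k_sq_mollifier])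
      (use U.sq_bm sq_eq int in \<open>auto simp: f_nonneg f_cube_integrable sq.conv_def[abs_def]\<close>)
  also have "\<dots> \<le> energy\<^sup>2 * (3 * K)" using f_cube by (intro mult_left_mono) auto
  finally show ?thesis by (simp add: mult_ac)
qed

text \<open>A weighted arithmetic-geometric mean inequality; \<open>sqrt energy\<close> is the optimal weight.\<close>
lemma proj_sup:
  assumes "energy > 0"
  shows "U.proj x \<le> 2 * K * sqrt energy"
proof -
  define s where "s = sqrt energy"
  have s: "s > 0" "s * s = energy" using assms by (auto simp: s_def)
  have i: "integrable lborel (\<lambda>y. (k (x - y))\<^sup>2 / s + s * (f y)\<^sup>2)"
    using sq.k_translate_integrable[of x] f_square_integrable by (simp add: square_integrable_def integrable_divide)
  have "U.proj x \<le> (\<integral>y. (k (x - y))\<^sup>2 / s + s * (f y)\<^sup>2 \<partial>lborel)"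
    unfolding proj_eq conv_def
  proof (intro integral_mono k_f_integrable i)
    fix y
    show "k (x - y) * f y \<le> (k (x - y))\<^sup>2 / s + s * (f y)\<^sup>2"
      using weighted_AM_GM[OF s(1), of "f y" "k (x - y)"] by (simp add: mult.commute add.commute)
  qed
  also have "\<dots> = energy / s + s * (\<integral>y. (f y)\<^sup>2 \<partial>lborel)"
    using sq.k_translate_integrable[of x] f_square_integrable
    by (simp add: square_integrable_def sq.k_translate_mass integrable_divide)
  also have "energy / s = s" using s by (simp add: field_simps)
  also have "s + s * (\<integral>y. (f y)\<^sup>2 \<partial>lborel) \<le> s * (2 * K)"
    using mult_left_mono[OF f_sq, of s] mult_left_mono[OF K_ge, of s] less_imp_le[OF s(1)] by simp
  finally show ?thesis by (simp add: s_def mult_ac)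
qed

text \<open>
  The projection is constant up to the boundary layer, of probability of order \<open>r\<close>, and the
  perturbation, of order \<open>a\<close>.  Hence the linear part of the pair sum is negligible although
  each of its terms carries the sample size as a factor.
\<close>
lemma proj_deviation: "(\<integral>x. (U.proj x - mass)\<^sup>2 \<partial>law) \<le> D * mass\<^sup>2 * (r + a\<^sup>2)"
proof -
  define c where "c x = conv (\<lambda>y. \<bar>g y\<bar>) x" for x
  have int_g: "integrable lborel (\<lambda>y. k (x - y) * \<bar>g y\<bar>)" for x
    by (rule Bochner_Integration.integrable_bound[where f = "\<lambda>y. B * \<bar>g y\<bar>"])
      (use abs_g_integrable k_le k_nonneg in \<open>auto intro!: AE_I2 mult_right_mono simp: abs_mult order_trans[OF _ abs_ge_self]\<close>)
  have int_g': "integrable lborel (\<lambda>y. k (x - y) * g y)" for x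
    using int_g[of x] by (rule Bochner_Integration.integrable_bound) (auto simp: abs_mult)
  have int_w: "integrable lborel (\<lambda>y. k (x - y) * w y)" for x
    by (rule k_bounded_integrable[where B = 1]) (use w_nonneg w_le_1 in auto)
  have [measurable]: "c \<in> borel_measurable borel" unfolding c_def[abs_def] by measurable
  have c_bm: "c \<in> bounded_measurable law"
  proof (rule bmI)
    show "c \<in> borel_measurable law" by measurable
    fix x
    have "\<bar>c x\<bar> \<le> (\<integral>y. \<bar>k (x - y) * \<bar>g y\<bar>\<bar> \<partial>lborel)" unfolding c_def conv_def by (rule integral_abs_bound)
    also have "\<dots> \<le> (\<integral>y. B * \<bar>g y\<bar> \<partial>lborel)"
      using int_g abs_g_integrable by (intro integral_mono) (auto simp: abs_mult k_nonneg intro!: mult_right_mono k_le)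
    finally show "\<bar>c x\<bar> \<le> (\<integral>y. B * \<bar>g y\<bar> \<partial>lborel)" .
  qed
  have near_bm: "near r \<in> bounded_measurable law"
    by (rule bmI[of _ _ 1]) (use near_nonneg near_le_1 in auto)
  have proj_split: "U.proj x = conv w x + a * conv g x" for x
    unfolding proj_eq conv_def f_def using int_w[of x] int_g'[of x]
    by (simp add: distrib_left mult.left_commute)
  have conv_g: "\<bar>conv g x\<bar> \<le> c x" for x
    unfolding c_def conv_def
    using integral_abs_bound[of lborel "\<lambda>y. k (x - y) * g y"] by (simp add: abs_mult k_nonneg)
  have pointwise: "f x * (U.proj x - mass)\<^sup>2 \<le> f x * (2 * mass\<^sup>2 * near r x + 2 * a\<^sup>2 * (c x)\<^sup>2)" for x
  proof (cases "w x = 0")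
    case False
    then have "\<bar>conv w x - mass\<bar> \<le> mass * near r x" using conv_w_approx w_01[of x] by auto
    then have 1: "(conv w x - mass)\<^sup>2 \<le> mass\<^sup>2 * near r x"
      using power_mono[OF _ abs_ge_zero, of "conv w x - mass" "mass * near r x" 2] near_01[of r x]
      by (auto simp: power_mult_distrib)
    have 2: "(conv g x)\<^sup>2 \<le> (c x)\<^sup>2"
      using power_mono[OF conv_g abs_ge_zero, of x 2] by simp
    have "(U.proj x - mass)\<^sup>2 \<le> 2 * (conv w x - mass)\<^sup>2 + 2 * (a\<^sup>2 * (conv g x)\<^sup>2)"
      using sum_squares_bound[of "conv w x - mass" "a * conv g x"]
      by (simp add: proj_split power2_eq_square algebra_simps)
    also have "\<dots> \<le> 2 * mass\<^sup>2 * near r x + 2 * a\<^sup>2 * (c x)\<^sup>2"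
      using 1 mult_left_mono[OF 2, of "a\<^sup>2"] by simp
    finally show ?thesis by (intro mult_left_mono f_nonneg)
  qed (simp add: f_outside)
  have bm: "(\<lambda>x. 2 * mass\<^sup>2 * near r x + 2 * a\<^sup>2 * (c x)\<^sup>2) \<in> bounded_measurable law"
    by (intro bm_intros near_bm c_bm)
  have [measurable]: "U.proj \<in> borel_measurable borel" using bm_measurable[OF U.proj_bm] by simp
  have "(\<integral>x. (U.proj x - mass)\<^sup>2 \<partial>law) \<le> (\<integral>x. 2 * mass\<^sup>2 * near r x + 2 * a\<^sup>2 * (c x)\<^sup>2 \<partial>law)"
  proof -
    have "integrable law (\<lambda>x. (U.proj x - mass)\<^sup>2)"
      by (intro law.bm_integrable bm_intros U.proj_bm)
    then have i1: "integrable lborel (\<lambda>x. f x * (U.proj x - mass)\<^sup>2)"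
      by (subst (asm) integrable_law) auto
    have i2: "integrable lborel (\<lambda>x. f x * (2 * mass\<^sup>2 * near r x + 2 * a\<^sup>2 * (c x)\<^sup>2))"
      using law.bm_integrable[OF bm] by (subst (asm) integrable_law) auto
    show ?thesis by (subst (1 2) integral_law) (auto intro!: integral_mono i1 i2 pointwise)
  qed
  also have "\<dots> = 2 * mass\<^sup>2 * (\<integral>x. near r x \<partial>law) + 2 * a\<^sup>2 * (\<integral>x. (c x)\<^sup>2 \<partial>law)"
    using law.bm_integrable[OF near_bm] law.bm_integrable[OF bm_power[OF c_bm]] by simp
  also have "\<dots> \<le> 2 * mass\<^sup>2 * (2 * (C * r)) + 2 * a\<^sup>2 * (mass\<^sup>2 * (K + 2 * G3))"
  proof (intro add_mono mult_left_mono)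
    have "(\<integral>x. near r x \<partial>law) = (\<integral>x. near r x * w x + a * (near r x * g x) \<partial>lborel)"
      by (subst integral_law) (auto simp: f_def algebra_simps)
    also have "\<dots> \<le> (\<integral>x. near r x * w x + near r x * \<bar>g x\<bar> \<partial>lborel)"
    proof (intro integral_mono Bochner_Integration.integrable_add integrable_mult_right near_times_integrable
        w_integrable g_integrable abs_g_integrable)
      fix x
      have "a * g x \<le> \<bar>g x\<bar>" using a_nonneg a_le_1
        by (metis abs_ge_self abs_ge_zero abs_mult abs_of_nonneg mult_left_le_one_le order_trans)
      then show "near r x * w x + a * (near r x * g x) \<le> near r x * w x + near r x * \<bar>g x\<bar>"
        using near_01[of r x] by auto
    qed
    also have "\<dots> = (\<integral>x. near r x * w x \<partial>lborel) + (\<integral>x. near r x * \<bar>g x\<bar> \<partial>lborel)"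
      by (simp add: near_times_integrable w_integrable abs_g_integrable)
    also have "\<dots> \<le> 2 * (C * r)" using near_w[OF r_pos] near_g[OF r_pos] by simp
    finally show "(\<integral>x. near r x \<partial>law) \<le> 2 * (C * r)" .
    show "(\<integral>x. (c x)\<^sup>2 \<partial>law) \<le> mass\<^sup>2 * (K + 2 * G3)"
      using cherry_bound[OF window_mollifier_axioms _ _ g_cube int_g] c_bm
      by (simp add: c_def[abs_def] conv_def[abs_def] mass_def G3_def)
  qed auto
  also have "\<dots> \<le> D * mass\<^sup>2 * (r + a\<^sup>2)"
  proof -
    have "D * mass\<^sup>2 * (r + a\<^sup>2) - (2 * mass\<^sup>2 * (2 * (C * r)) + 2 * a\<^sup>2 * (mass\<^sup>2 * (K + 2 * G3)))
        = mass\<^sup>2 * ((2 * K + 4 * G3) * r + 4 * C * a\<^sup>2)"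
      by (simp add: D_def algebra_simps)
    also have "\<dots> \<ge> 0" using K_ge G_nonneg C_nonneg r_pos by (intro mult_nonneg_nonneg add_nonneg_nonneg) auto
    finally show ?thesis by simp
  qed
  finally show ?thesis .
qed

end

section \<open>Variance bound for unbounded kernels\<close>

text \<open>
  For a negative exponent the power kernel is unbounded, but it is square integrable.  It is
  approximated from below by the bounded kernels \<open>trunc j\<close>, whose bounds are uniform in \<open>j\<close>.
\<close>
locale square_window_kernel = perturbed_window w g near C a + window_mollifier w g near C k r
  for w g :: "'a::euclidean_space \<Rightarrow> real" and near C a and k :: "'a \<Rightarrow> real" and r +
  assumes k_sq_integrable: "integrable lborel (\<lambda>z. (k z)\<^sup>2)"
begin

definition k_energy :: real where "k_energy = (\<integral>z. (k z)\<^sup>2 \<partial>lborel)"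

definition trunc :: "nat \<Rightarrow> 'a \<Rightarrow> real" where "trunc j z = min (k z) (real j)"

lemma trunc_nonneg: "trunc j z \<ge> 0" and trunc_le: "trunc j z \<le> k z" and trunc_le': "trunc j z \<le> real j"
  using k_nonneg[of z] by (auto simp: trunc_def)

lemma trunc_tendsto: "(\<lambda>j. trunc j z) \<longlonglongrightarrow> k z"
proof (rule tendsto_eventually)
  obtain n where "k z \<le> real n" using real_arch_simple by blast
  then show "\<forall>\<^sub>F j in sequentially. trunc j z = k z"
    by (intro eventually_sequentiallyI[of n]) (auto simp: trunc_def min_def)
qed

lemma trunc_kernel: "bounded_window_kernel w g near C a (trunc j) r (real j)"
proof unfold_locales
  show m: "trunc j \<in> borel_measurable borel" unfolding trunc_def by measurable
  show "integrable lborel (trunc j)"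
    by (rule Bochner_Integration.integrable_bound[OF k_integrable])
      (use trunc_nonneg trunc_le m in \<open>auto intro!: AE_I2 order_trans[OF _ abs_ge_self]\<close>)
qed (use trunc_nonneg trunc_le' k_support in \<open>auto simp: trunc_def k_even r_pos\<close>)

text \<open>Fatou's lemma passes the bound for the truncated kernels to the limit.\<close>
lemma pair_sum_variance_le:
  assumes I: "finite I"
  shows "(\<integral>\<^sup>+x. ennreal ((pair_sum (\<lambda>x y. k (x - y)) I x - card I * (real (card I) - 1) / 2 * form k f f)\<^sup>2) \<partial>Pi\<^sub>M I (\<lambda>_. law))
    \<le> ennreal ((real (card I))\<^sup>2 * (2 * K * k_energy) + 2 * (real (card I))^3 * (D * mass\<^sup>2 * (r + a\<^sup>2)))"
    (is "_ \<le> ennreal ?R")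
proof -
  interpret law: prob_space law by (rule prob_space_law)
  interpret T: bounded_window_kernel w g near C a "trunc j" r "real j" for j by (rule trunc_kernel)
  interpret S: prob_space "Pi\<^sub>M I (\<lambda>_. law)" by (rule law.prob_space_sample)
  define c where "c = card I * (real (card I) - 1) / 2"
  define X where "X j x = pair_sum (\<lambda>x y. trunc j (x - y)) I x - c * form (trunc j) f f" for j and x :: "'b \<Rightarrow> 'a"
  define Y where "Y x = pair_sum (\<lambda>x y. k (x - y)) I x - c * form k f f" for x :: "'b \<Rightarrow> 'a"
  have X_bm: "X j \<in> bounded_measurable (Pi\<^sub>M I (\<lambda>_. law))" for j
    unfolding X_def by (intro bm_intros law.bm_pair_sum T.U.h_bm)
  have mass_le: "T.mass j \<le> mass" for j
    unfolding T.mass_def mass_def by (intro integral_mono T.k_integrable k_integrable trunc_le)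
  have energy_le: "T.energy j \<le> k_energy" for j
    unfolding T.energy_def k_energy_def
    by (intro integral_mono k_sq_integrable T.sq.k_integrable power_mono trunc_le trunc_nonneg)
  have "(\<lambda>j. form (trunc j) f f) \<longlonglongrightarrow> form k f f"
    unfolding form_def
  proof (rule integral_dominated_convergence[where w = "\<lambda>p. k (fst p - snd p) * (f (fst p) * f (snd p))"])
    show "integrable (lborel \<Otimes>\<^sub>M lborel) (\<lambda>p. k (fst p - snd p) * (f (fst p) * f (snd p)))"
      by (rule form_integrable'[OF f_square_integrable f_square_integrable])
    show "AE p in lborel \<Otimes>\<^sub>M lborel. (\<lambda>j. trunc j (fst p - snd p) * (f (fst p) * f (snd p)))
        \<longlonglongrightarrow> k (fst p - snd p) * (f (fst p) * f (snd p))"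
      by (intro AE_I2 tendsto_intros trunc_tendsto)
    show "AE p in lborel \<Otimes>\<^sub>M lborel. norm (trunc j (fst p - snd p) * (f (fst p) * f (snd p)))
        \<le> k (fst p - snd p) * (f (fst p) * f (snd p))" for j
      by (intro AE_I2) (simp add: abs_mult trunc_nonneg f_nonneg mult_right_mono trunc_le)
  qed measurable
  then have lim: "(\<lambda>j. X j x) \<longlonglongrightarrow> Y x" for x
    unfolding X_def Y_def pair_sum_def by (intro tendsto_intros trunc_tendsto)
  have bound: "(\<integral>\<^sup>+x. ennreal ((X j x)\<^sup>2) \<partial>Pi\<^sub>M I (\<lambda>_. law)) \<le> ennreal ?R" for j
  proof -
    have "(\<integral>\<^sup>+x. ennreal ((X j x)\<^sup>2) \<partial>Pi\<^sub>M I (\<lambda>_. law)) = ennreal (\<integral>x. (X j x)\<^sup>2 \<partial>Pi\<^sub>M I (\<lambda>_. law))"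
      by (rule nn_integral_eq_integral) (auto intro!: S.bm_integrable bm_intros X_bm)
    also have "(\<integral>x. (X j x)\<^sup>2 \<partial>Pi\<^sub>M I (\<lambda>_. law))
        \<le> (real (card I))\<^sup>2 * T.U.a2 j + 2 * (real (card I))^3 * (\<integral>x. (T.U.proj j x - T.mass j)\<^sup>2 \<partial>law)"
      using T.U.pair_sum_variance[OF I, of j "T.mass j"] by (simp add: X_def c_def T.mean_eq)
    also have "\<dots> \<le> (real (card I))\<^sup>2 * (2 * K * T.energy j) + 2 * (real (card I))^3 * (D * (T.mass j)\<^sup>2 * (r + a\<^sup>2))"
      by (intro add_mono mult_left_mono T.a2_le T.proj_deviation) auto
    also have "\<dots> \<le> ?R"
      using K_ge D_nonneg r_pos
      by (intro add_mono mult_left_mono mult_right_mono power_mono energy_le mass_le T.mass_nonneg) auto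
    finally show ?thesis by (simp add: ennreal_leI)
  qed
  have "(\<integral>\<^sup>+x. ennreal ((Y x)\<^sup>2) \<partial>Pi\<^sub>M I (\<lambda>_. law)) = (\<integral>\<^sup>+x. liminf (\<lambda>j. ennreal ((X j x)\<^sup>2)) \<partial>Pi\<^sub>M I (\<lambda>_. law))"
  proof (intro nn_integral_cong)
    fix x
    have "(\<lambda>j. ennreal ((X j x)\<^sup>2)) \<longlonglongrightarrow> ennreal ((Y x)\<^sup>2)"
      by (intro tendsto_ennrealI tendsto_power lim)
    then show "ennreal ((Y x)\<^sup>2) = liminf (\<lambda>j. ennreal ((X j x)\<^sup>2))"
      using lim_imp_Liminf[OF sequentially_bot] by metis
  qed
  also have "\<dots> \<le> liminf (\<lambda>j. \<integral>\<^sup>+x. ennreal ((X j x)\<^sup>2) \<partial>Pi\<^sub>M I (\<lambda>_. law))"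
    by (rule nn_integral_liminf) (use bm_measurable[OF X_bm] in measurable)
  also have "\<dots> \<le> ennreal ?R"
    by (rule order_trans[OF Liminf_le_Limsup[OF sequentially_bot]])
      (intro Limsup_bounded always_eventually allI bound)
  finally show ?thesis by (simp add: Y_def c_def)
qed

end

section \<open>Radial power integrals\<close>

text \<open>Polar coordinates for radial functions: both sides have the same distribution function.\<close>
lemma measure_norm_ball:
  fixes \<rho> :: real
  assumes \<rho>: "\<rho> > 0"
  shows "distr (density lborel (indicator (cball 0 \<rho> :: 'a::euclidean_space set))) borel norm
    = density lborel (\<lambda>s. ennreal (DIM('a) * unit_ball_vol DIM('a) * s^(DIM('a) - 1)) * indicator {0..\<rho>} s)"
    (is "?M = ?N")
proof (rule cdf_unique')
  have cball_ind [measurable]: "(indicator (cball 0 \<rho>) :: 'a \<Rightarrow> ennreal) \<in> borel_measurable borel"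
    by (intro borel_measurable_indicator) auto
  define d where "d = DIM('a)"
  have d: "d \<ge> 1" by (simp add: d_def)
  define v where "v = unit_ball_vol (real d)"
  have v: "v \<ge> 0" by (simp add: v_def)
  have M: "emeasure ?M {..x} = ennreal (v * (max 0 (min x \<rho>))^d)" for x
  proof -
    have "emeasure ?M {..x} = (\<integral>\<^sup>+z. indicator (cball 0 \<rho>) z * indicator {z::'a. norm z \<le> x} z \<partial>lborel)"
    proof -
      have "{z::'a. norm z \<le> x} \<in> sets borel" by measurable
      then show ?thesis
        by (subst emeasure_distr) (auto simp: emeasure_density vimage_def)
    qed
    also have "\<dots> = (\<integral>\<^sup>+z. indicator {z::'a. norm z \<le> min x \<rho>} z \<partial>lborel)"
      by (intro nn_integral_cong) (auto simp: indicator_def)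
    also have "\<dots> = emeasure lborel {z::'a. norm z \<le> min x \<rho>}" by (subst nn_integral_indicator) auto
    also have "\<dots> = ennreal (v * (max 0 (min x \<rho>))^d)"
    proof (cases "x \<ge> 0")
      case True
      have "{z::'a. norm z \<le> min x \<rho>} = cball 0 (min x \<rho>)" by auto
      then show ?thesis using True \<rho> by (simp add: emeasure_cball v_def d_def max_def)
    next
      case False
      have "\<not> norm z \<le> min x \<rho>" for z :: 'a using False norm_ge_zero[of z] by linarith
      then have "{z::'a. norm z \<le> min x \<rho>} = {}" by blast
      then have "emeasure lborel {z::'a. norm z \<le> min x \<rho>} = 0" by (simp only: emeasure_empty)
      moreover have "max 0 (min x \<rho>) = 0" using False by simp
      ultimately show ?thesis using d by (simp only:) (simp add: power_0_left)
    qed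
    finally show ?thesis .
  qed
  have N: "emeasure ?N {..x} = ennreal (v * (max 0 (min x \<rho>))^d)" for x
  proof -
    define y where "y = max 0 (min x \<rho>)"
    have "emeasure ?N {..x} = (\<integral>\<^sup>+s. ennreal (d * v * s^(d - 1)) * indicator {0..\<rho>} s * indicator {..x} s \<partial>lborel)"
      by (subst emeasure_density) (auto simp: d_def v_def)
    also have "\<dots> = (\<integral>\<^sup>+s. ennreal (d * v * s^(d - 1)) * indicator {0..y} s \<partial>lborel)"
    proof (cases "x \<ge> 0")
      case True
      then show ?thesis using \<rho> by (intro nn_integral_cong) (auto simp: indicator_def y_def)
    next
      case False
      then have "(\<integral>\<^sup>+s. ennreal (d * v * s^(d - 1)) * indicator {0..\<rho>} s * indicator {..x} s \<partial>lborel) = (\<integral>\<^sup>+s. 0 \<partial>(lborel::real measure))"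
        by (intro nn_integral_cong) (auto simp: indicator_def)
      moreover have "AE s in lborel. ennreal (d * v * s^(d - 1)) * indicator {0..y} s = 0"
      proof -
        have y: "y = 0" using False by (simp add: y_def)
        show ?thesis using AE_lborel_singleton[of "0::real"] by eventually_elim (auto simp: indicator_def y)
      qed
      ultimately show ?thesis by (simp add: nn_integral_0_iff_AE cong: nn_integral_cong_AE)
    qed
    also have "\<dots> = ennreal (v * y^d - v * 0^d)"
    proof (rule nn_integral_FTC_Icc[where F = "\<lambda>s. v * s^d" and f = "\<lambda>s. d * v * s^(d - 1)" and a = 0 and b = y])
      show "((\<lambda>s. v * s^d) has_real_derivative d * v * s^(d - 1)) (at s)" for s
        by (auto intro!: derivative_eq_intros)
    qed (use v in \<open>auto simp: y_def\<close>)
    finally show ?thesis using d by (simp add: y_def power_0_left)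
  qed
  have fin: "finite_borel_measure ?M" "finite_borel_measure ?N"
  proof -
    have Msp: "emeasure ?M UNIV \<noteq> \<infinity>"
    proof -
      have "emeasure ?M UNIV = emeasure lborel (cball 0 \<rho> :: 'a set)"
        by (subst emeasure_distr) (auto simp: emeasure_density)
      then show ?thesis by (simp add: emeasure_cball \<rho> less_imp_le)
    qed
    have Nsp: "emeasure ?N UNIV \<noteq> \<infinity>"
    proof -
      have eq: "emeasure ?N UNIV = emeasure ?N {..\<rho>}"
        by (subst (1 2) emeasure_density) (auto simp: indicator_def intro!: nn_integral_cong)
      show ?thesis unfolding eq N by simp
    qed
    show "finite_borel_measure ?M" using Msp by (auto simp: finite_borel_measure_def finite_borel_measure_axioms_def intro!: finite_measureI)
    show "finite_borel_measure ?N" using Nsp by (auto simp: finite_borel_measure_def finite_borel_measure_axioms_def intro!: finite_measureI)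
  qed
  then show "finite_borel_measure ?M" "finite_borel_measure ?N" .
  show "cdf ?M = cdf ?N"
    unfolding cdf_def2 measure_def M N ..
qed

lemma nn_integral_norm_powr_cball:
  fixes \<rho> p :: real
  assumes \<rho>: "\<rho> > 0" and p: "p > - real DIM('a)"
  shows "(\<integral>\<^sup>+z. ennreal (of_bool (norm z \<le> \<rho>) * norm z powr p) \<partial>(lborel :: 'a::euclidean_space measure))
    = ennreal (DIM('a) * unit_ball_vol DIM('a) / (p + DIM('a)) * \<rho> powr (p + DIM('a)))"
proof -
  have cball_ind [measurable]: "(indicator (cball 0 \<rho>) :: 'a \<Rightarrow> ennreal) \<in> borel_measurable borel"
    by (intro borel_measurable_indicator) auto
  define d where "d = DIM('a)"
  have d: "d \<ge> 1" by (simp add: d_def)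
  define v where "v = unit_ball_vol (real d)"
  have v: "v \<ge> 0" by (simp add: v_def)
  have "(\<integral>\<^sup>+z. ennreal (of_bool (norm z \<le> \<rho>) * norm z powr p) \<partial>(lborel :: 'a measure))
      = (\<integral>\<^sup>+z. ennreal (norm z powr p) \<partial>density lborel (indicator (cball (0::'a) \<rho>)))"
    by (subst nn_integral_density) (auto intro!: nn_integral_cong simp: indicator_def)
  also have "\<dots> = (\<integral>\<^sup>+s. ennreal (s powr p) \<partial>distr (density lborel (indicator (cball (0::'a) \<rho>))) borel norm)"
    by (subst nn_integral_distr) auto
  also have "\<dots> = (\<integral>\<^sup>+s. ennreal (d * v * s^(d - 1)) * indicator {0..\<rho>} s * ennreal (s powr p) \<partial>lborel)"
    unfolding measure_norm_ball[OF \<rho>] by (subst nn_integral_density) (auto simp: d_def v_def)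
  also have "\<dots> = (\<integral>\<^sup>+s. ennreal (d * v) * (ennreal (s powr (p + d - 1)) * indicator {0..\<rho>} s) \<partial>lborel)"
  proof (intro nn_integral_cong)
    fix s :: real
    show "ennreal (d * v * s^(d - 1)) * indicator {0..\<rho>} s * ennreal (s powr p)
        = ennreal (d * v) * (ennreal (s powr (p + d - 1)) * indicator {0..\<rho>} s)"
    proof (cases "s > 0")
      case True
      then have "s^(d - 1) * s powr p = s powr (p + d - 1)"
        using d by (simp add: powr_realpow[symmetric] powr_add[symmetric] of_nat_diff algebra_simps)
      then show ?thesis using v True
        by (auto simp: indicator_def ennreal_mult[symmetric] mult.assoc)
    qed (auto simp: indicator_def)
  qed
  also have "\<dots> = ennreal (d * v) * (\<integral>\<^sup>+s. ennreal (s powr (p + d - 1)) * indicator {0..\<rho>} s \<partial>lborel)"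
    by (rule nn_integral_cmult) auto
  also have "(\<integral>\<^sup>+s. ennreal (s powr (p + d - 1)) * indicator {0..\<rho>} s \<partial>lborel) = ennreal (\<rho> powr (p + d - 1 + 1) / (p + d - 1 + 1))"
    by (rule nn_integral_has_integral_lebesgue'[OF _ has_integral_powr_from_0]) (use \<rho> p in \<open>auto simp: d_def\<close>)
  also have "ennreal (d * v) * \<dots> = ennreal (d * v / (p + d) * \<rho> powr (p + d))"
    using v p by (subst ennreal_mult[symmetric]) (auto simp: d_def)
  finally show ?thesis by (simp add: d_def v_def)
qed

section \<open>Standardised pair sums of bounded kernels\<close>

context bounded_window_kernel
begin

text \<open>
  The normal approximation of \<open>char_pair_sum\<close> with its error in terms of the kernel.  \<open>Q\<close> and \<open>c\<close> are the
  energy and the mass of the kernel that sets the scale, of which \<open>k\<close> is a part.  The ratio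
  \<open>c\<^sup>2 / Q\<close> is of the order of the volume of the ball that carries the kernel, so it tends to zero,
  and \<open>B\<^sup>2 / (n\<^sup>2 * Q)\<close> is of the order of the inverse of the expected number of edges.
\<close>
lemma residual_char_bound:
  fixes n :: nat and c Q \<delta> t :: real
  assumes energy: "0 < energy" "energy \<le> Q" and mass: "mass \<le> c" and n: "n > 0" and \<delta>: "\<delta> > 0"
    and I: "finite I" "card I = n"
  defines "\<sigma> \<equiv> n * sqrt (Q / 2)"
  shows "cmod ((\<integral>x. iexp (t * (pair_sum U.residual I x / \<sigma>)) \<partial>Pi\<^sub>M I (\<lambda>_. law))
      - complex_of_real (exp (- (t\<^sup>2 * ((real n - 1) / n * (U.R.m2 / Q)) / 2))))
    \<le> t\<^sup>2 * (sqrt (48 * K / n) + sqrt 2 * sqrt (24 * K\<^sup>2 * (B / sqrt Q * (c\<^sup>2 / Q)) + 96 * K\<^sup>2 * (c\<^sup>2 / Q) + 144 * K\<^sup>2 * (c\<^sup>2 / Q)\<^sup>2))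
      + \<bar>t\<bar>^3 / 12 * (4 * K * \<delta> + 4 / \<delta> * (8 * K * (B\<^sup>2 / (real n^2 * Q)) + 144 * K / n)) + 24 * t^4 * K / n"
proof -
  interpret law: prob_space law by (rule prob_space_law)
  have Q: "Q > 0" using energy by simp
  define s where "s = sqrt Q"
  have s: "s > 0" "s\<^sup>2 = Q" using Q by (auto simp: s_def)
  define N where "N = real n"
  have N: "N \<ge> 1" using n by (simp add: N_def)
  have \<sigma>: "\<sigma> > 0" "\<sigma>\<^sup>2 = N\<^sup>2 * Q / 2"
    using N Q by (auto simp: \<sigma>_def N_def power_mult_distrib)
  have B: "B \<ge> 0" using k_nonneg k_le order_trans by blast
  have K: "K \<ge> 1" by (rule K_ge)
  have mass2: "mass\<^sup>2 \<le> c\<^sup>2" using mass mass_nonneg by (rule power_mono)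
  have energy2: "energy\<^sup>2 \<le> Q\<^sup>2" using energy by (intro power_mono) auto
  have v1: "U.v1 \<le> 3 * K * c\<^sup>2"
    using v1_bound mult_left_mono[OF mass2, of "3 * K"] K by linarith
  have a2: "U.a2 \<le> 2 * K * Q"
    using a2_le mult_left_mono[OF energy(2), of "2 * K"] K by linarith
  have m2: "U.R.m2 \<le> 2 * K * Q" using U.m2_le a2 by linarith
  have m4: "U.R.m4 \<le> 8 * K * B\<^sup>2 * Q"
  proof -
    have "4 * B\<^sup>2 * U.a2 \<le> 4 * B\<^sup>2 * (2 * K * Q)" using a2 by (intro mult_left_mono) auto
    then show ?thesis using U.m4_le by (simp add: mult_ac)
  qed
  have q2: "U.R.q2 \<le> 48 * K * Q\<^sup>2"
    using U.q2_le sq_sq_bound mult_left_mono[OF energy2, of "48 * K"] K by linarith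
  have g2: "U.R.g2 \<le> 24 * K\<^sup>2 * (B * s * c\<^sup>2) + 96 * K\<^sup>2 * (Q * c\<^sup>2) + 144 * K\<^sup>2 * (c\<^sup>2)\<^sup>2"
  proof -
    have sup: "U.proj x \<le> 2 * K * s" for x
    proof -
      have "U.proj x \<le> 2 * K * sqrt energy" by (rule proj_sup[OF energy(1)])
      also have "\<dots> \<le> 2 * K * s" unfolding s_def using K energy by (intro mult_left_mono) auto
      finally show ?thesis .
    qed
    have "U.R.g2 \<le> 4 * (B * (2 * K * s) * U.v1 + 4 * U.a2 * U.v1 + 4 * U.v1\<^sup>2)"
      by (rule U.g2_le) (rule sup)
    also have "\<dots> \<le> 4 * (B * (2 * K * s) * (3 * K * c\<^sup>2) + 4 * (2 * K * Q) * (3 * K * c\<^sup>2) + 4 * (3 * K * c\<^sup>2)\<^sup>2)"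
      using B K s Q U.v1_nonneg U.a2_nonneg v1 a2
      by (intro mult_left_mono add_mono mult_mono power_mono) auto
    also have "\<dots> = 24 * K\<^sup>2 * (B * s * c\<^sup>2) + 96 * K\<^sup>2 * (Q * c\<^sup>2) + 144 * K\<^sup>2 * (c\<^sup>2)\<^sup>2"
      by (simp add: power2_eq_square algebra_simps)
    finally show ?thesis .
  qed
  define S where "S = 24 * K\<^sup>2 * (B / s * (c\<^sup>2 / Q)) + 96 * K\<^sup>2 * (c\<^sup>2 / Q) + 144 * K\<^sup>2 * (c\<^sup>2 / Q)\<^sup>2"
  have S: "U.R.g2 \<le> Q\<^sup>2 * S"
  proof -
    have "Q\<^sup>2 * S = 24 * K\<^sup>2 * (B * s * c\<^sup>2) + 96 * K\<^sup>2 * (Q * c\<^sup>2) + 144 * K\<^sup>2 * (c\<^sup>2)\<^sup>2"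
      unfolding S_def s(2)[symmetric] using s(1) by (simp add: field_simps power2_eq_square)
    then show ?thesis using g2 by simp
  qed
  have T1: "N * ((t / \<sigma>)\<^sup>2 / 2 * (sqrt (N * U.R.q2) + sqrt 2 * N * sqrt U.R.g2))
      \<le> t\<^sup>2 * (sqrt (48 * K / N) + sqrt 2 * sqrt S)"
  proof -
    have "sqrt (N * U.R.q2) \<le> sqrt (N * (48 * K * Q\<^sup>2))"
      using q2 N by (intro real_sqrt_le_mono mult_left_mono) auto
    also have "N * (48 * K * Q\<^sup>2) = (N * Q)\<^sup>2 * (48 * K / N)"
      using N by (simp add: power2_eq_square)
    also have "sqrt \<dots> = N * Q * sqrt (48 * K / N)" unfolding real_sqrt_mult[of "(N * Q)\<^sup>2"] using N Q by simp
    finally have 1: "sqrt (N * U.R.q2) \<le> N * Q * sqrt (48 * K / N)" .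
    have "sqrt U.R.g2 \<le> sqrt (Q\<^sup>2 * S)" using S by simp
    also have "\<dots> = Q * sqrt S" using Q by (simp add: real_sqrt_mult)
    finally have 2: "sqrt U.R.g2 \<le> Q * sqrt S" .
    have "N * ((t / \<sigma>)\<^sup>2 / 2 * (sqrt (N * U.R.q2) + sqrt 2 * N * sqrt U.R.g2))
        \<le> N * ((t / \<sigma>)\<^sup>2 / 2 * (N * Q * sqrt (48 * K / N) + sqrt 2 * N * (Q * sqrt S)))"
      using 1 2 N by (intro mult_left_mono add_mono) auto
    also have "\<dots> = t\<^sup>2 * (sqrt (48 * K / N) + sqrt 2 * sqrt S)"
      unfolding power_divide \<sigma>(2) using N Q by (simp add: field_simps power2_eq_square)
    finally show ?thesis .
  qed
  have T2: "N * (\<bar>t / \<sigma>\<bar>^3 / 6 * (((\<delta> * \<sigma>) * (N * U.R.m2) + (N * U.R.m4 + 3 * N\<^sup>2 * U.R.q2) / (\<delta> * \<sigma>)) / 2))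
      \<le> \<bar>t\<bar>^3 / 12 * (4 * K * \<delta> + 4 / \<delta> * (8 * K * (B\<^sup>2 / (N\<^sup>2 * Q)) + 144 * K / N))"
  proof -
    have s4: "\<sigma>^4 = (N\<^sup>2 * Q / 2)\<^sup>2"
    proof -
      have "\<sigma>^4 = (\<sigma>\<^sup>2)\<^sup>2" by simp
      then show ?thesis by (simp only: \<sigma>(2))
    qed
    have "N * (\<bar>t / \<sigma>\<bar>^3 / 6 * (((\<delta> * \<sigma>) * (N * U.R.m2) + (N * U.R.m4 + 3 * N\<^sup>2 * U.R.q2) / (\<delta> * \<sigma>)) / 2))
      \<le> N * (\<bar>t / \<sigma>\<bar>^3 / 6 * (((\<delta> * \<sigma>) * (N * (2 * K * Q)) + (N * (8 * K * B\<^sup>2 * Q) + 3 * N\<^sup>2 * (48 * K * Q\<^sup>2)) / (\<delta> * \<sigma>)) / 2))"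
      using N \<delta> \<sigma> m2 m4 q2 by (intro mult_left_mono divide_right_mono add_mono) auto
    also have "\<dots> = \<bar>t\<bar>^3 / 12 * (\<delta> * (N\<^sup>2 * (2 * K * Q)) / \<sigma>\<^sup>2 + (N\<^sup>2 * (8 * K * B\<^sup>2 * Q) + 3 * N^3 * (48 * K * Q\<^sup>2)) / (\<delta> * \<sigma>^4))"
      using \<sigma>(1) \<delta> N by (simp add: field_simps abs_divide power_divide eval_nat_numeral)
    also have "\<dots> = \<bar>t\<bar>^3 / 12 * (4 * K * \<delta> + 4 / \<delta> * (8 * K * (B\<^sup>2 / (N\<^sup>2 * Q)) + 144 * K / N))"
    proof -
      have "\<delta> * (N\<^sup>2 * (2 * K * Q)) / \<sigma>\<^sup>2 = 4 * K * \<delta>"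
        unfolding \<sigma>(2) using N Q by (simp add: field_simps)
      moreover have "(N\<^sup>2 * (8 * K * B\<^sup>2 * Q) + 3 * N^3 * (48 * K * Q\<^sup>2)) / (\<delta> * \<sigma>^4)
          = 4 / \<delta> * (8 * K * (B\<^sup>2 / (N\<^sup>2 * Q)) + 144 * K / N)"
        unfolding s4 using N Q \<delta> by (simp add: field_simps eval_nat_numeral)
      ultimately show ?thesis by simp
    qed
    finally show ?thesis .
  qed
  have T3: "N * ((t / \<sigma>)^4 / 8 * (N\<^sup>2 * U.R.q2)) \<le> 24 * t^4 * K / N"
  proof -
    have t4: "(t / \<sigma>)^4 = t^4 / (\<sigma>\<^sup>2)\<^sup>2" by (simp add: power_divide)
    have "N * (t^4 / (\<sigma>\<^sup>2)\<^sup>2 / 8 * (N\<^sup>2 * U.R.q2)) \<le> N * (t^4 / (\<sigma>\<^sup>2)\<^sup>2 / 8 * (N\<^sup>2 * (48 * K * Q\<^sup>2)))"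
      using N q2 by (intro mult_left_mono) auto
    also have "N * (t^4 / (\<sigma>\<^sup>2)\<^sup>2 / 8 * (N\<^sup>2 * (48 * K * Q\<^sup>2))) = 24 * t^4 * K / N"
      unfolding \<sigma>(2) using N Q by (simp add: field_simps power2_eq_square eval_nat_numeral)
    finally show ?thesis unfolding t4 .
  qed
  have "cmod ((\<integral>x. iexp (t / \<sigma> * pair_sum U.residual I x) \<partial>Pi\<^sub>M I (\<lambda>_. law))
      - complex_of_real (exp (- ((t / \<sigma>)\<^sup>2 * (card I * (real (card I) - 1) / 2 * U.R.m2) / 2))))
    \<le> card I * U.R.char_error (t / \<sigma>) (\<delta> * \<sigma>) N"
    by (rule U.R.char_pair_sum) (use I \<delta> \<sigma> in \<open>auto simp: N_def\<close>)
  also have "card I * U.R.char_error (t / \<sigma>) (\<delta> * \<sigma>) N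
      = N * ((t / \<sigma>)\<^sup>2 / 2 * (sqrt (N * U.R.q2) + sqrt 2 * N * sqrt U.R.g2))
      + N * (\<bar>t / \<sigma>\<bar>^3 / 6 * (((\<delta> * \<sigma>) * (N * U.R.m2) + (N * U.R.m4 + 3 * N\<^sup>2 * U.R.q2) / (\<delta> * \<sigma>)) / 2))
      + N * ((t / \<sigma>)^4 / 8 * (N\<^sup>2 * U.R.q2))"
    unfolding U.R.char_error_def I(2) N_def[symmetric] by (simp only: distrib_left)
  also have "\<dots> \<le> t\<^sup>2 * (sqrt (48 * K / N) + sqrt 2 * sqrt S)
      + \<bar>t\<bar>^3 / 12 * (4 * K * \<delta> + 4 / \<delta> * (8 * K * (B\<^sup>2 / (N\<^sup>2 * Q)) + 144 * K / N)) + 24 * t^4 * K / N"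
    by (intro add_mono T1 T2 T3)
  also have "(t / \<sigma>)\<^sup>2 * (card I * (real (card I) - 1) / 2 * U.R.m2) / 2 = t\<^sup>2 * ((real n - 1) / n * (U.R.m2 / Q)) / 2"
    unfolding power_divide \<sigma>(2) I(2) N_def[symmetric] using N Q by (simp add: field_simps power2_eq_square)
  also have "(\<lambda>x. iexp (t / \<sigma> * pair_sum U.residual I x)) = (\<lambda>x. iexp (t * (pair_sum U.residual I x / \<sigma>)))"
    by simp
  finally show ?thesis unfolding N_def S_def s_def .
qed

lemma standardized_residual_distance:
  fixes n :: nat and c Q :: real
  assumes Q: "0 < Q" and mass: "mass \<le> c" and n: "n > 0" and I: "finite I" "card I = n"
  defines "\<sigma> \<equiv> n * sqrt (Q / 2)"
  shows "(\<integral>x. \<bar>(pair_sum (\<lambda>x y. k (x - y)) I x - real n * (real n - 1) / 2 * form k f f) / \<sigma> - pair_sum U.residual I x / \<sigma>\<bar> \<partial>Pi\<^sub>M I (\<lambda>_. law))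
    \<le> sqrt (2 * D * (c\<^sup>2 / Q * (n * (r + a\<^sup>2))))"
proof -
  have \<sigma>: "\<sigma> > 0" "\<sigma>\<^sup>2 = (real n)\<^sup>2 * Q / 2"
    using n Q by (auto simp: \<sigma>_def power_mult_distrib)
  define X where "X x = (pair_sum (\<lambda>x y. k (x - y)) I x - card I * (real (card I) - 1) / 2 * U.mean) - pair_sum U.residual I x" for x
  have "(\<integral>x. \<bar>(pair_sum (\<lambda>x y. k (x - y)) I x - real n * (real n - 1) / 2 * form k f f) / \<sigma> - pair_sum U.residual I x / \<sigma>\<bar> \<partial>Pi\<^sub>M I (\<lambda>_. law))
      = (\<integral>x. \<bar>X x\<bar> / \<sigma> \<partial>Pi\<^sub>M I (\<lambda>_. law))"
    using \<sigma>(1) by (simp add: X_def I(2) mean_eq diff_divide_distrib[symmetric] abs_divide)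
  also have "\<dots> = (\<integral>x. \<bar>X x\<bar> \<partial>Pi\<^sub>M I (\<lambda>_. law)) / \<sigma>" by simp
  also have "\<dots> \<le> sqrt ((real n)^3 * (\<integral>x. (U.proj x - mass)\<^sup>2 \<partial>law)) / \<sigma>"
    using U.pair_sum_residual_distance[OF I(1), of mass] \<sigma>(1) by (intro divide_right_mono) (auto simp: X_def I(2))
  also have "\<dots> = sqrt ((real n)^3 * (\<integral>x. (U.proj x - mass)\<^sup>2 \<partial>law) / \<sigma>\<^sup>2)"
    using \<sigma>(1) by (simp add: real_sqrt_divide)
  also have "\<dots> \<le> sqrt (2 * D * (c\<^sup>2 / Q * (n * (r + a\<^sup>2))))"
  proof (rule real_sqrt_le_mono)
    have "(\<integral>x. (U.proj x - mass)\<^sup>2 \<partial>law) \<le> D * c\<^sup>2 * (r + a\<^sup>2)"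
      by (rule order_trans[OF proj_deviation])
        (use D_nonneg r_pos mass mass_nonneg in \<open>auto intro!: mult_left_mono mult_right_mono power_mono\<close>)
    then have "(real n)^3 * (\<integral>x. (U.proj x - mass)\<^sup>2 \<partial>law) / \<sigma>\<^sup>2 \<le> (real n)^3 * (D * c\<^sup>2 * (r + a\<^sup>2)) / \<sigma>\<^sup>2"
      by (intro divide_right_mono mult_left_mono) auto
    also have "\<dots> = 2 * D * (c\<^sup>2 / Q * (n * (r + a\<^sup>2)))"
      unfolding \<sigma>(2) using n Q by (simp add: field_simps power2_eq_square power3_eq_cube)
    finally show "(real n)^3 * (\<integral>x. (U.proj x - mass)\<^sup>2 \<partial>law) / \<sigma>\<^sup>2 \<le> 2 * D * (c\<^sup>2 / Q * (n * (r + a\<^sup>2)))" .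
  qed
  finally show ?thesis .
qed

end

section \<open>Asymptotic normality of the centred edge length\<close>

definition power_kernel :: "real \<Rightarrow> real \<Rightarrow> 'a::euclidean_space \<Rightarrow> real" where
  "power_kernel \<beta> \<rho> z = of_bool (norm z \<le> \<rho>) * norm z powr \<beta>"

lemma power_kernel_measurable [measurable]: "power_kernel \<beta> \<rho> \<in> borel_measurable borel"
  unfolding power_kernel_def by measurable

lemma power_kernel_nonneg: "power_kernel \<beta> \<rho> z \<ge> 0"
  by (simp add: power_kernel_def)

lemma power_kernel_sq: "(power_kernel \<beta> \<rho> z)\<^sup>2 = power_kernel (2 * \<beta>) \<rho> z"
  by (simp add: power_kernel_def power2_eq_square powr_add[symmetric])

lemma power_kernel_integral:
  fixes \<rho> p :: real
  assumes "\<rho> > 0" "p > - real DIM('a::euclidean_space)"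
  shows "integrable lborel (power_kernel p \<rho> :: 'a \<Rightarrow> real)"
    and "(\<integral>z. power_kernel p \<rho> z \<partial>(lborel :: 'a measure))
      = DIM('a) * unit_ball_vol DIM('a) / (p + DIM('a)) * \<rho> powr (p + DIM('a))"
proof -
  have nn: "(\<integral>\<^sup>+z. ennreal (power_kernel p \<rho> z) \<partial>(lborel :: 'a measure))
      = ennreal (DIM('a) * unit_ball_vol DIM('a) / (p + DIM('a)) * \<rho> powr (p + DIM('a)))"
    unfolding power_kernel_def by (rule nn_integral_norm_powr_cball[OF assms])
  show "integrable lborel (power_kernel p \<rho> :: 'a \<Rightarrow> real)"
    by (rule integrableI_nonneg) (auto simp: power_kernel_nonneg nn)
  show "(\<integral>z. power_kernel p \<rho> z \<partial>(lborel :: 'a measure))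
      = DIM('a) * unit_ball_vol DIM('a) / (p + DIM('a)) * \<rho> powr (p + DIM('a))"
    by (rule integral_eq_nn_integral[THEN trans]) (use assms in \<open>auto simp: power_kernel_nonneg nn\<close>)
qed

text \<open>The square integral is a Lebesgue integral in \<open>ennreal\<close>, which is what Fatou's lemma delivers.\<close>
lemma (in prob_space) L1_le_of_second_moment:
  fixes X :: "'a \<Rightarrow> real"
  assumes X [measurable]: "X \<in> borel_measurable M" and le: "(\<integral>\<^sup>+x. ennreal ((X x)\<^sup>2) \<partial>M) \<le> ennreal v" and v: "v \<ge> 0"
  shows "integrable M X" "(\<integral>x. \<bar>X x\<bar> \<partial>M) \<le> sqrt v"
proof -
  have i2: "integrable M (\<lambda>x. (X x)\<^sup>2)"
    by (rule integrableI_nonneg) (use le in \<open>auto simp: top_unique less_top[symmetric]\<close>)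
  show i1: "integrable M X"
  proof (rule Bochner_Integration.integrable_bound)
    show "integrable M (\<lambda>x. 1 + (X x)\<^sup>2)" using i2 by simp
    have "norm (X x) \<le> norm (1 + (X x)\<^sup>2)" for x
    proof -
      have "0 \<le> (1 - \<bar>X x\<bar>)\<^sup>2" by simp
      then have "2 * \<bar>X x\<bar> \<le> 1 + (X x)\<^sup>2" by (simp add: power2_eq_square algebra_simps)
      then show ?thesis by simp
    qed
    then show "AE x in M. norm (X x) \<le> norm (1 + (X x)\<^sup>2)" by simp
  qed measurable
  define m where "m = (\<integral>x. \<bar>X x\<bar> \<partial>M)"
  have "0 \<le> (\<integral>x. (\<bar>X x\<bar> - m)\<^sup>2 \<partial>M)" by simp
  also have "\<dots> = (\<integral>x. (X x)\<^sup>2 - 2 * m * \<bar>X x\<bar> + m\<^sup>2 \<partial>M)"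
    by (intro Bochner_Integration.integral_cong) (auto simp: power2_eq_square algebra_simps)
  also have "\<dots> = (\<integral>x. (X x)\<^sup>2 \<partial>M) - 2 * m * m + m\<^sup>2"
    using i1 i2 by (simp add: prob_space m_def)
  finally have "m\<^sup>2 \<le> (\<integral>x. (X x)\<^sup>2 \<partial>M)" by (simp add: power2_eq_square)
  also have "\<dots> \<le> v"
    using le nn_integral_eq_integral[OF i2] v by simp
  finally show "(\<integral>x. \<bar>X x\<bar> \<partial>M) \<le> sqrt v" unfolding m_def by (rule real_le_rsqrt)
qed

lemma pred_ratio_limit: "(\<lambda>n. (real n - 1) / n) \<longlonglongrightarrow> 1"
proof (rule Lim_transform_eventually)
  show "(\<lambda>n. 1 - 1 / real n) \<longlonglongrightarrow> 1" using tendsto_diff[OF tendsto_const lim_const_over_n[of 1], of 1] by simp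
  show "\<forall>\<^sub>F n in sequentially. 1 - 1 / real n = (real n - 1) / n"
    by (rule eventually_sequentiallyI[of 1]) (simp add: field_simps)
qed

lemma iexp_lipschitz: "cmod (iexp x - iexp y) \<le> \<bar>x - y\<bar>" for x y :: real
proof -
  have "iexp x - iexp y = iexp y * (iexp (x - y) - 1)"
    by (simp add: right_diff_distrib exp_diff)
  then have "cmod (iexp x - iexp y) = cmod (iexp (x - y) - 1)"
    by (simp only: norm_mult norm_exp_i_times mult_1)
  also have "\<dots> \<le> \<bar>x - y\<bar>" using iexp_approx1[of "x - y" 0] by simp
  finally show ?thesis .
qed

lemma (in prob_space) char_lipschitz:
  fixes X Y :: "'a \<Rightarrow> real"
  assumes [measurable]: "X \<in> borel_measurable M" "Y \<in> borel_measurable M" and i: "integrable M (\<lambda>x. X x - Y x)"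
  shows "cmod ((\<integral>x. iexp (t * X x) \<partial>M) - (\<integral>x. iexp (t * Y x) \<partial>M)) \<le> \<bar>t\<bar> * (\<integral>x. \<bar>X x - Y x\<bar> \<partial>M)"
proof -
  have iX: "integrable M (\<lambda>x. iexp (t * X x))" and iY: "integrable M (\<lambda>x. iexp (t * Y x))"
    by (rule integrable_const_bound[where B = 1]; auto)+
  have "(\<integral>x. iexp (t * X x) \<partial>M) - (\<integral>x. iexp (t * Y x) \<partial>M) = (\<integral>x. iexp (t * X x) - iexp (t * Y x) \<partial>M)"
    using iX iY by simp
  also have "cmod \<dots> \<le> (\<integral>x. cmod (iexp (t * X x) - iexp (t * Y x)) \<partial>M)" by (rule integral_norm_bound)
  also have "\<dots> \<le> (\<integral>x. \<bar>t\<bar> * \<bar>X x - Y x\<bar> \<partial>M)"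
  proof (intro integral_mono integrable_norm integrable_mult_right integrable_abs i)
    show "integrable M (\<lambda>x. iexp (t * X x) - iexp (t * Y x))" using iX iY by simp
    show "cmod (iexp (t * X x) - iexp (t * Y x)) \<le> \<bar>t\<bar> * \<bar>X x - Y x\<bar>" for x
      using iexp_lipschitz[of "t * X x" "t * Y x"] by (simp add: abs_mult[symmetric] right_diff_distrib)
  qed
  finally show ?thesis by simp
qed

text \<open>
  Stated for arbitrary sequences, so that no simplification of the powers of the radius interferes
  with the limit of the error bound \<open>char_gap\<close> below.
\<close>
lemma char_gap_expression_limit:
  fixes K D \<epsilon> \<eta> t :: real and u1 u2 u3 u4 u5 u6 u7 u8 :: "nat \<Rightarrow> real"
  assumes u: "u1 \<longlonglongrightarrow> 0" "u2 \<longlonglongrightarrow> 0" "u3 \<longlonglongrightarrow> 0" "u4 \<longlonglongrightarrow> 0" "u5 \<longlonglongrightarrow> 0" "u6 \<longlonglongrightarrow> 0"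
    "u7 \<longlonglongrightarrow> 1 * (1 - \<eta>)" "u8 \<longlonglongrightarrow> 0"
  shows "(\<lambda>n. t\<^sup>2 * (sqrt (u1 n) + sqrt 2 * sqrt (24 * K\<^sup>2 * u2 n + 96 * K\<^sup>2 * u3 n + 144 * K\<^sup>2 * (u3 n)\<^sup>2))
      + \<bar>t\<bar>^3 / 12 * (4 * K * \<epsilon> + 4 / \<epsilon> * (8 * K * u4 n + u5 n)) + u6 n
      + \<bar>exp (- (t\<^sup>2 * u7 n / 2)) - exp (- (t\<^sup>2 / 2))\<bar> + \<bar>t\<bar> * (sqrt (2 * D * u8 n) + sqrt (4 * K * \<eta> + 4 * D * u8 n)))
    \<longlonglongrightarrow> \<bar>t\<bar>^3 / 12 * (4 * K * \<epsilon>) + \<bar>exp (- (t\<^sup>2 * (1 - \<eta>) / 2)) - exp (- (t\<^sup>2 / 2))\<bar> + \<bar>t\<bar> * sqrt (4 * K * \<eta>)"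
proof -
  have "(\<lambda>n. t\<^sup>2 * (sqrt (u1 n) + sqrt 2 * sqrt (24 * K\<^sup>2 * u2 n + 96 * K\<^sup>2 * u3 n + 144 * K\<^sup>2 * (u3 n)\<^sup>2))
      + \<bar>t\<bar>^3 / 12 * (4 * K * \<epsilon> + 4 / \<epsilon> * (8 * K * u4 n + u5 n)) + u6 n
      + \<bar>exp (- (t\<^sup>2 * u7 n / 2)) - exp (- (t\<^sup>2 / 2))\<bar> + \<bar>t\<bar> * (sqrt (2 * D * u8 n) + sqrt (4 * K * \<eta> + 4 * D * u8 n)))
    \<longlonglongrightarrow> t\<^sup>2 * (sqrt 0 + sqrt 2 * sqrt (24 * K\<^sup>2 * 0 + 96 * K\<^sup>2 * 0 + 144 * K\<^sup>2 * 0\<^sup>2))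
      + \<bar>t\<bar>^3 / 12 * (4 * K * \<epsilon> + 4 / \<epsilon> * (8 * K * 0 + 0)) + 0
      + \<bar>exp (- (t\<^sup>2 * (1 * (1 - \<eta>)) / 2)) - exp (- (t\<^sup>2 / 2))\<bar> + \<bar>t\<bar> * (sqrt (2 * D * 0) + sqrt (4 * K * \<eta> + 4 * D * 0))"
    by (intro tendsto_intros u) simp_all
  then show ?thesis by simp
qed

lemma char_gap_expression_vanishes:
  fixes K t :: real and \<epsilon> \<eta> :: "nat \<Rightarrow> real"
  assumes "\<epsilon> \<longlonglongrightarrow> 0" "\<eta> \<longlonglongrightarrow> 0"
  shows "(\<lambda>j. \<bar>t\<bar>^3 / 12 * (4 * K * \<epsilon> j) + \<bar>exp (- (t\<^sup>2 * (1 - \<eta> j) / 2)) - exp (- (t\<^sup>2 / 2))\<bar> + \<bar>t\<bar> * sqrt (4 * K * \<eta> j)) \<longlonglongrightarrow> 0"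
proof -
  have "(\<lambda>j. \<bar>t\<bar>^3 / 12 * (4 * K * \<epsilon> j) + \<bar>exp (- (t\<^sup>2 * (1 - \<eta> j) / 2)) - exp (- (t\<^sup>2 / 2))\<bar> + \<bar>t\<bar> * sqrt (4 * K * \<eta> j))
      \<longlonglongrightarrow> \<bar>t\<bar>^3 / 12 * (4 * K * 0) + \<bar>exp (- (t\<^sup>2 * (1 - 0) / 2)) - exp (- (t\<^sup>2 / 2))\<bar> + \<bar>t\<bar> * sqrt (4 * K * 0)"
    by (intro tendsto_intros assms) simp_all
  then show ?thesis by simp
qed

locale shrinking_window_kernels = window w g near C
  for w g :: "'a::euclidean_space \<Rightarrow> real" and near C +
  fixes r a :: "nat \<Rightarrow> real" and \<beta> d :: real
  assumes d_eq: "d = real DIM('a)"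
    and r_pos: "\<And>n. r n > 0" and r_lim: "r \<longlonglongrightarrow> 0"
    and a_pos: "\<And>n. a n > 0" and a_le_1: "\<And>n. a n \<le> 1" and a_lim: "a \<longlonglongrightarrow> 0"
    and density_nonneg: "\<And>n x. w x + a n * g x \<ge> 0"
    and beta: "\<beta> > - d / 2"
    and n2rd: "filterlim (\<lambda>n. (real n)\<^sup>2 * r n powr d) at_top sequentially"
    and nrd1: "(\<lambda>n. real n * r n powr (d + 1)) \<longlonglongrightarrow> 0"
begin

lemma d_pos: "d > 0"
  by (simp add: d_eq)

text \<open>
  For the unit ball, \<open>\<kappa>1\<close> is the integral of the power kernel and \<open>\<kappa>2\<close> that of its square; \<open>c\<close> and \<open>Q\<close>
  are the same integrals for radius \<open>r n\<close>.  The standard deviation \<open>\<sigma>\<close> is that of \<open>n\<^sup>2 / 2\<close> uncorrelated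
  edges, each of variance \<open>Q n\<close>.
\<close>
definition \<kappa>1 :: real where "\<kappa>1 = d * unit_ball_vol d / (\<beta> + d)"
definition \<kappa>2 :: real where "\<kappa>2 = d * unit_ball_vol d / (2 * \<beta> + d)"

lemma beta_pos: "\<beta> + d > 0" "2 * \<beta> + d > 0"
  using beta d_pos by auto

lemma \<kappa>_pos: "\<kappa>1 > 0" "\<kappa>2 > 0"
  using beta_pos d_pos by (auto simp: \<kappa>1_def \<kappa>2_def unit_ball_vol_pos)

definition c :: "nat \<Rightarrow> real" where "c n = \<kappa>1 * r n powr (\<beta> + d)"
definition Q :: "nat \<Rightarrow> real" where "Q n = \<kappa>2 * r n powr (2 * \<beta> + d)"
definition \<sigma> :: "nat \<Rightarrow> real" where "\<sigma> n = real n * sqrt (Q n / 2)"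

lemma c_pos: "c n > 0" and Q_pos: "Q n > 0"
  using \<kappa>_pos r_pos[of n] by (auto simp: c_def Q_def)

lemma \<sigma>_pos: "n > 0 \<Longrightarrow> \<sigma> n > 0"
  using Q_pos by (simp add: \<sigma>_def)

abbreviation kern :: "nat \<Rightarrow> 'a \<Rightarrow> real" where "kern n \<equiv> power_kernel \<beta> (r n)"

lemma kern_mass: "0 < \<rho> \<Longrightarrow> (\<integral>z. power_kernel \<beta> \<rho> z \<partial>(lborel :: 'a measure)) = \<kappa>1 * \<rho> powr (\<beta> + d)"
  using power_kernel_integral(2)[of \<rho> \<beta>, where 'a='a] beta_pos by (simp add: \<kappa>1_def d_eq[symmetric])

lemma kern_integrable: "0 < \<rho> \<Longrightarrow> integrable lborel (power_kernel \<beta> \<rho> :: 'a \<Rightarrow> real)"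
  using power_kernel_integral(1)[of \<rho> \<beta>, where 'a='a] beta_pos by (simp add: d_eq[symmetric])

lemma kern_sq_integrable: "0 < \<rho> \<Longrightarrow> integrable lborel (\<lambda>z::'a. (power_kernel \<beta> \<rho> z)\<^sup>2)"
  using power_kernel_integral(1)[of \<rho> "2 * \<beta>", where 'a='a] beta_pos
  by (simp add: power_kernel_sq[abs_def] d_eq)

lemma kern_energy: "0 < \<rho> \<Longrightarrow> (\<integral>z. (power_kernel \<beta> \<rho> z)\<^sup>2 \<partial>(lborel :: 'a measure)) = \<kappa>2 * \<rho> powr (2 * \<beta> + d)"
  using power_kernel_integral(2)[of \<rho> "2 * \<beta>", where 'a='a] beta_pos
  by (simp add: power_kernel_sq \<kappa>2_def d_eq[symmetric])

lemma perturbed_window_n: "perturbed_window w g near C (a n)"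
  by unfold_locales (use a_pos[of n] a_le_1 density_nonneg in auto)

sublocale P: perturbed_window w g near C "a n" for n
  by (rule perturbed_window_n)

lemma power_kernel_window:
  assumes "0 < \<rho>" "\<rho> \<le> r n"
  shows "square_window_kernel w g near C (a n) (power_kernel \<beta> \<rho>) (r n)"
  by unfold_locales
    (use assms kern_integrable kern_sq_integrable r_pos in \<open>auto simp: power_kernel_def\<close>)

sublocale S: square_window_kernel w g near C "a n" "kern n" "r n"
  rewrites "mollifier.mass (kern n) = c n" and "square_window_kernel.k_energy (kern n) = Q n" for n
proof -
  show s: "square_window_kernel w g near C (a n) (kern n) (r n)"
    by (rule power_kernel_window) (use r_pos in auto)
  then interpret S: square_window_kernel w g near C "a n" "kern n" "r n" .
  show "S.mass = c n" using kern_mass[OF r_pos] by (simp add: S.mass_def c_def)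
  show "S.k_energy = Q n" using kern_energy[OF r_pos] by (simp add: S.k_energy_def Q_def)
qed

definition Z :: "nat \<Rightarrow> (nat \<Rightarrow> 'a) \<Rightarrow> real" where
  "Z n x = (pair_sum (\<lambda>x y. kern n (x - y)) {1..n} x - real n * (real n - 1) / 2 * form (kern n) (P.f n) (P.f n)) / \<sigma> n"

abbreviation sample_law :: "nat \<Rightarrow> (nat \<Rightarrow> 'a) measure" where
  "sample_law n \<equiv> Pi\<^sub>M {1..n} (\<lambda>_. P.law n)"

lemma prob_space_sample_law: "prob_space (sample_law n)"
  by (intro prob_space_PiM P.prob_space_law)

lemma pair_sum_measurable [measurable]:
  assumes [measurable]: "k \<in> borel_measurable borel"
  shows "pair_sum (\<lambda>x y. k (x - y)) {1..n} \<in> borel_measurable (sample_law n)"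
proof -
  have comp: "(\<lambda>x. x i) \<in> borel_measurable (sample_law n)" if "i \<in> {1..n}" for i
    using measurable_component_singleton[OF that, of "\<lambda>_. P.law n"]
    by (simp add: measurable_cong_sets[OF refl P.sets_law])
  show ?thesis
    unfolding pair_sum_def
    by (intro borel_measurable_times borel_measurable_const borel_measurable_sum
        measurable_compose[OF borel_measurable_diff assms] comp) auto
qed

lemma Z_measurable [measurable]: "Z n \<in> borel_measurable (sample_law n)"
  unfolding Z_def by measurable

text \<open>
  The share of the linear part of the Hoeffding decomposition in the variance, relative to \<open>(\<sigma> n)\<^sup>2\<close> and
  up to the constant \<open>D\<close>.
\<close>
definition y :: "nat \<Rightarrow> real" where "y n = (c n)\<^sup>2 / Q n * (real n * (r n + (a n)\<^sup>2))"

lemma y_nonneg: "y n \<ge> 0"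
  using Q_pos[of n] r_pos[of n] by (simp add: y_def)

text \<open>
  The radius \<open>\<rho>\<close> is smaller than \<open>r n\<close> when the bound is applied to the short edges that are cut off
  below; their contribution is then a small fraction of the variance.
\<close>
lemma standardized_second_moment:
  assumes n: "n > 0" and \<rho>: "0 < \<rho>" "\<rho> \<le> r n"
  shows "(\<integral>\<^sup>+x. ennreal (((pair_sum (\<lambda>x y. power_kernel \<beta> \<rho> (x - y)) {1..n} x
      - real n * (real n - 1) / 2 * form (power_kernel \<beta> \<rho>) (P.f n) (P.f n)) / \<sigma> n)\<^sup>2) \<partial>sample_law n)
    \<le> ennreal (4 * K * (\<rho> / r n) powr (2 * \<beta> + d) + 4 * D * y n)"
proof -
  interpret R: square_window_kernel w g near C "a n" "power_kernel \<beta> \<rho>" "r n"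
    by (rule power_kernel_window[OF \<rho>])
  have \<sigma>: "\<sigma> n > 0" "(\<sigma> n)\<^sup>2 = (real n)\<^sup>2 * Q n / 2"
    using \<sigma>_pos[OF n] Q_pos[of n] by (auto simp: \<sigma>_def power_mult_distrib)
  define X where "X x = pair_sum (\<lambda>x y. power_kernel \<beta> \<rho> (x - y)) {1..n} x
      - real n * (real n - 1) / 2 * form (power_kernel \<beta> \<rho>) (P.f n) (P.f n)" for x :: "nat \<Rightarrow> 'a"
  have mass: "R.mass \<le> c n"
  proof -
    have "\<rho> powr (\<beta> + d) \<le> r n powr (\<beta> + d)" using \<rho> beta_pos by (intro powr_mono2) auto
    then show ?thesis using kern_mass[OF \<rho>(1)] \<kappa>_pos by (simp add: R.mass_def c_def)
  qed
  have energy: "R.k_energy = Q n * (\<rho> / r n) powr (2 * \<beta> + d)"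
    using kern_energy[OF \<rho>(1)] \<rho> r_pos[of n] by (simp add: R.k_energy_def Q_def powr_divide)
  have [measurable]: "X \<in> borel_measurable (sample_law n)" unfolding X_def by measurable
  have "(\<integral>\<^sup>+x. ennreal ((X x / \<sigma> n)\<^sup>2) \<partial>sample_law n) = (\<integral>\<^sup>+x. ennreal (1 / (\<sigma> n)\<^sup>2) * ennreal ((X x)\<^sup>2) \<partial>sample_law n)"
    by (intro nn_integral_cong) (simp add: ennreal_mult[symmetric] power_divide)
  also have "\<dots> = ennreal (1 / (\<sigma> n)\<^sup>2) * (\<integral>\<^sup>+x. ennreal ((X x)\<^sup>2) \<partial>sample_law n)"
    by (rule nn_integral_cmult) measurable
  also have "\<dots> \<le> ennreal (1 / (\<sigma> n)\<^sup>2) * ennreal ((real n)\<^sup>2 * (2 * K * R.k_energy) + 2 * (real n)^3 * (D * R.mass\<^sup>2 * (r n + (a n)\<^sup>2)))"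
    using R.pair_sum_variance_le[of "{1..n}"] by (intro mult_left_mono) (auto simp: X_def)
  also have "\<dots> \<le> ennreal (1 / (\<sigma> n)\<^sup>2) * ennreal ((real n)\<^sup>2 * (2 * K * R.k_energy) + 2 * (real n)^3 * (D * (c n)\<^sup>2 * (r n + (a n)\<^sup>2)))"
    using D_nonneg K_ge r_pos[of n] mass R.mass_nonneg
    by (intro mult_left_mono ennreal_leI add_mono mult_right_mono power_mono) auto
  also have "\<dots> = ennreal (4 * K * (\<rho> / r n) powr (2 * \<beta> + d) + 4 * D * y n)"
  proof (subst ennreal_mult[symmetric])
    show "ennreal (1 / (\<sigma> n)\<^sup>2 * ((real n)\<^sup>2 * (2 * K * R.k_energy) + 2 * (real n)^3 * (D * (c n)\<^sup>2 * (r n + (a n)\<^sup>2))))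
      = ennreal (4 * K * (\<rho> / r n) powr (2 * \<beta> + d) + 4 * D * y n)"
      unfolding \<sigma>(2) energy y_def using n Q_pos[of n]
      by (intro arg_cong[where f = ennreal]) (simp add: field_simps power2_eq_square power3_eq_cube)
  next
    show "0 \<le> (real n)\<^sup>2 * (2 * K * R.k_energy) + 2 * (real n)^3 * (D * (c n)\<^sup>2 * (r n + (a n)\<^sup>2))"
      using K_ge D_nonneg r_pos[of n] Q_pos[of n] energy by (intro add_nonneg_nonneg mult_nonneg_nonneg) auto
  qed simp
  finally show ?thesis by (simp add: X_def)
qed

lemma Z_second_moment:
  assumes n: "n > 0"
  shows "(\<integral>\<^sup>+x. ennreal ((Z n x)\<^sup>2) \<partial>sample_law n) \<le> ennreal (4 * K + 4 * D * y n)"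
  using standardized_second_moment[OF n r_pos order_refl] r_pos[of n] by (simp add: Z_def)

lemma sqrt_r_powr: "sqrt (r n powr (2 * \<beta> + d)) = r n powr (\<beta> + d / 2)"
  using r_pos[of n] by (simp add: powr_half_sqrt[symmetric] powr_powr add_divide_distrib)

lemma mass_energy_ratio: "(c n)\<^sup>2 / Q n = \<kappa>1\<^sup>2 / \<kappa>2 * r n powr d"
proof -
  have "(r n powr (\<beta> + d))\<^sup>2 / r n powr (2 * \<beta> + d) = r n powr d"
    using r_pos[of n] by (simp add: power2_eq_square powr_add[symmetric] powr_diff[symmetric])
  then show ?thesis unfolding c_def Q_def power_mult_distrib
    by (metis (no_types, lifting) times_divide_times_eq)
qed

lemma r_powr_lim: "p > 0 \<Longrightarrow> (\<lambda>n. r n powr p) \<longlonglongrightarrow> 0"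
  using tendsto_powr2[OF r_lim tendsto_const, of p] r_pos by (auto simp: less_imp_le)

lemma mass_energy_ratio_lim: "(\<lambda>n. (c n)\<^sup>2 / Q n) \<longlonglongrightarrow> 0"
  unfolding mass_energy_ratio using tendsto_mult_right_zero[OF r_powr_lim[OF d_pos], of "\<kappa>1\<^sup>2 / \<kappa>2"] by simp

lemma y_eq: "y n = \<kappa>1\<^sup>2 / \<kappa>2 * (real n * r n powr (d + 1) + real n * r n powr d * (a n)\<^sup>2)"
  unfolding y_def mass_energy_ratio using r_pos[of n] by (simp add: powr_add algebra_simps add_divide_distrib)

lemma y_lim: "(\<lambda>n. real n * r n powr d * (a n)\<^sup>2) \<longlonglongrightarrow> 0 \<Longrightarrow> y \<longlonglongrightarrow> 0"
  unfolding y_eq[abs_def] using tendsto_mult_right_zero[OF tendsto_add[OF nrd1, simplified]] by blast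

text \<open>
  For a negative exponent \<open>kern n\<close> is unbounded at the origin.  Edges shorter than \<open>\<epsilon> * r n\<close> are split
  off; what is left is bounded, and its bound exceeds the natural size \<open>r n powr \<beta>\<close> only by a factor that
  depends on \<open>\<epsilon>\<close>.
\<close>
definition cut :: "real \<Rightarrow> nat \<Rightarrow> 'a \<Rightarrow> real" where
  "cut \<epsilon> n z = of_bool (\<epsilon> * r n < norm z) * kern n z"

definition cut_bound :: "real \<Rightarrow> nat \<Rightarrow> real" where
  "cut_bound \<epsilon> n = r n powr \<beta> * max 1 (\<epsilon> powr \<beta>)"

lemma kern_split: "\<epsilon> < 1 \<Longrightarrow> kern n z = cut \<epsilon> n z + power_kernel \<beta> (\<epsilon> * r n) z"
  using r_pos[of n] by (auto simp: cut_def power_kernel_def mult_le_cancel_right1)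
    (smt (verit) mult_le_cancel_right1)

lemma cut_le: 
  assumes "0 < \<epsilon>" "\<epsilon> < 1"
  shows "cut \<epsilon> n z \<le> cut_bound \<epsilon> n"
proof (cases "\<epsilon> * r n < norm z \<and> norm z \<le> r n")
  case True
  show ?thesis
  proof (cases "\<beta> \<ge> 0")
    case pos: True
    have "norm z powr \<beta> \<le> r n powr \<beta>" using True pos by (intro powr_mono2) auto
    also have "\<dots> \<le> cut_bound \<epsilon> n" unfolding cut_bound_def by (simp add: mult_le_cancel_left1)
    finally show ?thesis using True by (simp add: cut_def power_kernel_def)
  next
    case neg: False
    have "norm z powr \<beta> \<le> (\<epsilon> * r n) powr \<beta>" using True neg assms r_pos[of n] by (intro powr_mono2') auto
    also have "\<dots> = r n powr \<beta> * \<epsilon> powr \<beta>" using assms r_pos[of n] by (simp add: powr_mult)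
    also have "\<dots> \<le> cut_bound \<epsilon> n" unfolding cut_bound_def by (intro mult_left_mono) auto
    finally show ?thesis using True by (simp add: cut_def power_kernel_def)
  qed
next
  case False
  then show ?thesis by (auto simp: cut_def power_kernel_def cut_bound_def)
qed

lemma cut_kernel:
  assumes "0 < \<epsilon>" "\<epsilon> < 1"
  shows "bounded_window_kernel w g near C (a n) (cut \<epsilon> n) (r n) (cut_bound \<epsilon> n)"
proof unfold_locales
  show m: "cut \<epsilon> n \<in> borel_measurable borel" unfolding cut_def by measurable
  show "integrable lborel (cut \<epsilon> n)"
    by (rule Bochner_Integration.integrable_bound[OF kern_integrable[OF r_pos[of n]]])
      (use m in \<open>auto simp: cut_def power_kernel_nonneg\<close>)
qed (use assms cut_le in \<open>auto simp: cut_def power_kernel_def r_pos\<close>)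

lemma cut_bound_ratio:
  "cut_bound \<epsilon> n / sqrt (Q n) * ((c n)\<^sup>2 / Q n) = max 1 (\<epsilon> powr \<beta>) * \<kappa>1\<^sup>2 / (\<kappa>2 * sqrt \<kappa>2) * r n powr (d / 2)"
proof -
  have "r n powr \<beta> / sqrt (r n powr (2 * \<beta> + d)) * r n powr d = r n powr (d / 2)"
    unfolding sqrt_r_powr using r_pos[of n] by (simp add: powr_add[symmetric] powr_diff[symmetric])
  then have "max 1 (\<epsilon> powr \<beta>) * \<kappa>1\<^sup>2 / (\<kappa>2 * sqrt \<kappa>2) * r n powr (d / 2)
      = max 1 (\<epsilon> powr \<beta>) * \<kappa>1\<^sup>2 / (\<kappa>2 * sqrt \<kappa>2) * (r n powr \<beta> / sqrt (r n powr (2 * \<beta> + d)) * r n powr d)"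
    by simp
  then show ?thesis
    unfolding mass_energy_ratio unfolding cut_bound_def Q_def real_sqrt_mult by (simp add: mult_ac)
qed

lemma cut_bound_sq_ratio:
  "(cut_bound \<epsilon> n)\<^sup>2 / ((real n)\<^sup>2 * Q n) = (max 1 (\<epsilon> powr \<beta>))\<^sup>2 / \<kappa>2 / ((real n)\<^sup>2 * r n powr d)"
proof -
  have "r n powr (2 * \<beta> + d) = r n powr \<beta> * r n powr \<beta> * r n powr d"
    unfolding powr_add[symmetric] by simp
  then have "(r n powr \<beta>)\<^sup>2 / r n powr (2 * \<beta> + d) = 1 / r n powr d"
    using r_pos[of n] by (simp add: power2_eq_square)
  then have "(max 1 (\<epsilon> powr \<beta>))\<^sup>2 / \<kappa>2 / ((real n)\<^sup>2 * r n powr d)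
      = (max 1 (\<epsilon> powr \<beta>))\<^sup>2 / \<kappa>2 / (real n)\<^sup>2 * ((r n powr \<beta>)\<^sup>2 / r n powr (2 * \<beta> + d))"
    by simp
  then show ?thesis unfolding cut_bound_def Q_def power_mult_distrib by (simp add: mult_ac)
qed

context
  fixes \<epsilon> :: real
  assumes \<epsilon>: "0 < \<epsilon>" "\<epsilon> < 1"
begin

interpretation T: bounded_window_kernel w g near C "a n" "cut \<epsilon> n" "r n" "cut_bound \<epsilon> n" for n
  by (rule cut_kernel[OF \<epsilon>])

text \<open>The fraction of the energy of the kernel that the short edges carry.\<close>
definition "\<eta> = \<epsilon> powr (2 * \<beta> + d)"

lemma \<eta>: "0 < \<eta>" "\<eta> < 1"
  using \<epsilon> beta_pos powr_less_mono2[of "2 * \<beta> + d" \<epsilon> 1] by (auto simp: \<eta>_def)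

lemma cut_mass: "T.mass n \<le> c n"
proof -
  have "T.mass n \<le> (\<integral>z. kern n z \<partial>(lborel :: 'a measure))"
    unfolding T.mass_def
    by (intro integral_mono T.k_integrable kern_integrable r_pos) (auto simp: cut_def power_kernel_nonneg)
  then show ?thesis using kern_mass[OF r_pos] by (simp add: c_def)
qed

lemma cut_energy: "T.energy n = Q n * (1 - \<eta>)"
proof -
  have \<rho>: "0 < \<epsilon> * r n" using \<epsilon> r_pos by simp
  have "T.energy n = (\<integral>z. (kern n z)\<^sup>2 - (power_kernel \<beta> (\<epsilon> * r n) z)\<^sup>2 \<partial>(lborel :: 'a measure))"
    unfolding T.energy_def
  proof (intro Bochner_Integration.integral_cong refl)
    fix z :: 'a
    have "cut \<epsilon> n z * power_kernel \<beta> (\<epsilon> * r n) z = 0" by (auto simp: cut_def power_kernel_def)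
    then show "(cut \<epsilon> n z)\<^sup>2 = (kern n z)\<^sup>2 - (power_kernel \<beta> (\<epsilon> * r n) z)\<^sup>2"
      unfolding kern_split[OF \<epsilon>(2)] by (simp add: power2_sum)
  qed
  also have "\<dots> = \<kappa>2 * r n powr (2 * \<beta> + d) - \<kappa>2 * (\<epsilon> * r n) powr (2 * \<beta> + d)"
    using kern_sq_integrable[OF r_pos] kern_sq_integrable[OF \<rho>] kern_energy[OF r_pos] kern_energy[OF \<rho>] by simp
  also have "\<dots> = Q n * (1 - \<eta>)"
    using \<epsilon> r_pos[of n] by (simp add: Q_def \<eta>_def powr_mult algebra_simps)
  finally show ?thesis .
qed

lemma cut_variance_limit: "(\<lambda>n. T.U.R.m2 n / Q n) \<longlonglongrightarrow> 1 - \<eta>"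
proof (rule LIM_zero_cancel, rule Lim_null_comparison)
  show "(\<lambda>n. 3 * C * r n + 2 * G2 * a n + 6 * K * ((c n)\<^sup>2 / Q n)) \<longlonglongrightarrow> 0"
  proof -
    have "(\<lambda>n. 3 * C * r n + 2 * G2 * a n + 6 * K * ((c n)\<^sup>2 / Q n)) \<longlonglongrightarrow> 3 * C * 0 + 2 * G2 * 0 + 6 * K * 0"
      by (intro tendsto_add tendsto_mult tendsto_const r_lim a_lim mass_energy_ratio_lim)
    then show ?thesis by simp
  qed
  show "\<forall>\<^sub>F n in sequentially. norm (T.U.R.m2 n / Q n - (1 - \<eta>)) \<le> 3 * C * r n + 2 * G2 * a n + 6 * K * ((c n)\<^sup>2 / Q n)"
  proof (intro always_eventually allI)
    fix n
    define e where "e = 3 * C * r n + 2 * G2 * a n"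
    have e: "e \<ge> 0" using C_nonneg G_nonneg r_pos[of n] a_pos[of n] by (simp add: e_def less_imp_le)
    have E: "T.energy n \<ge> 0" "T.energy n \<le> Q n"
      using cut_energy[of n] Q_pos[of n] \<eta> by (auto simp: mult_le_cancel_left2)
    have v1: "T.U.v1 n \<le> 3 * K * (c n)\<^sup>2"
      using T.v1_bound[of n] mult_left_mono[OF power_mono[OF cut_mass T.mass_nonneg, of n 2], of "3 * K"] K_ge by linarith
    have "\<bar>T.U.a2 n - T.energy n\<bar> \<le> Q n * e"
      using T.a2_approx[of n] mult_right_mono[OF E(2) e] unfolding e_def by linarith
    then have "\<bar>T.U.R.m2 n - T.energy n\<bar> \<le> Q n * e + 6 * K * (c n)\<^sup>2"
      using T.U.m2_le[of n] T.U.m2_ge[of n] v1 T.U.v1_nonneg[of n] by linarith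
    then have "\<bar>T.U.R.m2 n - T.energy n\<bar> / Q n \<le> (Q n * e + 6 * K * (c n)\<^sup>2) / Q n"
      using Q_pos[of n] by (intro divide_right_mono) auto
    also have "\<dots> = e + 6 * K * ((c n)\<^sup>2 / Q n)" using Q_pos[of n] by (simp add: add_divide_distrib)
    also have "\<bar>T.U.R.m2 n - T.energy n\<bar> / Q n = \<bar>T.U.R.m2 n / Q n - (1 - \<eta>)\<bar>"
    proof -
      have "T.U.R.m2 n / Q n - (1 - \<eta>) = (T.U.R.m2 n - T.energy n) / Q n"
        using Q_pos[of n] unfolding cut_energy by (simp add: diff_divide_distrib)
      then show ?thesis using Q_pos[of n] by (simp add: abs_divide)
    qed
    finally show "norm (T.U.R.m2 n / Q n - (1 - \<eta>)) \<le> 3 * C * r n + 2 * G2 * a n + 6 * K * ((c n)\<^sup>2 / Q n)"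
      by (simp add: e_def)
  qed
qed

text \<open>
  Four errors add up: the normal approximation of the residual of the cut kernel, with truncation level
  \<open>\<epsilon>\<close> in Lindeberg's condition; the energy lost by cutting; the linear part of the cut kernel; and the
  short edges.
\<close>
definition char_gap :: "real \<Rightarrow> nat \<Rightarrow> real" where
  "char_gap t n = t\<^sup>2 * (sqrt (48 * K / n) + sqrt 2 * sqrt (24 * K\<^sup>2 * (cut_bound \<epsilon> n / sqrt (Q n) * ((c n)\<^sup>2 / Q n))
        + 96 * K\<^sup>2 * ((c n)\<^sup>2 / Q n) + 144 * K\<^sup>2 * ((c n)\<^sup>2 / Q n)\<^sup>2))
      + \<bar>t\<bar>^3 / 12 * (4 * K * \<epsilon> + 4 / \<epsilon> * (8 * K * ((cut_bound \<epsilon> n)\<^sup>2 / ((real n)\<^sup>2 * Q n)) + 144 * K / n)) + 24 * t^4 * K / n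
      + \<bar>exp (- (t\<^sup>2 * ((real n - 1) / n * (T.U.R.m2 n / Q n)) / 2)) - exp (- (t\<^sup>2 / 2))\<bar>
      + \<bar>t\<bar> * (sqrt (2 * D * y n) + sqrt (4 * K * \<eta> + 4 * D * y n))"

lemma char_Z_bound:
  assumes n: "n > 0"
  shows "cmod ((\<integral>x. iexp (t * Z n x) \<partial>sample_law n) - complex_of_real (exp (- (t\<^sup>2 / 2)))) \<le> char_gap t n"
proof -
  interpret M: prob_space "sample_law n" by (rule prob_space_sample_law)
  have \<rho>: "0 < \<epsilon> * r n" "\<epsilon> * r n \<le> r n" using \<epsilon> r_pos[of n] by (auto simp: mult_le_cancel_right1)
  interpret R: square_window_kernel w g near C "a n" "power_kernel \<beta> (\<epsilon> * r n)" "r n"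
    by (rule power_kernel_window[OF \<rho>])
  define A where "A x = pair_sum (T.U.residual n) {1..n} x / \<sigma> n" for x
  define Zc where "Zc x = (pair_sum (\<lambda>x y. cut \<epsilon> n (x - y)) {1..n} x - real n * (real n - 1) / 2 * form (cut \<epsilon> n) (P.f n) (P.f n)) / \<sigma> n" for x :: "nat \<Rightarrow> 'a"
  define Zr where "Zr x = (pair_sum (\<lambda>x y. power_kernel \<beta> (\<epsilon> * r n) (x - y)) {1..n} x
      - real n * (real n - 1) / 2 * form (power_kernel \<beta> (\<epsilon> * r n)) (P.f n) (P.f n)) / \<sigma> n" for x :: "nat \<Rightarrow> 'a"
  have A_bm: "A \<in> bounded_measurable (sample_law n)"
    unfolding A_def by (intro bm_divide T.U.residual_sum_bm)
  have Zc_bm: "Zc \<in> bounded_measurable (sample_law n)"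
    unfolding Zc_def by (intro bm_intros T.U.bm_pair_sum T.U.h_bm)
  note [measurable] = bm_measurable[OF A_bm] bm_measurable[OF Zc_bm]
  have [measurable]: "Zr \<in> borel_measurable (sample_law n)" unfolding Zr_def by measurable
  have split: "Z n x = Zc x + Zr x" for x
  proof -
    have "form (kern n) (P.f n) (P.f n) = form (cut \<epsilon> n) (P.f n) (P.f n) + form (power_kernel \<beta> (\<epsilon> * r n)) (P.f n) (P.f n)"
      unfolding form_def kern_split[OF \<epsilon>(2)] distrib_right
      by (intro Bochner_Integration.integral_add T.form_integrable' R.form_integrable' P.f_square_integrable)
    moreover have "pair_sum (\<lambda>x y. kern n (x - y)) {1..n} x
        = pair_sum (\<lambda>x y. cut \<epsilon> n (x - y)) {1..n} x + pair_sum (\<lambda>x y. power_kernel \<beta> (\<epsilon> * r n) (x - y)) {1..n} x"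
      unfolding pair_sum_def kern_split[OF \<epsilon>(2)] by (simp add: sum.distrib add_divide_distrib)
    ultimately show ?thesis by (simp add: Z_def Zc_def Zr_def add_divide_distrib[symmetric] algebra_simps)
  qed
  have Zr2: "(\<integral>\<^sup>+x. ennreal ((Zr x)\<^sup>2) \<partial>sample_law n) \<le> ennreal (4 * K * \<eta> + 4 * D * y n)"
    using standardized_second_moment[OF n \<rho>] r_pos[of n] by (simp add: Zr_def \<eta>_def)
  have v: "4 * K * \<eta> + 4 * D * y n \<ge> 0" using K_ge \<eta> D_nonneg y_nonneg[of n] by simp
  note Zr = M.L1_le_of_second_moment[OF _ Zr2 v]
  have Zr': "integrable (sample_law n) Zr" "(\<integral>x. \<bar>Zr x\<bar> \<partial>sample_law n) \<le> sqrt (4 * K * \<eta> + 4 * D * y n)"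
    by (rule Zr; measurable)+
  have 1: "cmod ((\<integral>x. iexp (t * Z n x) \<partial>sample_law n) - (\<integral>x. iexp (t * Zc x) \<partial>sample_law n))
      \<le> \<bar>t\<bar> * sqrt (4 * K * \<eta> + 4 * D * y n)"
  proof -
    have "cmod ((\<integral>x. iexp (t * Z n x) \<partial>sample_law n) - (\<integral>x. iexp (t * Zc x) \<partial>sample_law n))
      \<le> \<bar>t\<bar> * (\<integral>x. \<bar>Z n x - Zc x\<bar> \<partial>sample_law n)"
    proof (rule M.char_lipschitz)
      show "Z n \<in> borel_measurable (sample_law n)" by (rule Z_measurable)
      show "Zc \<in> borel_measurable (sample_law n)" by (rule bm_measurable[OF Zc_bm])
      show "integrable (sample_law n) (\<lambda>x. Z n x - Zc x)"
        using Zr'(1) by (simp only: split add_diff_cancel_left')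
    qed
    also have "\<dots> \<le> \<bar>t\<bar> * sqrt (4 * K * \<eta> + 4 * D * y n)"
      unfolding split add_diff_cancel_left' by (intro mult_left_mono Zr'(2)) simp
    finally show ?thesis .
  qed
  have I: "finite {1..n}" "card {1..n} = n" by auto
  have 2: "cmod ((\<integral>x. iexp (t * Zc x) \<partial>sample_law n) - (\<integral>x. iexp (t * A x) \<partial>sample_law n))
      \<le> \<bar>t\<bar> * sqrt (2 * D * y n)"
  proof -
    have "cmod ((\<integral>x. iexp (t * Zc x) \<partial>sample_law n) - (\<integral>x. iexp (t * A x) \<partial>sample_law n))
      \<le> \<bar>t\<bar> * (\<integral>x. \<bar>Zc x - A x\<bar> \<partial>sample_law n)"
      by (intro M.char_lipschitz bm_measurable M.bm_integrable bm_diff Zc_bm A_bm)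
    also have "(\<integral>x. \<bar>Zc x - A x\<bar> \<partial>sample_law n) \<le> sqrt (2 * D * y n)"
      using T.standardized_residual_distance[OF Q_pos cut_mass n I]
      unfolding Zc_def A_def y_def \<sigma>_def .
    finally show ?thesis by (simp add: mult_left_mono)
  qed
  define m where "m = (real n - 1) / n * (T.U.R.m2 n / Q n)"
  have E: "0 < T.energy n" "T.energy n \<le> Q n"
    using Q_pos[of n] \<eta> by (auto simp: cut_energy mult_le_cancel_left2)
  note 3 = T.residual_char_bound[OF E cut_mass n \<epsilon>(1) I, of t, folded \<sigma>_def, folded m_def, folded A_def]
  have 4: "cmod (complex_of_real (exp (- (t\<^sup>2 * m / 2))) - complex_of_real (exp (- (t\<^sup>2 / 2))))
      = \<bar>exp (- (t\<^sup>2 * m / 2)) - exp (- (t\<^sup>2 / 2))\<bar>"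
    by (simp only: of_real_diff[symmetric] norm_of_real)
  define zz where "zz = (\<integral>x. iexp (t * Z n x) \<partial>sample_law n)"
  define zc where "zc = (\<integral>x. iexp (t * Zc x) \<partial>sample_law n)"
  define za where "za = (\<integral>x. iexp (t * A x) \<partial>sample_law n)"
  define e1 e2 where "e1 = complex_of_real (exp (- (t\<^sup>2 * m / 2)))" and "e2 = complex_of_real (exp (- (t\<^sup>2 / 2)))"
  have "zz - e2 = (zz - zc) + (zc - za) + (za - e1) + (e1 - e2)" by simp
  then have "cmod (zz - e2) \<le> cmod (zz - zc) + cmod (zc - za) + cmod (za - e1) + cmod (e1 - e2)"
    by (metis (no_types, lifting) norm_triangle_ineq norm_triangle_mono order_refl)
  with 1 2 3 4 show ?thesis
    unfolding char_gap_def m_def[symmetric] zz_def[symmetric] zc_def[symmetric] za_def[symmetric] e1_def[symmetric] e2_def[symmetric]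
      distrib_left[of "\<bar>t\<bar>"] by linarith
qed

lemma char_gap_limit:
  assumes y: "y \<longlonglongrightarrow> 0"
  shows "char_gap t \<longlonglongrightarrow> \<bar>t\<bar>^3 / 12 * (4 * K * \<epsilon>) + \<bar>exp (- (t\<^sup>2 * (1 - \<eta>) / 2)) - exp (- (t\<^sup>2 / 2))\<bar> + \<bar>t\<bar> * sqrt (4 * K * \<eta>)"
proof -
  have inv: "(\<lambda>n. u / real n) \<longlonglongrightarrow> 0" for u :: real by (rule lim_const_over_n)
  have b1: "(\<lambda>n. cut_bound \<epsilon> n / sqrt (Q n) * ((c n)\<^sup>2 / Q n)) \<longlonglongrightarrow> 0"
    unfolding cut_bound_ratio by (intro tendsto_mult_right_zero r_powr_lim) (use d_pos in simp)
  have b2: "(\<lambda>n. (cut_bound \<epsilon> n)\<^sup>2 / ((real n)\<^sup>2 * Q n)) \<longlonglongrightarrow> 0"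
    unfolding cut_bound_sq_ratio by (rule tendsto_divide_0[OF tendsto_const filterlim_at_top_imp_at_infinity[OF n2rd]])
  show ?thesis
    unfolding char_gap_def[abs_def]
    by (rule char_gap_expression_limit[OF inv[of "48 * K"] b1 mass_energy_ratio_lim b2 inv[of "144 * K"] inv[of "24 * t^4 * K"]
        tendsto_mult[OF pred_ratio_limit cut_variance_limit] y])
qed

end

text \<open>
  The limit of \<open>char_gap\<close> for a fixed cut \<open>\<epsilon>\<close> is not zero, but it vanishes as \<open>\<epsilon>\<close> tends to zero: the
  cut is fixed first, so that its gap limit is small, and the sample size afterwards.
\<close>
theorem char_Z_limit:
  assumes "(\<lambda>n. real n * r n powr d * (a n)\<^sup>2) \<longlonglongrightarrow> 0"
  shows "(\<lambda>n. \<integral>x. iexp (t * Z n x) \<partial>sample_law n) \<longlonglongrightarrow> complex_of_real (exp (- (t\<^sup>2 / 2)))"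
proof (rule LIMSEQ_I)
  fix e :: real assume e: "e > 0"
  have y: "y \<longlonglongrightarrow> 0" by (rule y_lim[OF assms])
  define \<epsilon> where "\<epsilon> j = inverse (real (Suc (Suc j)))" for j
  have \<epsilon>: "0 < \<epsilon> j" "\<epsilon> j < 1" for j by (auto simp: \<epsilon>_def field_simps)
  have \<epsilon>_lim: "\<epsilon> \<longlonglongrightarrow> 0"
    unfolding \<epsilon>_def[abs_def] by (rule LIMSEQ_Suc[OF LIMSEQ_inverse_real_of_nat])
  have \<eta>_lim: "(\<lambda>j. \<eta> (\<epsilon> j)) \<longlonglongrightarrow> 0"
    unfolding \<eta>_def[OF \<epsilon>] using tendsto_powr2[OF \<epsilon>_lim tendsto_const, of "2 * \<beta> + d"] beta_pos \<epsilon>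
    by (auto simp: less_imp_le)
  define Y where "Y j = \<bar>t\<bar>^3 / 12 * (4 * K * \<epsilon> j) + \<bar>exp (- (t\<^sup>2 * (1 - \<eta> (\<epsilon> j)) / 2)) - exp (- (t\<^sup>2 / 2))\<bar>
      + \<bar>t\<bar> * sqrt (4 * K * \<eta> (\<epsilon> j))" for j
  have "Y \<longlonglongrightarrow> 0" unfolding Y_def by (rule char_gap_expression_vanishes[OF \<epsilon>_lim \<eta>_lim])
  from eventually_happens'[OF sequentially_bot order_tendstoD(2)[OF this e]] obtain j where j: "Y j < e" by blast
  have "char_gap (\<epsilon> j) t \<longlonglongrightarrow> Y j" unfolding Y_def by (rule char_gap_limit[OF \<epsilon> y])
  from order_tendstoD(2)[OF this j] obtain n0 where n0: "\<And>n. n \<ge> n0 \<Longrightarrow> char_gap (\<epsilon> j) t n < e"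
    unfolding eventually_sequentially by blast
  have "norm ((\<integral>x. iexp (t * Z n x) \<partial>sample_law n) - complex_of_real (exp (- (t\<^sup>2 / 2)))) < e" if "n \<ge> max n0 1" for n
  proof -
    have n: "0 < n" "n0 \<le> n" using that by auto
    show ?thesis by (rule le_less_trans[OF char_Z_bound[OF \<epsilon> n(1)] n0[OF n(2)]])
  qed
  then show "\<exists>n0. \<forall>n\<ge>n0. norm ((\<integral>x. iexp (t * Z n x) \<partial>sample_law n) - complex_of_real (exp (- (t\<^sup>2 / 2)))) < e"
    by blast
qed

end

section \<open>The shift caused by the perturbation\<close>

text \<open>
  Levy's continuity theorem for the shifted variables, then the continuous mapping theorem for the
  square, both in terms of laws because the variables live on different spaces.
\<close>
lemma weak_conv_shifted_square:
  fixes P :: "nat \<Rightarrow> 'b measure" and Z :: "nat \<Rightarrow> 'b \<Rightarrow> real"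
  assumes P: "\<And>n. prob_space (P n)" and Z: "\<And>n. Z n \<in> borel_measurable (P n)"
    and char: "\<And>t. (\<lambda>n. \<integral>x. iexp (t * Z n x) \<partial>P n) \<longlonglongrightarrow> complex_of_real (exp (- (t\<^sup>2 / 2)))"
    and s: "s \<longlonglongrightarrow> \<mu>"
  shows "weak_conv_m (\<lambda>n. distr (P n) borel (\<lambda>x. (Z n x + s n)\<^sup>2)) (shifted_normal_square \<mu>)"
proof -
  note [measurable] = Z
  define L where "L n = distr (P n) borel (\<lambda>x. Z n x + s n)" for n
  define N where "N = distr std_normal_distribution borel (\<lambda>z::real. z + \<mu>)"
  interpret std: real_distribution std_normal_distribution by (rule real_dist_normal_dist)
  have L: "real_distribution (L n)" for n
  proof -
    interpret prob_space "P n" by (rule P)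
    show ?thesis unfolding L_def by (rule real_distribution_distr) measurable
  qed
  have N: "real_distribution N"
    unfolding N_def by (rule std.real_distribution_distr) measurable
  have "weak_conv_m L N"
  proof (rule levy_continuity[OF L N])
    fix t
    have "char (L n) t = iexp (t * s n) * (\<integral>x. iexp (t * Z n x) \<partial>P n)" for n
    proof -
      have "char (L n) t = (\<integral>x. iexp (t * (Z n x + s n)) \<partial>P n)"
        unfolding char_def L_def by (subst integral_distr) auto
      also have "\<dots> = (\<integral>x. iexp (t * s n) * iexp (t * Z n x) \<partial>P n)"
        by (simp add: distrib_left exp_add mult.commute)
      finally show ?thesis by simp
    qed
    moreover have "char N t = iexp (t * \<mu>) * complex_of_real (exp (- (t\<^sup>2 / 2)))"
    proof -
      have "char N t = (\<integral>z. iexp (t * (z + \<mu>)) \<partial>std_normal_distribution)"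
        unfolding char_def N_def by (subst integral_distr) auto
      also have "\<dots> = (\<integral>z. iexp (t * \<mu>) * iexp (t * z) \<partial>std_normal_distribution)"
        by (simp add: distrib_left exp_add mult.commute)
      also have "\<dots> = iexp (t * \<mu>) * char std_normal_distribution t" by (simp add: char_def)
      finally show ?thesis by (simp add: char_std_normal_distribution)
    qed
    moreover have "(\<lambda>n. iexp (t * s n) * (\<integral>x. iexp (t * Z n x) \<partial>P n)) \<longlonglongrightarrow> iexp (t * \<mu>) * complex_of_real (exp (- (t\<^sup>2 / 2)))"
      by (intro tendsto_mult char tendsto_exp tendsto_const tendsto_of_real s)
    ultimately show "(\<lambda>n. char (L n) t) \<longlonglongrightarrow> char N t" by simp
  qed
  show ?thesis
  proof (rule integral_bdd_continuous_conv_imp_weak_conv)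
    show "real_distribution (distr (P n) borel (\<lambda>x. (Z n x + s n)\<^sup>2))" for n
    proof -
      interpret prob_space "P n" by (rule P)
      show ?thesis by (rule real_distribution_distr) measurable
    qed
    show "real_distribution (shifted_normal_square \<mu>)"
      unfolding shifted_normal_square_def by (rule std.real_distribution_distr) measurable
    fix f :: "real \<Rightarrow> real" assume f: "\<And>x. isCont f x" "\<And>x. \<bar>f x\<bar> \<le> 1"
    have [measurable]: "f \<in> borel_measurable borel"
      using f(1) by (intro borel_measurable_continuous_onI) (simp add: continuous_at_imp_continuous_on)
    have "(\<lambda>n. \<integral>u. f (u\<^sup>2) \<partial>L n) \<longlonglongrightarrow> (\<integral>u. f (u\<^sup>2) \<partial>N)"
    proof (rule weak_conv_imp_integral_bdd_continuous_conv[OF L N \<open>weak_conv_m L N\<close>])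
      show "isCont (\<lambda>u. f (u\<^sup>2)) x" for x by (rule isCont_o2[OF _ f(1)]) simp
      show "norm (f (x\<^sup>2)) \<le> 1" for x using f(2) by simp
    qed
    then show "(\<lambda>n. integral\<^sup>L (distr (P n) borel (\<lambda>x. (Z n x + s n)\<^sup>2)) f) \<longlonglongrightarrow> integral\<^sup>L (shifted_normal_square \<mu>) f"
      by (simp add: L_def N_def shifted_normal_square_def integral_distr)
  qed
qed

text \<open>Chebyshev: if the square is at most \<open>B\<close>, then \<open>Z\<close> has to make up for at least half of the shift.\<close>
lemma (in prob_space) shifted_square_tail:
  fixes Z :: "'a \<Rightarrow> real"
  assumes [measurable]: "Z \<in> borel_measurable M" and le: "(\<integral>\<^sup>+x. ennreal ((Z x)\<^sup>2) \<partial>M) \<le> ennreal v" and v: "v \<ge> 0"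
    and B: "B > 0" and s: "s \<ge> 2 * sqrt B"
  shows "measure M {x \<in> space M. (Z x + s)\<^sup>2 > B} \<ge> 1 - 4 * (v / s\<^sup>2)"
proof -
  have s0: "s > 0" using s B by (smt (verit) real_sqrt_gt_zero)
  have i2: "integrable M (\<lambda>x. (Z x)\<^sup>2)"
    by (rule integrableI_nonneg) (use le in \<open>auto simp: top_unique less_top[symmetric]\<close>)
  have "{x \<in> space M. \<not> (Z x + s)\<^sup>2 > B} \<subseteq> {x \<in> space M. (s / 2)\<^sup>2 \<le> (Z x)\<^sup>2}"
  proof safe
    fix x assume "\<not> (Z x + s)\<^sup>2 > B"
    then have "\<bar>Z x + s\<bar> \<le> sqrt B" by (intro real_le_rsqrt) simp
    then have "\<bar>Z x\<bar> \<ge> s / 2" using s by linarith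
    then show "(s / 2)\<^sup>2 \<le> (Z x)\<^sup>2" using s0 by (metis abs_le_square_iff abs_of_pos half_gt_zero)
  qed
  then have "measure M {x \<in> space M. \<not> (Z x + s)\<^sup>2 > B} \<le> measure M {x \<in> space M. (s / 2)\<^sup>2 \<le> (Z x)\<^sup>2}"
    by (rule finite_measure_mono) measurable
  also have "\<dots> \<le> (\<integral>x. (Z x)\<^sup>2 \<partial>M) / (s / 2)\<^sup>2"
    by (rule integral_Markov_inequality_measure[OF i2, where A = "{}"]) (use s0 in auto)
  also have "\<dots> \<le> v / (s / 2)\<^sup>2"
    using le nn_integral_eq_integral[OF i2] v by (intro divide_right_mono) auto
  also have "\<dots> = 4 * (v / s\<^sup>2)" by (simp add: power_divide)
  finally have "measure M {x \<in> space M. \<not> (Z x + s)\<^sup>2 > B} \<le> 4 * (v / s\<^sup>2)" .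
  moreover have "measure M {x \<in> space M. \<not> (Z x + s)\<^sup>2 > B} = 1 - measure M {x \<in> space M. (Z x + s)\<^sup>2 > B}"
    by (rule prob_neg) measurable
  ultimately show ?thesis by linarith
qed

context shrinking_window_kernels
begin

text \<open>
  \<open>A\<close> is the order of the part of \<open>shift\<close> that is quadratic in the perturbation, and \<open>\<omega>\<close> is the ratio of
  the mass and the root energy of the kernel of radius one.  \<open>bias\<close> is the error of centring by the
  expectation in the absence of a boundary.
\<close>
definition A :: "nat \<Rightarrow> real" where "A n = real n * r n powr (d / 2) * (a n)\<^sup>2"
definition \<omega> :: real where "\<omega> = \<kappa>1 / sqrt \<kappa>2"
definition shift :: "nat \<Rightarrow> real" where
  "shift n = real n * (real n - 1) / 2 * (form (kern n) (P.f n) (P.f n) - form (kern n) w w) / \<sigma> n"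
definition bias :: "nat \<Rightarrow> real" where
  "bias n = real n * (real n - 1) / 2 * (form (kern n) w w - c n) / \<sigma> n"

lemma c_eq: "c n = \<omega> * r n powr (d / 2) * sqrt (Q n)"
proof -
  have "r n powr (d / 2) * r n powr (\<beta> + d / 2) = r n powr (\<beta> + d)"
    unfolding powr_add[symmetric] by (simp add: add.commute)
  then show ?thesis using \<kappa>_pos by (simp add: c_def \<omega>_def Q_def real_sqrt_mult sqrt_r_powr)
qed

lemma standardized_product:
  assumes "n > 0"
  shows "real n * (real n - 1) / 2 * (c n * u) / \<sigma> n = (real n - 1) * r n powr (d / 2) * (\<omega> / sqrt 2) * u"
proof -
  have q: "sqrt (Q n) > 0" using Q_pos by simp
  define t where "t = sqrt (2::real)"
  have t: "t > 0" "t * t = 2" by (auto simp: t_def)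
  have sig: "\<sigma> n = real n * sqrt (Q n) / t" by (simp add: \<sigma>_def real_sqrt_divide t_def)
  have "real n * (real n - 1) / (t * t) * (\<omega> * r n powr (d / 2) * sqrt (Q n) * u) / (real n * sqrt (Q n) / t)
      = (real n - 1) * r n powr (d / 2) * (\<omega> / t) * u"
    using assms q t(1) by (simp add: field_simps)
  then show ?thesis unfolding c_eq sig t_def[symmetric] t(2) .
qed

lemma \<omega>_pos: "\<omega> > 0"
  using \<kappa>_pos by (simp add: \<omega>_def)

lemma form_le_imp: "\<bar>u\<bar> \<le> c n * v \<Longrightarrow> n > 0 \<Longrightarrow> \<bar>real n * (real n - 1) / 2 * u / \<sigma> n\<bar> \<le> real n * r n powr (d / 2) * \<omega> * v"
proof -
  assume u: "\<bar>u\<bar> \<le> c n * v" and n: "n > 0"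
  have v: "v \<ge> 0" using u c_pos[of n] by (smt (verit) mult_pos_neg)
  have "\<bar>real n * (real n - 1) / 2 * u / \<sigma> n\<bar> = real n * (real n - 1) / 2 * \<bar>u\<bar> / \<sigma> n"
    using n \<sigma>_pos[OF n] by (simp add: abs_mult)
  also have "\<dots> \<le> real n * (real n - 1) / 2 * (c n * v) / \<sigma> n"
    using n \<sigma>_pos[OF n] u by (intro divide_right_mono mult_left_mono) auto
  also have "\<dots> = (real n - 1) * r n powr (d / 2) * (\<omega> / sqrt 2) * v" by (rule standardized_product[OF n])
  also have "\<dots> \<le> real n * r n powr (d / 2) * \<omega> * v"
  proof (intro mult_right_mono v mult_mono)
    have "\<omega> * 1 \<le> \<omega> * sqrt 2" using \<omega>_pos by (intro mult_left_mono) auto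
    then show "\<omega> / sqrt 2 \<le> \<omega>" by (simp add: field_simps)
  qed (use n \<omega>_pos in auto)
  finally show ?thesis .
qed

lemma bias_bound: "n > 0 \<Longrightarrow> \<bar>bias n\<bar> \<le> \<omega> * C * (real n * r n powr (d / 2 + 1))"
  unfolding bias_def using form_le_imp[OF S.form_w_w[of n]] r_pos[of n]
  by (simp add: powr_add mult_ac)

lemma bias_limit:
  assumes "(\<lambda>n. (real n)\<^sup>2 * r n powr (d + 2)) \<longlonglongrightarrow> 0"
  shows "bias \<longlonglongrightarrow> 0"
proof (rule Lim_null_comparison)
  have "(\<lambda>n. sqrt ((real n)\<^sup>2 * r n powr (d + 2))) \<longlonglongrightarrow> sqrt 0"
    by (rule tendsto_real_sqrt[OF assms])
  moreover have "sqrt ((real n)\<^sup>2 * r n powr (d + 2)) = real n * r n powr (d / 2 + 1)" for n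
    using r_pos[of n] by (simp add: real_sqrt_mult powr_half_sqrt[symmetric] powr_powr add_divide_distrib)
  ultimately show "(\<lambda>n. \<omega> * C * (real n * r n powr (d / 2 + 1))) \<longlonglongrightarrow> 0"
    by (intro tendsto_mult_right_zero) simp
  show "\<forall>\<^sub>F n in sequentially. norm (bias n) \<le> \<omega> * C * (real n * r n powr (d / 2 + 1))"
    by (rule eventually_sequentiallyI[of 1]) (use bias_bound in auto)
qed

definition gg :: "nat \<Rightarrow> real" where "gg n = form (kern n) g g / c n"

lemma gg_limit: "gg \<longlonglongrightarrow> G2"
proof -
  have "(\<lambda>n. form (kern n) g g / (\<integral>z. kern n z \<partial>lborel)) \<longlonglongrightarrow> G2"
    by (rule form_g_g_limit[where r = r]) (use S.window_mollifier_axioms r_lim kern_mass[OF r_pos] c_pos in \<open>auto simp: c_def\<close>)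
  then show ?thesis using kern_mass[OF r_pos] by (simp add: gg_def[abs_def] c_def)
qed

text \<open>
  The shift is a quadratic polynomial in the amplitude \<open>a n\<close>.  The linear coefficient \<open>form (kern n) g w\<close>
  is only a boundary effect, since \<open>g\<close> has mean zero.
\<close>
lemma shift_approx:
  assumes n: "n > 0"
  shows "\<bar>shift n - (\<omega> / sqrt 2) * ((real n - 1) / n) * A n * gg n\<bar> \<le> 2 * \<omega> * C * (real n * r n powr (d / 2 + 1) * a n)"
proof -
  have f: "form (kern n) (P.f n) (P.f n) - form (kern n) w w = 2 * a n * form (kern n) g w + (a n)\<^sup>2 * form (kern n) g g"
    using S.form_perturbed[of n "a n"] by (simp add: P.f_def[abs_def])
  have F: "(a n)\<^sup>2 * form (kern n) g g = c n * ((a n)\<^sup>2 * gg n)"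
    using c_pos[of n] by (simp add: gg_def)
  have "shift n = real n * (real n - 1) / 2 * (2 * a n * form (kern n) g w) / \<sigma> n
      + real n * (real n - 1) / 2 * (c n * ((a n)\<^sup>2 * gg n)) / \<sigma> n"
    unfolding shift_def f F by (simp add: distrib_left add_divide_distrib)
  also have "real n * (real n - 1) / 2 * (c n * ((a n)\<^sup>2 * gg n)) / \<sigma> n = (\<omega> / sqrt 2) * ((real n - 1) / n) * A n * gg n"
    unfolding standardized_product[OF n] using n by (simp add: A_def)
  finally have eq: "shift n - (\<omega> / sqrt 2) * ((real n - 1) / n) * A n * gg n
      = real n * (real n - 1) / 2 * (2 * a n * form (kern n) g w) / \<sigma> n" by simp
  have "\<bar>2 * a n * form (kern n) g w\<bar> = 2 * a n * \<bar>form (kern n) g w\<bar>"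
    using a_pos[of n] by (simp add: abs_mult)
  also have "\<dots> \<le> 2 * a n * (c n * (C * r n))"
    using a_pos[of n] S.form_g_w[of n] by (intro mult_left_mono) auto
  finally have "\<bar>2 * a n * form (kern n) g w\<bar> \<le> c n * (2 * a n * C * r n)" by (simp add: mult_ac)
  from form_le_imp[OF this n] show ?thesis
    unfolding eq using r_pos[of n] by (simp add: powr_add mult_ac)
qed

text \<open>The order of the part of \<open>shift\<close> that is linear in the perturbation.\<close>
definition E :: "nat \<Rightarrow> real" where "E n = real n * r n powr (d / 2 + 1) * a n"

lemma E_nonneg: "E n \<ge> 0"
  using a_pos[of n] by (simp add: E_def)

text \<open>
  \<open>E n\<close> is \<open>r n / a n\<close> times \<open>A n\<close>.  So if the minimum tends to zero, then the linear part of the shift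
  tends to zero or is dominated by the quadratic part, whichever term attains the minimum.
\<close>
lemma E_le: "E n \<le> min (E n) (r n / a n) * max 1 (A n)"
proof (cases "E n \<le> r n / a n")
  case True
  then show ?thesis using E_nonneg[of n] by (simp add: mult_le_cancel_left1)
next
  case False
  have "E n = r n / a n * A n"
    using a_pos[of n] r_pos[of n] by (simp add: E_def A_def powr_add power2_eq_square)
  also have "\<dots> \<le> r n / a n * max 1 (A n)"
    using a_pos[of n] r_pos[of n] by (intro mult_left_mono) auto
  finally show ?thesis using False by simp
qed

context
  assumes min_cond: "(\<lambda>n. min (E n) (r n / a n)) \<longlonglongrightarrow> 0"
begin

lemma shift_limit:
  assumes A: "A \<longlonglongrightarrow> \<gamma>"
  shows "shift \<longlonglongrightarrow> \<omega> / sqrt 2 * \<gamma> * G2"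
proof -
  have "(\<lambda>n. min (E n) (r n / a n) * max 1 (A n)) \<longlonglongrightarrow> 0 * max 1 \<gamma>"
    by (intro tendsto_mult tendsto_max tendsto_const A min_cond)
  then have lim0: "(\<lambda>n. 2 * \<omega> * C * (min (E n) (r n / a n) * max 1 (A n))) \<longlonglongrightarrow> 0"
    by (intro tendsto_mult_right_zero) simp
  have "(\<lambda>n. shift n - (\<omega> / sqrt 2) * ((real n - 1) / n) * A n * gg n) \<longlonglongrightarrow> 0"
  proof (rule Lim_null_comparison[OF _ lim0], rule eventually_sequentiallyI[of 1])
    fix n :: nat assume "1 \<le> n"
    then have n: "n > 0" by simp
    have "\<bar>shift n - (\<omega> / sqrt 2) * ((real n - 1) / n) * A n * gg n\<bar> \<le> 2 * \<omega> * C * E n"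
      using shift_approx[OF n] by (simp add: E_def)
    also have "\<dots> \<le> 2 * \<omega> * C * (min (E n) (r n / a n) * max 1 (A n))"
      using \<omega>_pos C_nonneg by (intro mult_left_mono E_le) auto
    finally show "norm (shift n - (\<omega> / sqrt 2) * ((real n - 1) / n) * A n * gg n)
        \<le> 2 * \<omega> * C * (min (E n) (r n / a n) * max 1 (A n))" by simp
  qed
  moreover have "(\<lambda>n. (\<omega> / sqrt 2) * ((real n - 1) / n) * A n * gg n) \<longlonglongrightarrow> \<omega> / sqrt 2 * 1 * \<gamma> * G2"
    by (intro tendsto_mult tendsto_const pred_ratio_limit A gg_limit)
  ultimately have "(\<lambda>n. (shift n - (\<omega> / sqrt 2) * ((real n - 1) / n) * A n * gg n)
      + (\<omega> / sqrt 2) * ((real n - 1) / n) * A n * gg n) \<longlonglongrightarrow> 0 + \<omega> / sqrt 2 * 1 * \<gamma> * G2"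
    by (rule tendsto_add)
  then show ?thesis by simp
qed

lemma shift_ratio_limit:
  assumes A: "filterlim A at_top sequentially"
  shows "(\<lambda>n. shift n / A n) \<longlonglongrightarrow> \<omega> / sqrt 2 * G2"
proof -
  have A1: "\<forall>\<^sub>F n in sequentially. 1 \<le> A n"
    using A by (simp add: filterlim_at_top)
  have lim0: "(\<lambda>n. 2 * \<omega> * C * min (E n) (r n / a n)) \<longlonglongrightarrow> 0"
    by (intro tendsto_mult_right_zero min_cond)
  have "(\<lambda>n. shift n / A n - (\<omega> / sqrt 2) * ((real n - 1) / n) * gg n) \<longlonglongrightarrow> 0"
  proof (rule Lim_null_comparison[OF _ lim0])
    show "\<forall>\<^sub>F n in sequentially. norm (shift n / A n - (\<omega> / sqrt 2) * ((real n - 1) / n) * gg n)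
        \<le> 2 * \<omega> * C * min (E n) (r n / a n)"
      using A1 eventually_ge_at_top[of 1]
    proof eventually_elim
      case (elim n)
      then have n: "n > 0" "A n > 0" "max 1 (A n) = A n" by auto
      have "\<bar>shift n - (\<omega> / sqrt 2) * ((real n - 1) / n) * A n * gg n\<bar> \<le> 2 * \<omega> * C * E n"
        using shift_approx[OF n(1)] by (simp add: E_def)
      also have "\<dots> \<le> 2 * \<omega> * C * (min (E n) (r n / a n) * A n)"
        using \<omega>_pos C_nonneg E_le[of n] unfolding n(3) by (intro mult_left_mono) auto
      finally have "\<bar>shift n - (\<omega> / sqrt 2) * ((real n - 1) / n) * A n * gg n\<bar> / A n
          \<le> 2 * \<omega> * C * min (E n) (r n / a n)"
        using n(2) by (simp add: pos_divide_le_eq mult_ac)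
      moreover have "shift n / A n - (\<omega> / sqrt 2) * ((real n - 1) / n) * gg n
          = (shift n - (\<omega> / sqrt 2) * ((real n - 1) / n) * A n * gg n) / A n"
        using n(2) by (simp add: diff_divide_distrib)
      ultimately show ?case using n(2) by (simp add: abs_divide)
    qed
  qed
  moreover have "(\<lambda>n. (\<omega> / sqrt 2) * ((real n - 1) / n) * gg n) \<longlonglongrightarrow> \<omega> / sqrt 2 * 1 * G2"
    by (intro tendsto_mult tendsto_const pred_ratio_limit gg_limit)
  ultimately have "(\<lambda>n. (shift n / A n - (\<omega> / sqrt 2) * ((real n - 1) / n) * gg n)
      + (\<omega> / sqrt 2) * ((real n - 1) / n) * gg n) \<longlonglongrightarrow> 0 + \<omega> / sqrt 2 * 1 * G2"
    by (rule tendsto_add)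
  then show ?thesis by simp
qed

lemma nrd_eq: "real n * r n powr d * (a n)\<^sup>2 = A n * r n powr (d / 2)"
proof -
  have "r n powr d = r n powr (d / 2) * r n powr (d / 2)" unfolding powr_add[symmetric] by simp
  then show ?thesis by (simp add: A_def)
qed

theorem bounded_perturbation_limit:
  assumes A: "A \<longlonglongrightarrow> \<gamma>" and b: "b \<longlonglongrightarrow> 0"
  shows "weak_conv_m (\<lambda>n. distr (sample_law n) borel (\<lambda>x. (Z n x + (shift n + b n))\<^sup>2))
    (shifted_normal_square (\<omega> / sqrt 2 * \<gamma> * G2))"
proof (rule weak_conv_shifted_square)
  have "(\<lambda>n. A n * r n powr (d / 2)) \<longlonglongrightarrow> \<gamma> * 0"
    by (intro tendsto_mult A r_powr_lim) (use d_pos in simp)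
  then show "(\<lambda>n. \<integral>x. iexp (t * Z n x) \<partial>sample_law n) \<longlonglongrightarrow> complex_of_real (exp (- (t\<^sup>2 / 2)))" for t
    by (intro char_Z_limit) (simp add: nrd_eq)
  show "(\<lambda>n. shift n + b n) \<longlonglongrightarrow> \<omega> / sqrt 2 * \<gamma> * G2"
    using tendsto_add[OF shift_limit[OF A] b] by simp
qed (rule prob_space_sample_law, rule Z_measurable)

text \<open>
  The shift grows like \<open>A\<close>, whereas the second moment of \<open>Z\<close> is at most of order \<open>1 + A n\<close>: here the linear
  part of the Hoeffding decomposition need not be negligible, but it is dominated by the shift.
\<close>
theorem large_perturbation_limit:
  assumes A: "filterlim A at_top sequentially" and b: "b \<longlonglongrightarrow> 0" and G2: "G2 > 0" and B: "B > 0"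
  shows "(\<lambda>n. measure (sample_law n) {x \<in> space (sample_law n). (Z n x + (shift n + b n))\<^sup>2 > B}) \<longlonglongrightarrow> 1"
proof -
  define s where "s n = shift n + b n" for n
  have inv_A: "(\<lambda>n. u / A n) \<longlonglongrightarrow> 0" for u
    by (rule tendsto_divide_0[OF tendsto_const filterlim_at_top_imp_at_infinity[OF A]])
  have A1: "\<forall>\<^sub>F n in sequentially. 1 \<le> A n"
    using A by (simp add: filterlim_at_top)
  have L: "\<omega> / sqrt 2 * G2 > 0" using \<omega>_pos G2 by simp
  have L': "\<omega> / sqrt 2 * G2 \<noteq> 0" "\<kappa>2 \<noteq> 0" using L \<kappa>_pos by auto
  have s_ratio: "(\<lambda>n. s n / A n) \<longlonglongrightarrow> \<omega> / sqrt 2 * G2"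
  proof -
    have "(\<lambda>n. b n * (1 / A n)) \<longlonglongrightarrow> 0 * 0" by (intro tendsto_mult b inv_A)
    then show ?thesis
      using tendsto_add[OF shift_ratio_limit[OF A]] by (fastforce simp: s_def add_divide_distrib)
  qed
  have s_top: "filterlim s at_top sequentially"
  proof -
    have "filterlim (\<lambda>n. s n / A n * A n) at_top sequentially"
      by (rule filterlim_tendsto_pos_mult_at_top[OF s_ratio L A])
    then show ?thesis
    proof (rule filterlim_mono_eventually[OF _ order_refl order_refl])
      show "\<forall>\<^sub>F n in sequentially. s n / A n * A n = s n"
        using A1 by eventually_elim auto
    qed
  qed
  define v where "v n = 4 * K + 4 * D * y n" for n
  have v_lim: "(\<lambda>n. v n / (s n)\<^sup>2) \<longlonglongrightarrow> 0"
  proof -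
    define x1 where "x1 n = real n * r n powr (d + 1)" for n
    define x2 where "x2 n = r n powr (d / 2)" for n
    have x: "x1 \<longlonglongrightarrow> 0" "x2 \<longlonglongrightarrow> 0"
      using nrd1 r_powr_lim[of "d / 2"] d_pos by (auto simp: x1_def[abs_def] x2_def[abs_def])
    have "(\<lambda>n. (4 * K / A n * (1 / A n) + 4 * D * (\<kappa>1\<^sup>2 / \<kappa>2 * (x1 n * (1 / A n) * (1 / A n) + x2 n * (1 / A n)))) / (s n / A n)\<^sup>2)
        \<longlonglongrightarrow> (0 * 0 + 4 * D * (\<kappa>1\<^sup>2 / \<kappa>2 * (0 * 0 * 0 + 0 * 0))) / (\<omega> / sqrt 2 * G2)\<^sup>2"
      by (intro tendsto_divide tendsto_power s_ratio tendsto_add tendsto_mult inv_A x tendsto_const) (use L' in simp_all)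
    then have lim: "(\<lambda>n. (4 * K / A n * (1 / A n) + 4 * D * (\<kappa>1\<^sup>2 / \<kappa>2 * (x1 n * (1 / A n) * (1 / A n) + x2 n * (1 / A n)))) / (s n / A n)\<^sup>2)
        \<longlonglongrightarrow> 0" by simp
    show ?thesis
    proof (rule Lim_transform_eventually[OF lim])
      show "\<forall>\<^sub>F n in sequentially. (4 * K / A n * (1 / A n) + 4 * D * (\<kappa>1\<^sup>2 / \<kappa>2 * (x1 n * (1 / A n) * (1 / A n) + x2 n * (1 / A n)))) / (s n / A n)\<^sup>2
          = v n / (s n)\<^sup>2"
        using A1
      proof eventually_elim
        case (elim n)
        define k where "k = \<kappa>1\<^sup>2 / \<kappa>2"
        have vn: "v n = 4 * K + 4 * D * (k * (x1 n + A n * x2 n))"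
          unfolding v_def y_eq nrd_eq x1_def x2_def k_def ..
        have "4 * K / A n * (1 / A n) + 4 * D * (k * (x1 n * (1 / A n) * (1 / A n) + x2 n * (1 / A n))) = v n / (A n)\<^sup>2"
          unfolding vn using elim by (simp add: field_simps power2_eq_square)
        then show ?case unfolding k_def using elim by (simp add: power_divide)
      qed
    qed
  qed
  have lower: "\<forall>\<^sub>F n in sequentially. 1 - 4 * (v n / (s n)\<^sup>2) \<le> measure (sample_law n) {x \<in> space (sample_law n). (Z n x + s n)\<^sup>2 > B}"
  proof -
    have "\<forall>\<^sub>F n in sequentially. 2 * sqrt B \<le> s n" using s_top by (simp add: filterlim_at_top)
    then show ?thesis using eventually_gt_at_top[of 0]
    proof eventually_elim
      case (elim n)
      interpret M: prob_space "sample_law n" by (rule prob_space_sample_law)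
      show ?case
        by (rule M.shifted_square_tail[OF Z_measurable _ _ B elim(1)])
          (use Z_second_moment[OF elim(2)] K_ge D_nonneg y_nonneg in \<open>auto simp: v_def\<close>)
    qed
  qed
  have upper: "\<forall>\<^sub>F n in sequentially. measure (sample_law n) {x \<in> space (sample_law n). (Z n x + s n)\<^sup>2 > B} \<le> 1"
    by (intro always_eventually allI prob_space.prob_le_1[OF prob_space_sample_law])
  have "(\<lambda>n. 1 - 4 * (v n / (s n)\<^sup>2)) \<longlonglongrightarrow> 1 - 4 * 0" by (intro tendsto_intros v_lim)
  then have "(\<lambda>n. 1 - 4 * (v n / (s n)\<^sup>2)) \<longlonglongrightarrow> 1" by simp
  from tendsto_sandwich[OF lower upper this tendsto_const] show ?thesis by (simp add: s_def)
qed

end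

end

section \<open>Reduction to Borel versions and product measures\<close>

lemma infdist_measurable [measurable]: "(\<lambda>x. infdist x A) \<in> borel_measurable borel"
  for A :: "'a::euclidean_space set"
  by (intro borel_measurable_continuous_onI continuous_intros)

text \<open>
  The null sets on which \<open>W\<close> and \<open>g\<close> differ from Borel objects are removed from the window.  Because \<open>V\<close>
  is a subset of \<open>W\<close>, every pointwise condition on \<open>W\<close> survives.
\<close>
lemma borel_version:
  fixes g :: "'a::euclidean_space \<Rightarrow> real"
  assumes W: "W \<in> sets lebesgue" and g: "g \<in> borel_measurable (lebesgue_on W)"
  obtains V g0 where "V \<in> sets borel" "V \<subseteq> W" "AE x in lborel. x \<in> W \<longleftrightarrow> x \<in> V"
    "g0 \<in> borel_measurable borel" "\<And>x. x \<in> V \<Longrightarrow> g0 x = g x" "\<And>x. x \<notin> V \<Longrightarrow> g0 x = (0::real)"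
proof -
  obtain S N N' where SN: "W = S \<union> N" "N \<subseteq> N'" "N' \<in> null_sets lborel" "S \<in> sets lborel"
    using sets_completionE[OF W] by blast
  have "(\<lambda>x. indicator W x * g x) \<in> borel_measurable lebesgue"
    using g W by (simp add: borel_measurable_restrict_space_iff)
  then obtain g' where g': "g' \<in> borel_measurable lborel" "AE x in lborel. indicator W x * g x = g' x"
    using completion_ex_borel_measurable_real by blast
  obtain Z where Z: "{x \<in> space lborel. \<not> indicator W x * g x = g' x} \<subseteq> Z" "Z \<in> null_sets lborel"
    using g'(2) unfolding eventually_ae_filter by blast
  define V where "V = S - Z"
  define g0 where "g0 x = indicator V x * g' x" for x
  have V: "V \<in> sets borel" using SN(4) Z(2) by (auto simp: V_def null_sets_def)
  show ?thesis
  proof (rule that[of V g0])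
    show "V \<in> sets borel" by (rule V)
    show "V \<subseteq> W" using SN(1) by (auto simp: V_def)
    have "AE x in lborel. x \<notin> N' \<union> Z" by (rule AE_not_in) (use SN(3) Z(2) in auto)
    then show "AE x in lborel. x \<in> W \<longleftrightarrow> x \<in> V"
      by eventually_elim (use SN(1,2) in \<open>auto simp: V_def\<close>)
    show "g0 \<in> borel_measurable borel" unfolding g0_def using V g'(1) by measurable
    show "g0 x = g x" if "x \<in> V" for x
    proof -
      have "x \<in> W" "x \<notin> Z" using that SN(1) by (auto simp: V_def)
      then have "x \<notin> {x \<in> space lborel. \<not> indicator W x * g x = g' x}" using Z(1) by blast
      then have "indicator W x * g x = g' x" by simp
      then show ?thesis using that \<open>x \<in> W\<close> by (simp add: g0_def)
    qed
    show "g0 x = 0" if "x \<notin> V" for x using that by (simp add: g0_def)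
  qed
qed

lemma nn_integral_lebesgue_on_borel:
  assumes W: "W \<in> sets lebesgue" and V: "AE x in lborel. x \<in> W \<longleftrightarrow> x \<in> V"
  shows "(\<integral>\<^sup>+x. F x \<partial>lebesgue_on W) = (\<integral>\<^sup>+x. F x * indicator V x \<partial>lborel)"
proof -
  have "(\<integral>\<^sup>+x. F x \<partial>lebesgue_on W) = (\<integral>\<^sup>+x. F x * indicator W x \<partial>lebesgue)"
    using W by (simp add: nn_integral_restrict_space)
  also have "\<dots> = (\<integral>\<^sup>+x. F x * indicator W x \<partial>lborel)" by (rule nn_integral_completion)
  also have "\<dots> = (\<integral>\<^sup>+x. F x * indicator V x \<partial>lborel)"
    using V by (intro nn_integral_cong_AE) (auto simp: indicator_def)
  finally show ?thesis .
qed

lemma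
  fixes F F0 :: "'a::euclidean_space \<Rightarrow> real"
  assumes W: "W \<in> sets lebesgue" and V: "AE x in lborel. x \<in> W \<longleftrightarrow> x \<in> V" "V \<in> sets borel"
    and F: "F \<in> borel_measurable (lebesgue_on W)" and F0: "F0 \<in> borel_measurable borel"
    and eq: "\<And>x. x \<in> V \<Longrightarrow> F0 x = F x" and out: "\<And>x. x \<notin> V \<Longrightarrow> F0 x = 0"
  shows integral_lebesgue_on_borel: "(\<integral>x. F x \<partial>lebesgue_on W) = (\<integral>x. F0 x \<partial>lborel)"
    and integrable_lebesgue_on_borel: "integrable (lebesgue_on W) F \<longleftrightarrow> integrable lborel F0"
proof -
  have m1: "(\<lambda>x. indicator W x *\<^sub>R F x) \<in> borel_measurable lebesgue"
    using F W by (subst (asm) borel_measurable_restrict_space_iff) auto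
  have m0: "F0 \<in> borel_measurable lborel" using F0 by simp
  have m2: "F0 \<in> borel_measurable lebesgue" by (rule measurable_completion[OF m0])
  have ae: "AE x in lebesgue. indicator W x *\<^sub>R F x = F0 x"
    by (rule AE_completion) (use V(1) in eventually_elim, use eq out in \<open>auto simp: indicator_def\<close>)
  have "(\<integral>x. F x \<partial>lebesgue_on W) = (\<integral>x. indicator W x *\<^sub>R F x \<partial>lebesgue)"
    using W by (intro integral_restrict_space) auto
  also have "\<dots> = (\<integral>x. F0 x \<partial>lebesgue)" by (rule integral_cong_AE[OF m1 m2 ae])
  also have "\<dots> = (\<integral>x. F0 x \<partial>lborel)" by (rule integral_completion[OF m0])
  finally show "(\<integral>x. F x \<partial>lebesgue_on W) = (\<integral>x. F0 x \<partial>lborel)" .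
  have "integrable (lebesgue_on W) F \<longleftrightarrow> integrable lebesgue (\<lambda>x. indicator W x *\<^sub>R F x)"
    using W by (intro integrable_restrict_space) auto
  also have "\<dots> \<longleftrightarrow> integrable lebesgue F0" by (rule integrable_cong_AE[OF m1 m2 ae])
  also have "\<dots> \<longleftrightarrow> integrable lborel F0" by (rule integrable_completion[OF m0])
  finally show "integrable (lebesgue_on W) F \<longleftrightarrow> integrable lborel F0" .
qed

lemma borel_measurable_lebesgue_on: "F \<in> borel_measurable borel \<Longrightarrow> F \<in> borel_measurable (lebesgue_on W)"
  for F :: "'a::euclidean_space \<Rightarrow> 'b::topological_space"
  by (rule measurable_restrict_space1) (rule measurable_completion, simp)

lemma integral_edge_kernel:
  fixes W V :: "'a::euclidean_space set"
  assumes W: "W \<in> sets lebesgue" "emeasure lebesgue W = 1" and V: "AE x in lborel. x \<in> W \<longleftrightarrow> x \<in> V" "V \<in> sets borel"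
  shows "(\<integral>p. edge_kernel \<beta> \<rho> (fst p) (snd p) \<partial>(lebesgue_on W \<Otimes>\<^sub>M lebesgue_on W))
    = form (power_kernel \<beta> \<rho>) (indicator V) (indicator V)"
proof -
  define k :: "'a \<Rightarrow> real" where "k = power_kernel \<beta> \<rho>"
  have [measurable]: "k \<in> borel_measurable borel" unfolding k_def by measurable
  note [measurable] = V(2)
  have k: "edge_kernel \<beta> \<rho> x y = k (x - y)" for x y :: 'a by (simp add: k_def edge_kernel_def power_kernel_def)
  have nonneg: "k z \<ge> 0" for z by (simp add: k_def power_kernel_nonneg)
  interpret L: finite_measure "lebesgue_on W"
    using W by (intro finite_measureI) (simp add: emeasure_restrict_space space_restrict_space)
  have meas: "(\<lambda>p. k (fst p - snd p)) \<in> borel_measurable (lebesgue_on W \<Otimes>\<^sub>M lebesgue_on W)"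
  proof -
    have "(\<lambda>x. x) \<in> measurable (lebesgue_on W) (borel :: 'a measure)" by (rule borel_measurable_lebesgue_on) simp
    then have [measurable]: "fst \<in> borel_measurable (lebesgue_on W \<Otimes>\<^sub>M lebesgue_on W)"
      "snd \<in> borel_measurable (lebesgue_on W \<Otimes>\<^sub>M lebesgue_on W)"
      using measurable_compose[OF measurable_fst, of "\<lambda>x. x"] measurable_compose[OF measurable_snd, of "\<lambda>x. x"] by auto
    show ?thesis by measurable
  qed
  have "(\<integral>\<^sup>+p. ennreal (k (fst p - snd p)) \<partial>(lebesgue_on W \<Otimes>\<^sub>M lebesgue_on W))
      = (\<integral>\<^sup>+x. \<integral>\<^sup>+y. ennreal (k (x - y)) \<partial>lebesgue_on W \<partial>lebesgue_on W)"
    by (subst L.nn_integral_fst[symmetric]) (use meas in auto)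
  also have "\<dots> = (\<integral>\<^sup>+x. (\<integral>\<^sup>+y. ennreal (k (x - y)) * indicator V y \<partial>lborel) * indicator V x \<partial>lborel)"
    by (simp only: nn_integral_lebesgue_on_borel[OF W(1) V(1)])
  also have "\<dots> = (\<integral>\<^sup>+x. \<integral>\<^sup>+y. ennreal (k (x - y) * (indicator V x * indicator V y)) \<partial>lborel \<partial>lborel)"
  proof (intro nn_integral_cong)
    fix x
    show "(\<integral>\<^sup>+y. ennreal (k (x - y)) * indicator V y \<partial>lborel) * indicator V x
        = (\<integral>\<^sup>+y. ennreal (k (x - y) * (indicator V x * indicator V y)) \<partial>lborel)"
      by (subst nn_integral_multc[symmetric]) (auto intro!: nn_integral_cong simp: indicator_def)
  qed
  also have "\<dots> = (\<integral>\<^sup>+p. ennreal (k (fst p - snd p) * (indicator V (fst p) * indicator V (snd p))) \<partial>(lborel \<Otimes>\<^sub>M lborel))"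
    by (subst lborel.nn_integral_fst[symmetric]) auto
  finally have nn: "(\<integral>\<^sup>+p. ennreal (k (fst p - snd p)) \<partial>(lebesgue_on W \<Otimes>\<^sub>M lebesgue_on W))
      = (\<integral>\<^sup>+p. ennreal (k (fst p - snd p) * (indicator V (fst p) * indicator V (snd p))) \<partial>(lborel \<Otimes>\<^sub>M lborel))" .
  have "(\<integral>p. k (fst p - snd p) \<partial>(lebesgue_on W \<Otimes>\<^sub>M lebesgue_on W))
      = enn2real (\<integral>\<^sup>+p. ennreal (k (fst p - snd p)) \<partial>(lebesgue_on W \<Otimes>\<^sub>M lebesgue_on W))"
    by (rule integral_eq_nn_integral) (use meas nonneg in auto)
  also have "\<dots> = form k (indicator V) (indicator V)"
    unfolding nn form_def by (rule integral_eq_nn_integral[symmetric]) (use nonneg in auto)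
  finally show ?thesis by (simp add: k k_def[symmetric])
qed

text \<open>A ball is connected, so it meets the frontier if it meets both \<open>W\<close> and its complement.\<close>
lemma cball_subset_of_infdist_frontier:
  fixes W :: "'a::euclidean_space set"
  assumes x: "x \<in> W" and far: "infdist x (frontier W) > \<rho>"
  shows "cball x \<rho> \<subseteq> W"
proof (rule ccontr)
  assume "\<not> cball x \<rho> \<subseteq> W"
  then have ne: "cball x \<rho> - W \<noteq> {}" by blast
  then have "\<rho> \<ge> 0" using cball_eq_empty[of x \<rho>] by force
  then have "x \<in> cball x \<rho> \<inter> W" using x by simp
  then have "cball x \<rho> \<inter> frontier W \<noteq> {}"
    using connected_Int_frontier[OF connected_cball _ ne] by blast
  then obtain y where "y \<in> frontier W" "dist x y \<le> \<rho>" by auto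
  then show False using infdist_le[of y "frontier W" x] far by simp
qed

text \<open>Small radii are covered by the limes superior, all others by the finite volume of \<open>W\<close>.\<close>
lemma boundary_layer_constant:
  fixes W :: "'a::euclidean_space set"
  assumes W: "W \<in> sets lebesgue" and vol: "emeasure lebesgue W = 1"
    and boundary: "Limsup (at_right 0)
           (\<lambda>\<rho>. ereal (measure lebesgue {x \<in> W. infdist x (frontier W) \<le> \<rho>} / \<rho>)) < \<infinity>"
  obtains C where "C \<ge> 0" "\<And>\<rho>. \<rho> > 0 \<Longrightarrow> measure lebesgue {x \<in> W. infdist x (frontier W) \<le> \<rho>} \<le> C * \<rho>"
proof -
  define m where "m \<rho> = measure lebesgue {x \<in> W. infdist x (frontier W) \<le> \<rho>}" for \<rho>
  have layer_subset: "{x \<in> W. infdist x (frontier W) \<le> \<rho>} \<subseteq> W" for \<rho> by auto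
  have m_le: "m \<rho> \<le> 1" for \<rho>
  proof -
    have "{x. infdist x (frontier W) \<le> \<rho>} \<in> sets lebesgue"
      by (intro sets_completionI_sets) measurable
    from sets.Int[OF W this] have "{x \<in> W. infdist x (frontier W) \<le> \<rho>} \<in> sets lebesgue"
      by (simp add: Int_def)
    then have "m \<rho> \<le> measure lebesgue W"
      unfolding m_def by (intro measure_mono_fmeasurable layer_subset) (use W vol in \<open>auto simp: fmeasurable_def\<close>)
    then show ?thesis using vol by (simp add: measure_def)
  qed
  obtain N :: nat where "Limsup (at_right 0) (\<lambda>\<rho>. ereal (m \<rho> / \<rho>)) < ereal (real N)"
    using boundary less_PInf_Ex_of_nat unfolding m_def by force
  from Limsup_lessD[OF this] obtain b where b: "b > 0" "\<And>\<rho>. 0 < \<rho> \<Longrightarrow> \<rho> < b \<Longrightarrow> m \<rho> / \<rho> < real N"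
    unfolding eventually_at_right_field by auto
  have layer: "m \<rho> \<le> max (real N) (1 / b) * \<rho>" if \<rho>: "\<rho> > 0" for \<rho>
    proof (cases "\<rho> < b")
      case True
      then have "m \<rho> \<le> real N * \<rho>" using b(2)[OF \<rho> True] \<rho> by (simp add: field_simps)
      also have "\<dots> \<le> max (real N) (1 / b) * \<rho>" using \<rho> by (intro mult_right_mono) auto
      finally show ?thesis .
    next
      case False
      have "1 \<le> 1 / b * \<rho>" using False b(1) by (simp add: field_simps)
      then have "m \<rho> \<le> 1 / b * \<rho>" using m_le[of \<rho>] by linarith
      also have "\<dots> \<le> max (real N) (1 / b) * \<rho>" using \<rho> by (intro mult_right_mono) auto
      finally show ?thesis .
    qed
  show ?thesis
    by (rule that[OF _ layer[unfolded m_def]]) (use b in auto)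
qed

lemma window_borel_version:
  fixes W V :: "'a::euclidean_space set" and g g0 :: "'a \<Rightarrow> real"
  assumes W: "W \<in> sets lebesgue" and vol: "emeasure lebesgue W = 1"
    and g: "g \<in> borel_measurable (lebesgue_on W)" and g3: "integrable (lebesgue_on W) (\<lambda>x. \<bar>g x\<bar> ^ 3)"
    and g1: "(\<integral>x. g x \<partial>lebesgue_on W) = 0"
    and C: "C \<ge> 0" "\<And>\<rho>. \<rho> > 0 \<Longrightarrow> measure lebesgue {x \<in> W. infdist x (frontier W) \<le> \<rho>} \<le> C * \<rho>"
      "\<And>\<rho>. \<rho> > 0 \<Longrightarrow> (\<integral>x. of_bool (infdist x (frontier W) \<le> \<rho>) * \<bar>g x\<bar> \<partial>lebesgue_on W) \<le> C * \<rho>"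
    and V: "V \<in> sets borel" "V \<subseteq> W" "AE x in lborel. x \<in> W \<longleftrightarrow> x \<in> V"
    and g0: "g0 \<in> borel_measurable borel" "\<And>x. x \<in> V \<Longrightarrow> g0 x = g x" "\<And>x. x \<notin> V \<Longrightarrow> g0 x = 0"
  shows "window (indicator V) g0 (\<lambda>\<rho> x. of_bool (infdist x (frontier W) \<le> \<rho>)) C"
proof unfold_locales
  note [measurable] = V(1) g0(1)
  have near[measurable]: "(\<lambda>x. of_bool (infdist x (frontier W) \<le> \<rho>) :: real) \<in> borel_measurable borel" for \<rho>
    by measurable
  have gm: "(\<lambda>x. of_bool (infdist x (frontier W) \<le> \<rho>) * \<bar>g x\<bar>) \<in> borel_measurable (lebesgue_on W)" for \<rho>
    using g borel_measurable_lebesgue_on[OF near[of \<rho>]] by measurable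
  have VW: "emeasure lborel V = 1"
  proof -
    have "emeasure lborel V = (\<integral>\<^sup>+x. 1 * indicator V x \<partial>lborel)" by simp
    also have "\<dots> = (\<integral>\<^sup>+x. 1 \<partial>lebesgue_on W)" by (rule nn_integral_lebesgue_on_borel[OF W V(3), symmetric])
    also have "\<dots> = 1" using W vol by (simp add: emeasure_restrict_space space_restrict_space)
    finally show ?thesis .
  qed
  show "(indicator V :: 'a \<Rightarrow> real) \<in> borel_measurable borel" by measurable
  show "indicator V x = (0::real) \<or> indicator V x = (1::real)" for x by (auto simp: indicator_def)
  show "integrable lborel (indicator V :: 'a \<Rightarrow> real)" using VW by (simp add: integrable_indicator_iff)
  show "(\<integral>x. indicator V x \<partial>lborel) = (1::real)" using VW by (simp add: measure_def)
  show "g0 \<in> borel_measurable borel" by (rule g0)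
  show "indicator V x = (0::real) \<Longrightarrow> g0 x = 0" for x using g0(3)[of x] by (auto simp: indicator_def split: if_splits)
  show "integrable lborel (\<lambda>x. \<bar>g0 x\<bar>^3)"
    by (rule integrable_lebesgue_on_borel[OF W V(3) V(1), THEN iffD1, rotated 4, OF g3])
      (use g g0 in auto)
  show "(\<integral>x. g0 x \<partial>lborel) = 0"
    using integral_lebesgue_on_borel[OF W V(3) V(1) g g0] g1 by simp
  show "(\<lambda>x. of_bool (infdist x (frontier W) \<le> \<rho>) :: real) \<in> borel_measurable borel" for \<rho> by (rule near)
  show "of_bool (infdist x (frontier W) \<le> \<rho>) = (0::real) \<or> of_bool (infdist x (frontier W) \<le> \<rho>) = (1::real)" for \<rho> x
    by simp
  show "AE y in lborel. norm (x - y) \<le> \<rho> \<longrightarrow> indicator V y = (1::real)"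
    if "indicator V x = (1::real)" "of_bool (infdist x (frontier W) \<le> \<rho>) = (0::real)" for \<rho> x
  proof -
    have "x \<in> W" using that(1) V(2) by (auto simp: indicator_def split: if_splits)
    moreover have "infdist x (frontier W) > \<rho>" using that(2) by simp
    ultimately have sub: "cball x \<rho> \<subseteq> W" by (rule cball_subset_of_infdist_frontier)
    show ?thesis using V(3) by eventually_elim (use sub in \<open>auto simp: dist_norm subset_iff\<close>)
  qed
  show "C \<ge> 0" by (rule C)
  show "(\<integral>x. of_bool (infdist x (frontier W) \<le> \<rho>) * indicator V x \<partial>lborel) \<le> C * \<rho>" if \<rho>: "\<rho> > 0" for \<rho>
  proof -
    have s: "{x. infdist x (frontier W) \<le> \<rho>} \<in> sets borel" by measurable
    have W': "{x \<in> W. infdist x (frontier W) \<le> \<rho>} \<in> sets lebesgue"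
      using sets.Int[OF W sets_completionI_sets[of _ lborel, simplified, OF s]] by (simp add: Collect_conj_eq Int_commute)
    have "(\<integral>x. of_bool (infdist x (frontier W) \<le> \<rho>) * indicat_real V x \<partial>lborel)
        = (\<integral>x. indicator {x \<in> V. infdist x (frontier W) \<le> \<rho>} x \<partial>lborel)"
      by (intro Bochner_Integration.integral_cong) (auto simp: indicator_def)
    also have "\<dots> = measure lebesgue {x \<in> V. infdist x (frontier W) \<le> \<rho>}"
    proof -
      have "{x \<in> V. infdist x (frontier W) \<le> \<rho>} \<in> sets borel" by measurable
      then show ?thesis by simp
    qed
    also have "\<dots> \<le> measure lebesgue {x \<in> W. infdist x (frontier W) \<le> \<rho>}"
    proof (rule measure_mono_fmeasurable)
      show "{x \<in> V. infdist x (frontier W) \<le> \<rho>} \<in> sets lebesgue"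
        by (intro sets_completionI_sets) measurable
      show "{x \<in> W. infdist x (frontier W) \<le> \<rho>} \<in> fmeasurable lebesgue"
        by (rule fmeasurableI2[OF _ _ W', of W]) (use W vol in \<open>auto simp: fmeasurable_def\<close>)
    qed (use V(2) in auto)
    also have "\<dots> \<le> C * \<rho>" by (rule C(2)[OF \<rho>])
    finally show ?thesis .
  qed
  show "(\<integral>x. of_bool (infdist x (frontier W) \<le> \<rho>) * \<bar>g0 x\<bar> \<partial>lborel) \<le> C * \<rho>" if \<rho>: "\<rho> > 0" for \<rho>
    using integral_lebesgue_on_borel[OF W V(3) V(1) gm[of \<rho>], of "\<lambda>x. of_bool (infdist x (frontier W) \<le> \<rho>) * \<bar>g0 x\<bar>"]
      C(3)[OF \<rho>] g0 by simp
qed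

lemma has_lebesgue_density_distr:
  fixes X :: "'s \<Rightarrow> 'a::euclidean_space"
  assumes dens: "has_lebesgue_density M X (\<lambda>x. indicator W x * (1 + b * g x))"
    and V: "AE x in lborel. x \<in> W \<longleftrightarrow> x \<in> V" "V \<in> sets borel"
    and g0: "g0 \<in> borel_measurable borel" "\<And>x. x \<in> V \<Longrightarrow> g0 x = g x" "\<And>x. x \<notin> V \<Longrightarrow> g0 x = 0"
  shows "distr M borel X = density lborel (\<lambda>x. ennreal (indicator V x + b * g0 x))"
proof (rule measure_eqI)
  fix A assume "A \<in> sets (distr M borel X)"
  then have A: "A \<in> sets borel" by simp
  note [measurable] = A g0(1) V(2)
  have X: "X \<in> borel_measurable M" using dens by (simp add: has_lebesgue_density_def)
  have "emeasure (distr M borel X) A = emeasure M (X -` A \<inter> space M)"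
    by (rule emeasure_distr[OF X A])
  also have "\<dots> = (\<integral>\<^sup>+x\<in>A. ennreal (indicator W x * (1 + b * g x)) \<partial>lebesgue)"
    using dens A by (simp add: has_lebesgue_density_def)
  also have "\<dots> = (\<integral>\<^sup>+x\<in>A. ennreal (indicator W x * (1 + b * g x)) \<partial>lborel)" by (rule nn_integral_completion)
  also have "\<dots> = (\<integral>\<^sup>+x\<in>A. ennreal (indicator V x + b * g0 x) \<partial>lborel)"
    by (rule nn_integral_cong_AE, use V(1) in eventually_elim) (use g0(2,3) in \<open>auto simp: indicator_def\<close>)
  also have "\<dots> = emeasure (density lborel (\<lambda>x. ennreal (indicator V x + b * g0 x))) A"
    using A by (subst emeasure_density) auto
  finally show "emeasure (distr M borel X) A = emeasure (density lborel (\<lambda>x. ennreal (indicator V x + b * g0 x))) A" .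
qed simp

text \<open>Laws of statistics may be computed on the canonical product space.\<close>
lemma iid_sample_distr:
  fixes X :: "'i \<Rightarrow> 's \<Rightarrow> 'a::euclidean_space"
  assumes M: "prob_space M" and I: "I \<noteq> {}"
    and indep: "prob_space.indep_vars M (\<lambda>_. borel) X I"
    and law: "\<And>i. i \<in> I \<Longrightarrow> distr M borel (X i) = N" and N: "sets N = sets borel"
    and T: "T \<in> borel_measurable (Pi\<^sub>M I (\<lambda>_. N))" "\<And>x. T (restrict x I) = T x"
  shows "distr M borel (\<lambda>\<omega>. T (\<lambda>i. X i \<omega>)) = distr (Pi\<^sub>M I (\<lambda>_. N)) borel T"
    and "(\<lambda>\<omega>. T (\<lambda>i. X i \<omega>)) \<in> borel_measurable M"
proof -
  interpret M: prob_space M by fact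
  have X: "X i \<in> borel_measurable M" if "i \<in> I" for i
    using indep that by (simp add: M.indep_vars_def)
  define R where "R \<omega> = (\<lambda>i\<in>I. X i \<omega>)" for \<omega>
  have sets_eq: "sets (Pi\<^sub>M I (\<lambda>_. N)) = sets (Pi\<^sub>M I (\<lambda>_. borel))" by (rule sets_PiM_cong) (auto simp: N)
  have R: "R \<in> measurable M (Pi\<^sub>M I (\<lambda>_. borel))" unfolding R_def by (rule measurable_restrict) (rule X)
  have R': "R \<in> measurable M (Pi\<^sub>M I (\<lambda>_. N))" using R by (simp add: measurable_cong_sets[OF refl sets_eq])
  have "distr M (Pi\<^sub>M I (\<lambda>_. borel)) R = Pi\<^sub>M I (\<lambda>i. distr M borel (X i))"
    using M.indep_vars_iff_distr_eq_PiM'[OF I, where M' = "\<lambda>_. borel" and X = X] X indep by (simp add: R_def[abs_def])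
  also have "\<dots> = Pi\<^sub>M I (\<lambda>_. N)" by (rule PiM_cong) (auto simp: law)
  finally have "distr M (Pi\<^sub>M I (\<lambda>_. N)) R = Pi\<^sub>M I (\<lambda>_. N)"
    by (metis distr_cong sets_eq)
  then have "distr (Pi\<^sub>M I (\<lambda>_. N)) borel T = distr M borel (T \<circ> R)"
    using distr_distr[OF T(1) R'] by simp
  also have "T \<circ> R = (\<lambda>\<omega>. T (\<lambda>i. X i \<omega>))"
    using T(2) by (auto simp: fun_eq_iff R_def)
  finally show "distr M borel (\<lambda>\<omega>. T (\<lambda>i. X i \<omega>)) = distr (Pi\<^sub>M I (\<lambda>_. N)) borel T" ..
  have "(\<lambda>\<omega>. T (R \<omega>)) \<in> borel_measurable M" by (rule measurable_compose[OF R' T(1)])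
  then show "(\<lambda>\<omega>. T (\<lambda>i. X i \<omega>)) \<in> borel_measurable M" using T(2) by (simp add: R_def)
qed

lemma measure_exceeds_distr:
  fixes Y :: "'b \<Rightarrow> real"
  assumes Y: "Y \<in> borel_measurable L"
  shows "measure L {x \<in> space L. Y x > B} = measure (distr L borel Y) {B<..}"
proof -
  have "{x \<in> space L. Y x > B} = Y -` {B<..} \<inter> space L" by auto
  then show ?thesis by (simp add: measure_distr[OF Y])
qed

lemma weak_conv_m_eventually_cong:
  assumes "weak_conv_m L N" "\<forall>\<^sub>F n in sequentially. L n = L' n"
  shows "weak_conv_m L' N"
  unfolding weak_conv_m_def weak_conv_def
proof (intro allI impI)
  fix x assume "isCont (cdf N) x"
  then have "(\<lambda>n. cdf (L n) x) \<longlonglongrightarrow> cdf N x" using assms(1) by (simp add: weak_conv_m_def weak_conv_def)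
  then show "(\<lambda>n. cdf (L' n) x) \<longlonglongrightarrow> cdf N x"
    by (rule Lim_transform_eventually) (use assms(2) in eventually_elim, simp)
qed

section \<open>Limit theorem for the test statistics\<close>

lemma pair_sum_restrict: "pair_sum h I (restrict x I) = pair_sum h I x"
  unfolding pair_sum_def by (intro arg_cong[where f = "\<lambda>s. 1/2 * s"] sum.cong) auto

theorem theorem4p1:
  fixes W :: "'a::euclidean_space set" and g :: "'a \<Rightarrow> real"
    and r a :: "nat \<Rightarrow> real" and \<beta> :: real
    and M :: "nat \<Rightarrow> 's measure" and X :: "nat \<Rightarrow> nat \<Rightarrow> 's \<Rightarrow> 'a"
  assumes W_meas: "W \<in> sets lebesgue" and W_vol: "emeasure lebesgue W = 1"
    and r_pos: "\<And>n. n \<ge> 1 \<Longrightarrow> r n > 0" and r_lim: "r \<longlonglongrightarrow> 0"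
    and g_meas: "g \<in> borel_measurable (lebesgue_on W)"
    and g_L3: "integrable (lebesgue_on W) (\<lambda>x. \<bar>g x\<bar> ^ 3)"
    and g_nonzero: "\<not> (AE x in lebesgue_on W. g x = 0)"
    and g_int: "(\<integral>x. g x \<partial>lebesgue_on W) = 0"
    and a_pos: "\<And>n. n \<ge> 1 \<Longrightarrow> a n > 0" and a_lim: "a \<longlonglongrightarrow> 0"
    and dens_nonneg: "\<And>n x. n \<ge> 1 \<Longrightarrow> x \<in> W \<Longrightarrow> 1 + a n * g x \<ge> 0"
    and prob: "\<And>n. n \<ge> 1 \<Longrightarrow> prob_space (M n)"
    and indep: "\<And>n. n \<ge> 1 \<Longrightarrow> prob_space.indep_vars (M n) (\<lambda>_. borel) (X n) {1..n}"
    and dens: "\<And>n i. n \<ge> 1 \<Longrightarrow> i \<in> {1..n} \<Longrightarrow>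
           has_lebesgue_density (M n) (X n i) (\<lambda>x. indicator W x * (1 + a n * g x))"
    and beta: "\<beta> > - real DIM('a) / 2"
    and boundary: "Limsup (at_right 0)
           (\<lambda>\<rho>. ereal (measure lebesgue {x \<in> W. infdist x (frontier W) \<le> \<rho>} / \<rho>)) < \<infinity>"
    and n2rd: "filterlim (\<lambda>n. (real n)\<^sup>2 * r n ^ DIM('a)) at_top sequentially"
    and nrd1: "(\<lambda>n. real n * r n ^ (DIM('a) + 1)) \<longlonglongrightarrow> 0"
    and min_cond: "(\<lambda>n. min (real n * r n powr (real DIM('a) / 2 + 1) * a n) (r n / a n)) \<longlonglongrightarrow> 0"
    and g_boundary: "\<exists>C>0. \<forall>\<rho>>0.
           (\<integral>x. of_bool (infdist x (frontier W) \<le> \<rho>) * \<bar>g x\<bar> \<partial>lebesgue_on W) \<le> C * \<rho>"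
  shows "((\<forall>\<gamma>\<ge>0. (\<lambda>n. real n * r n powr (real DIM('a) / 2) * (a n)\<^sup>2) \<longlonglongrightarrow> \<gamma> \<longrightarrow>
           weak_conv_m
             (\<lambda>n. distr (M n) borel (\<lambda>\<omega>. T_exact W \<beta> (r n) n (\<lambda>i. X n i \<omega>)))
             (shifted_normal_square
               (sqrt (real DIM('a) * unit_ball_vol (real DIM('a)) * (2 * \<beta> + real DIM('a)))
                  / (sqrt 2 * (\<beta> + real DIM('a)))
                  * \<gamma> * (\<integral>x. (g x)\<^sup>2 \<partial>lebesgue_on W)))) \<and>
         (filterlim (\<lambda>n. real n * r n powr (real DIM('a) / 2) * (a n)\<^sup>2) at_top sequentially \<longrightarrow>
           tends_to_infinity_in_prob M (\<lambda>n \<omega>. T_exact W \<beta> (r n) n (\<lambda>i. X n i \<omega>)))) \<and>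
     ((\<lambda>n. (real n)\<^sup>2 * r n ^ (DIM('a) + 2)) \<longlonglongrightarrow> 0 \<longrightarrow>
        ((\<forall>\<gamma>\<ge>0. (\<lambda>n. real n * r n powr (real DIM('a) / 2) * (a n)\<^sup>2) \<longlonglongrightarrow> \<gamma> \<longrightarrow>
           weak_conv_m
             (\<lambda>n. distr (M n) borel (\<lambda>\<omega>. T_approx \<beta> (r n) n (\<lambda>i. X n i \<omega>)))
             (shifted_normal_square
               (sqrt (real DIM('a) * unit_ball_vol (real DIM('a)) * (2 * \<beta> + real DIM('a)))
                  / (sqrt 2 * (\<beta> + real DIM('a)))
                  * \<gamma> * (\<integral>x. (g x)\<^sup>2 \<partial>lebesgue_on W)))) \<and>
         (filterlim (\<lambda>n. real n * r n powr (real DIM('a) / 2) * (a n)\<^sup>2) at_top sequentially \<longrightarrow>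
           tends_to_infinity_in_prob M (\<lambda>n \<omega>. T_approx \<beta> (r n) n (\<lambda>i. X n i \<omega>)))))"
proof -
  define d where "d = real DIM('a)"
  define near where "near \<rho> x = (of_bool (infdist x (frontier W) \<le> \<rho>) :: real)" for \<rho> x
  obtain V g0 where V: "V \<in> sets borel" "V \<subseteq> W" "AE x in lborel. x \<in> W \<longleftrightarrow> x \<in> V"
    and g0: "g0 \<in> borel_measurable borel" "\<And>x. x \<in> V \<Longrightarrow> g0 x = g x" "\<And>x. x \<notin> V \<Longrightarrow> g0 x = 0"
    using borel_version[OF W_meas g_meas] by blast
  obtain C1 where C1: "C1 \<ge> 0" "\<And>\<rho>. \<rho> > 0 \<Longrightarrow> measure lebesgue {x \<in> W. infdist x (frontier W) \<le> \<rho>} \<le> C1 * \<rho>"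
    using boundary_layer_constant[OF W_meas W_vol boundary] by blast
  obtain C2 where C2: "C2 > 0" "\<And>\<rho>. \<rho> > 0 \<Longrightarrow> (\<integral>x. of_bool (infdist x (frontier W) \<le> \<rho>) * \<bar>g x\<bar> \<partial>lebesgue_on W) \<le> C2 * \<rho>"
    using g_boundary by blast
  define C where "C = max C1 C2"
  have C: "C \<ge> 0" "\<And>\<rho>. \<rho> > 0 \<Longrightarrow> measure lebesgue {x \<in> W. infdist x (frontier W) \<le> \<rho>} \<le> C * \<rho>"
    "\<And>\<rho>. \<rho> > 0 \<Longrightarrow> (\<integral>x. of_bool (infdist x (frontier W) \<le> \<rho>) * \<bar>g x\<bar> \<partial>lebesgue_on W) \<le> C * \<rho>"
  proof -
    show "C \<ge> 0" using C1(1) by (simp add: C_def)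
    fix \<rho> :: real assume \<rho>: "\<rho> > 0"
    have le: "C1 * \<rho> \<le> C * \<rho>" "C2 * \<rho> \<le> C * \<rho>" using \<rho> by (auto simp: C_def intro!: mult_right_mono)
    show "measure lebesgue {x \<in> W. infdist x (frontier W) \<le> \<rho>} \<le> C * \<rho>" using C1(2)[OF \<rho>] le by linarith
    show "(\<integral>x. of_bool (infdist x (frontier W) \<le> \<rho>) * \<bar>g x\<bar> \<partial>lebesgue_on W) \<le> C * \<rho>" using C2(2)[OF \<rho>] le by linarith
  qed
  have win: "window (indicator V) g0 near C"
    unfolding near_def by (rule window_borel_version[OF W_meas W_vol g_meas g_L3 g_int C V g0])
  have "\<forall>\<^sub>F n in sequentially. a n < 1" using order_tendstoD(2)[OF a_lim, of 1] by simp
  then obtain n1 where n1: "\<And>n. n \<ge> n1 \<Longrightarrow> a n < 1" unfolding eventually_sequentially by blast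
  define n0 where "n0 = max n1 1"
  have n0: "n0 \<ge> 1" "\<And>n. n \<ge> n0 \<Longrightarrow> a n \<le> 1" using n1 by (auto simp: n0_def less_imp_le)
  \<comment> \<open>Only \<open>n \<ge> n0\<close> matters for the limits.  Making the sequences constant before \<open>n0\<close> gives them, for
     every \<open>n\<close>, the positivity and the bound \<open>a' n \<le> 1\<close> that the locale requires.\<close>
  define r' where "r' n = r (max n n0)" for n
  define a' where "a' n = a (max n n0)" for n
  have r': "r' n = r n" and a': "a' n = a n" if "n \<ge> n0" for n
    using that by (auto simp: r'_def a'_def max_def)
  have tail: "\<forall>\<^sub>F n in sequentially. n0 \<le> n" by (rule eventually_ge_at_top)
  have r'_pos: "r' n > 0" for n using r_pos n0(1) by (simp add: r'_def)
  have powr_d: "r' n powr d = r n ^ DIM('a)" if "n \<ge> n0" for n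
    using r'_pos[of n] r'[OF that] by (simp add: d_def powr_realpow)
  interpret S: shrinking_window_kernels "indicator V" g0 near C r' a' \<beta> d
  proof (intro shrinking_window_kernels.intro win shrinking_window_kernels_axioms.intro)
    show "d = real DIM('a)" by (rule d_def)
    show "r' n > 0" for n by (rule r'_pos)
    show "r' \<longlonglongrightarrow> 0"
      by (rule Lim_transform_eventually[OF r_lim]) (use tail in eventually_elim, simp add: r')
    show "a' n > 0" for n using a_pos n0(1) by (simp add: a'_def)
    show "a' n \<le> 1" for n using n0(2) by (simp add: a'_def)
    show "a' \<longlonglongrightarrow> 0"
      by (rule Lim_transform_eventually[OF a_lim]) (use tail in eventually_elim, simp add: a')
    show "indicator V x + a' n * g0 x \<ge> 0" for n x
    proof (cases "x \<in> V")
      case True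
      then show ?thesis using dens_nonneg[of "max n n0" x] n0(1) V(2) g0(2)[OF True] by (auto simp: a'_def)
    qed (simp add: g0(3))
    show "\<beta> > - d / 2" using beta by (simp add: d_def)
    show "filterlim (\<lambda>n. (real n)\<^sup>2 * r' n powr d) at_top sequentially"
      by (rule filterlim_mono_eventually[OF n2rd order_refl order_refl])
        (use tail in eventually_elim, simp add: powr_d)
    show "(\<lambda>n. real n * r' n powr (d + 1)) \<longlonglongrightarrow> 0"
      by (rule Lim_transform_eventually[OF nrd1])
        (use tail in eventually_elim, simp add: powr_add powr_d r'[symmetric] abs_of_pos[OF r'_pos])
  qed
  have A_eq: "real n * r n powr (real DIM('a) / 2) * (a n)\<^sup>2 = S.A n" if "n \<ge> n0" for n
    using that by (simp add: S.A_def r' a' d_def[symmetric])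
  have A_lim: "S.A \<longlonglongrightarrow> \<gamma>" if "(\<lambda>n. real n * r n powr (real DIM('a) / 2) * (a n)\<^sup>2) \<longlonglongrightarrow> \<gamma>" for \<gamma>
    by (rule Lim_transform_eventually[OF that]) (use tail in eventually_elim, simp add: A_eq)
  have A_top: "filterlim S.A at_top sequentially"
    if "filterlim (\<lambda>n. real n * r n powr (real DIM('a) / 2) * (a n)\<^sup>2) at_top sequentially"
    by (rule filterlim_mono_eventually[OF that order_refl order_refl]) (use tail in eventually_elim, simp add: A_eq)
  have min_lim: "(\<lambda>n. min (S.E n) (r' n / a' n)) \<longlonglongrightarrow> 0"
    by (rule Lim_transform_eventually[OF min_cond]) (use tail in eventually_elim, simp add: S.E_def r' a' d_def[symmetric])
  have G2: "S.G2 = (\<integral>x. (g x)\<^sup>2 \<partial>lebesgue_on W)"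
    unfolding S.G2_def
    by (rule integral_lebesgue_on_borel[OF W_meas V(3,1), symmetric]) (use g_meas g0 in auto)
  have G2_pos: "S.G2 > 0"
  proof (rule ccontr)
    assume "\<not> S.G2 > 0"
    then have "S.G2 = 0" using S.G_nonneg(1) by linarith
    then have "(\<integral>x. (g0 x)\<^sup>2 \<partial>lborel) = 0" by (simp add: S.G2_def)
    moreover have "integrable lborel (\<lambda>x. (g0 x)\<^sup>2)" using S.g_square_integrable by (simp add: square_integrable_def)
    ultimately have "AE x in lborel. (g0 x)\<^sup>2 = 0" by (subst (asm) integral_nonneg_eq_0_iff_AE) auto
    then have "AE x in lborel. x \<in> W \<longrightarrow> g x = 0" using V(3) by eventually_elim (use g0(2) in auto)
    then have "AE x in lebesgue_on W. g x = 0"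
      using W_meas by (subst AE_restrict_space_iff) (auto intro: AE_completion)
    then show False using g_nonzero by contradiction
  qed
  have const: "sqrt (real DIM('a) * unit_ball_vol (real DIM('a)) * (2 * \<beta> + real DIM('a))) / (sqrt 2 * (\<beta> + real DIM('a)))
      = S.\<omega> / sqrt 2"
  proof -
    define v where "v = d * unit_ball_vol d"
    have v: "v > 0" using S.d_pos by (simp add: v_def)
    have "S.\<omega> = v / (\<beta> + d) / (sqrt v / sqrt (2 * \<beta> + d))"
      by (simp add: S.\<omega>_def S.\<kappa>1_def S.\<kappa>2_def v_def real_sqrt_divide)
    also have "\<dots> = (v / sqrt v) * sqrt (2 * \<beta> + d) / (\<beta> + d)" by (simp add: field_simps)
    also have "v / sqrt v = sqrt v" using v by (simp add: real_div_sqrt)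
    finally show ?thesis by (simp add: d_def[symmetric] v_def[symmetric] real_sqrt_mult)
  qed
  have scale: "edge_scale TYPE('a) \<beta> (r n) n = S.\<sigma> n" if "n \<ge> n0" for n
  proof -
    define k where "k = d * unit_ball_vol d / (2 * (2 * \<beta> + d))"
    have sqrt_r: "sqrt (r n powr (2 * \<beta> + d)) = r n powr (\<beta> + d / 2)"
      using S.sqrt_r_powr[of n] by (simp only: r'[OF that])
    have "S.Q n / 2 = k * r n powr (2 * \<beta> + d)"
      unfolding S.Q_def S.\<kappa>2_def r'[OF that] k_def by (simp add: mult.commute)
    then have "S.\<sigma> n = real n * (sqrt k * r n powr (\<beta> + d / 2))"
      unfolding S.\<sigma>_def by (simp only: real_sqrt_mult sqrt_r)
    then show ?thesis
      unfolding edge_scale_def d_def[symmetric] k_def[symmetric] by simp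
  qed
  have length_eq: "edge_length \<beta> (r n) n x = pair_sum (\<lambda>x y. S.kern n (x - y)) {1..n} x" if "n \<ge> n0" for n x
    by (simp add: edge_length_def pair_sum_def edge_kernel_def power_kernel_def r'[OF that])
  \<comment> \<open>The centring of each statistic differs from the true mean of the edge length; the differences are
     \<open>shift\<close> and, for the approximate centring, \<open>bias\<close> in addition.\<close>
  have exact: "T_exact W \<beta> (r n) n x = (S.Z n x + (S.shift n + 0))\<^sup>2" if n: "n \<ge> n0" for n x
  proof -
    have i: "(\<integral>p. edge_kernel \<beta> (r n) (fst p) (snd p) \<partial>(lebesgue_on W \<Otimes>\<^sub>M lebesgue_on W))
        = form (S.kern n) (indicator V) (indicator V)"
      unfolding r'[OF n] by (rule integral_edge_kernel[OF W_meas W_vol V(3,1)])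
    show ?thesis
      unfolding T_exact_def i length_eq[OF n] scale[OF n] S.Z_def S.shift_def
      by (simp add: add_divide_distrib[symmetric] algebra_simps)
  qed
  have approx: "T_approx \<beta> (r n) n x = (S.Z n x + (S.shift n + S.bias n))\<^sup>2" if n: "n \<ge> n0" for n x
  proof -
    have c: "real DIM('a) * unit_ball_vol (real DIM('a)) / (2 * (\<beta> + real DIM('a))) * real n * (real n - 1) * r n powr (\<beta> + real DIM('a))
        = real n * (real n - 1) / 2 * S.c n"
      unfolding S.c_def S.\<kappa>1_def r'[OF n] d_def[symmetric] by simp
    have telescope: "(L - p * e) / s = (L - p * t) / s + (p * (t - u) / s + p * (u - e) / s)" for L p e s t u :: real
      by (simp add: add_divide_distrib[symmetric] algebra_simps)
    show ?thesis
      unfolding T_approx_def c length_eq[OF n] scale[OF n] S.Z_def S.shift_def S.bias_def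
      by (rule arg_cong[where f = "\<lambda>z. z\<^sup>2"], rule telescope)
  qed
  have law: "distr (M n) borel (X n i) = S.P.law n" if "n \<ge> n0" "i \<in> {1..n}" for n i
  proof -
    have "n \<ge> 1" using that n0(1) by simp
    have "distr (M n) borel (X n i) = density lborel (\<lambda>x. ennreal (indicator V x + a n * g0 x))"
      by (rule has_lebesgue_density_distr[OF dens[OF \<open>n \<ge> 1\<close> that(2)] V(3,1) g0(1)]) (use g0 in auto)
    then show ?thesis unfolding S.P.law_def S.P.f_def unfolding a'[OF that(1)] .
  qed
  have restrict_Z: "(S.Z n (restrict x {1..n}) + u)\<^sup>2 = (S.Z n x + u)\<^sup>2" for n x u
    by (simp only: S.Z_def pair_sum_restrict)
  have Z_meas: "(\<lambda>x. (S.Z n x + u)\<^sup>2) \<in> borel_measurable (S.sample_law n)" for n u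
    using S.Z_measurable[of n] by measurable
  have transfer: "distr (M n) borel (\<lambda>\<omega>. (S.Z n (\<lambda>i. X n i \<omega>) + u)\<^sup>2) = distr (S.sample_law n) borel (\<lambda>x. (S.Z n x + u)\<^sup>2)"
      "(\<lambda>\<omega>. (S.Z n (\<lambda>i. X n i \<omega>) + u)\<^sup>2) \<in> borel_measurable (M n)"
    if n: "n \<ge> n0" for n u
  proof -
    have n1: "n \<ge> 1" using n n0(1) by simp
    note tr = iid_sample_distr[OF prob[OF n1] _ indep[OF n1] law[OF n] S.P.sets_law Z_meas restrict_Z]
    show "distr (M n) borel (\<lambda>\<omega>. (S.Z n (\<lambda>i. X n i \<omega>) + u)\<^sup>2) = distr (S.sample_law n) borel (\<lambda>x. (S.Z n x + u)\<^sup>2)"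
      "(\<lambda>\<omega>. (S.Z n (\<lambda>i. X n i \<omega>) + u)\<^sup>2) \<in> borel_measurable (M n)"
      by (rule tr; use n1 in simp)+
  qed
  have conclusion:
    "(\<forall>\<gamma>\<ge>0. (\<lambda>n. real n * r n powr (real DIM('a) / 2) * (a n)\<^sup>2) \<longlonglongrightarrow> \<gamma> \<longrightarrow>
       weak_conv_m (\<lambda>n. distr (M n) borel (\<lambda>\<omega>. T n (\<lambda>i. X n i \<omega>)))
         (shifted_normal_square
           (sqrt (real DIM('a) * unit_ball_vol (real DIM('a)) * (2 * \<beta> + real DIM('a)))
              / (sqrt 2 * (\<beta> + real DIM('a))) * \<gamma> * (\<integral>x. (g x)\<^sup>2 \<partial>lebesgue_on W)))) \<and>
     (filterlim (\<lambda>n. real n * r n powr (real DIM('a) / 2) * (a n)\<^sup>2) at_top sequentially \<longrightarrow>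
       tends_to_infinity_in_prob M (\<lambda>n \<omega>. T n (\<lambda>i. X n i \<omega>)))"
    if T: "\<And>n x. n \<ge> n0 \<Longrightarrow> T n x = (S.Z n x + (S.shift n + b n))\<^sup>2" and b: "b \<longlonglongrightarrow> 0" for T b
  proof (intro conjI allI impI)
    fix \<gamma> :: real assume "(\<lambda>n. real n * r n powr (real DIM('a) / 2) * (a n)\<^sup>2) \<longlonglongrightarrow> \<gamma>"
    from S.bounded_perturbation_limit[OF min_lim A_lim[OF this] b]
    show "weak_conv_m (\<lambda>n. distr (M n) borel (\<lambda>\<omega>. T n (\<lambda>i. X n i \<omega>)))
         (shifted_normal_square
           (sqrt (real DIM('a) * unit_ball_vol (real DIM('a)) * (2 * \<beta> + real DIM('a)))
              / (sqrt 2 * (\<beta> + real DIM('a))) * \<gamma> * (\<integral>x. (g x)\<^sup>2 \<partial>lebesgue_on W)))"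
      unfolding const G2
      by (rule weak_conv_m_eventually_cong) (use tail in eventually_elim, simp only: T transfer(1))
  next
    assume "filterlim (\<lambda>n. real n * r n powr (real DIM('a) / 2) * (a n)\<^sup>2) at_top sequentially"
    note big = S.large_perturbation_limit[OF min_lim A_top[OF this] b G2_pos]
    show "tends_to_infinity_in_prob M (\<lambda>n \<omega>. T n (\<lambda>i. X n i \<omega>))"
      unfolding tends_to_infinity_in_prob_def
    proof (intro allI impI)
      fix B :: real assume B: "B > 0"
      show "(\<lambda>n. measure (M n) {\<omega> \<in> space (M n). T n (\<lambda>i. X n i \<omega>) > B}) \<longlonglongrightarrow> 1"
      proof (rule Lim_transform_eventually[OF big[OF B]], use tail in eventually_elim)
        fix n assume n: "n0 \<le> n"
        define u where "u = S.shift n + b n"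
        have "measure (S.sample_law n) {x \<in> space (S.sample_law n). (S.Z n x + u)\<^sup>2 > B}
            = measure (distr (S.sample_law n) borel (\<lambda>x. (S.Z n x + u)\<^sup>2)) {B<..}"
          by (rule measure_exceeds_distr[OF Z_meas])
        also have "\<dots> = measure (distr (M n) borel (\<lambda>\<omega>. (S.Z n (\<lambda>i. X n i \<omega>) + u)\<^sup>2)) {B<..}"
          by (simp only: transfer(1)[OF n])
        also have "\<dots> = measure (M n) {\<omega> \<in> space (M n). (S.Z n (\<lambda>i. X n i \<omega>) + u)\<^sup>2 > B}"
          by (rule measure_exceeds_distr[OF transfer(2)[OF n], symmetric])
        finally show "measure (S.sample_law n) {x \<in> space (S.sample_law n). (S.Z n x + (S.shift n + b n))\<^sup>2 > B}
            = measure (M n) {\<omega> \<in> space (M n). T n (\<lambda>i. X n i \<omega>) > B}"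
          by (simp only: T[OF n] u_def)
      qed
    qed
  qed
  show ?thesis
  proof (rule conjI, goal_cases)
    case 1
    show ?case
      by (rule conclusion[of "\<lambda>n. T_exact W \<beta> (r n) n" "\<lambda>_. 0"]) (simp_all only: exact tendsto_const)
  next
    case 2
    show ?case
    proof (rule impI, goal_cases)
      case 1
      then have "(\<lambda>n. (real n)\<^sup>2 * r' n powr (d + 2)) \<longlonglongrightarrow> 0"
        by (rule Lim_transform_eventually)
          (use tail in eventually_elim, simp add: powr_add powr_d r'[symmetric] power_add power2_eq_square powr_numeral[OF less_imp_le[OF r'_pos]])
      from S.bias_limit[OF this] show ?case
        by (intro conclusion[of "\<lambda>n. T_approx \<beta> (r n) n" S.bias]) (simp_all only: approx)
    qed
  qed
qed

end
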